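(* Let $(x,\Phi)$ be a minimizer of the Crisanti–Sommers functional $\mathscr C(\cdot,\cdot)$ with constraint $Q$, and let $\mu_P$ be the measure with $\mu_P([0,t])=x(t)$. For every $t\in\mathrm{supp}\,\mu_P$, $$\xi'(\Phi(t))+\vec h\vec h^T=\int_0^t\hat\Phi(s)^{-1}\Phi'(s)\hat\Phi(s)^{-1}\,ds .$$
   Context: Fix $m\ge1$. For each $p\ge2$ let $\vec\beta_p\in\mathbb R^m$, with $\vec\beta_p=0$ for odd $p$ and $\sum_{p\ge2}2^p\vec\beta_p(j)^2<\infty$ for every $1\le j\le m$; let $\vec h\in\mathbb R^m$. (The inverse temperature is absorbed into $\xi$ and $\vec h$.) $\odot$ is the entrywise product, $A^{\circ p}$ the entrywise $p$-th power, $\langle\cdot,\cdot\rangle$ the Frobenius inner product, $|A|$ the determinant. $\vec\beta_p\otimes\vec\beta_p=(\vec\beta_p(i)\vec\beta_p(j))_{i,j}$, $\xi(A)=\sum_p(\vec\beta_p\otimes\vec\beta_p)\odot A^{\circ p}$, $\xi'(A)=\sum_pp(\vec\beta_p\otimes\vec\beta_p)\odot A^{\circ(p-1)}$. $\mathbb S^m_+$ is the set of symmetric positive semidefinite $m\times m$ matrices. $Q\in\mathbb S^m_+$ has entries in $[-1,1]$ and diagonal entries $1$. Admissible pairs $(x,\Phi)$: $x:[0,m]\to[0,1]$ is right-continuous and nondecreasing with $x(0^-)=0$, $x(m)=1$, with associated probability measure $\mu_P([0,t])=x(t)$; $\Phi\in\mathscr M$, i.e. $\Phi:[0,m]\to\mathbb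 S^m_+$ is a continuously differentiable, Lipschitz, monotone (Loewner-nondecreasing) path with Lipschitz derivative, $\Phi(0)=0$, $\Phi(m)=Q$, and $\mathrm{Trace}(\Phi(t))=t$ for $t\in\mathrm{supp}\,\mu_P$; and $|Q-\Phi(t_x)|>0$ where $t_x=\inf\{t:x(t)=1\}$. Put $\hat\Phi(t)=\int_t^mx(s)\Phi'(s)ds$. For $\hat T\in(t_x,m)$ with $|Q-\Phi(\hat T)|>0$ (the value does not depend on $\hat T$), $$\mathscr C(x,\Phi)=\tfrac12\Big[\int_0^mx(t)\langle\xi'(\Phi(t))+\vec h\vec h^T,\Phi'(t)\rangle dt+\log|\Phi(m)-\Phi(\hat T)|+\int_0^{\hat T}\langle\hat\Phi(t)^{-1},\Phi'(t)\rangle dt\Big].$$ A minimizer is a pair minimizing $\mathscr C$ over all admissible pairs. *)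

theory Defs
  imports "HOL-Analysis.Analysis"
begin

text \<open>
  The dimension \<open>m\<close> is \<open>CARD('n)\<close>; matrices are elements of \<open>real ^ 'n ^ 'n\<close>, on which the library's
  inner product is the Frobenius one. Functions on \<open>[0, m]\<close> are total functions on the reals, and
  every notion below depends only on their values on \<open>[0, m]\<close>.
\<close>

definition outer_prod :: "real ^ 'n \<Rightarrow> real ^ 'n \<Rightarrow> real ^ 'n ^ 'n"
  where "outer_prod u v = (\<chi> i j. u $ i * v $ j)"

definition psd :: "real ^ 'n ^ 'n \<Rightarrow> bool"
  where "psd A \<longleftrightarrow> transpose A = A \<and> (\<forall>v. 0 \<le> v \<bullet> (A *v v))"

definition loewner_mono_on :: "real set \<Rightarrow> (real \<Rightarrow> real ^ 'n ^ 'n) \<Rightarrow> bool"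
  where "loewner_mono_on S \<Phi> \<longleftrightarrow> (\<forall>s\<in>S. \<forall>t\<in>S. s \<le> t \<longrightarrow> psd (\<Phi> t - \<Phi> s))"

definition xi' :: "(nat \<Rightarrow> real ^ 'n) \<Rightarrow> real ^ 'n ^ 'n \<Rightarrow> real ^ 'n ^ 'n"
  where "xi' \<beta> A = (\<chi> i j. \<Sum>\<^sub>\<infinity>p\<in>{2..}.
           real p * outer_prod (\<beta> p) (\<beta> p) $ i $ j * (A $ i $ j) ^ (p - 1))"

definition order_param :: "real \<Rightarrow> (real \<Rightarrow> real) \<Rightarrow> bool"
  where "order_param m x \<longleftrightarrow>
           x ` {0..m} \<subseteq> {0..1} \<and> mono_on {0..m} x \<and>
           (\<forall>t\<in>{0..<m}. continuous (at_right t) x) \<and> x m = 1"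

text \<open>
  The Stieltjes measure of \<open>x\<close>. The extension by \<open>0\<close> to the left of \<open>0\<close> is the convention
  \<open>x(0-) = 0\<close>: the point \<open>0\<close> carries mass \<open>x 0\<close>.
\<close>

definition parisi_measure :: "real \<Rightarrow> (real \<Rightarrow> real) \<Rightarrow> real measure"
  where "parisi_measure m x = interval_measure (\<lambda>t. if t < 0 then 0 else x (min t m))"

definition measure_support :: "real measure \<Rightarrow> real set"
  where "measure_support M = {t. \<forall>U. open U \<and> t \<in> U \<longrightarrow> 0 < emeasure M U}"

definition top_time :: "real \<Rightarrow> (real \<Rightarrow> real) \<Rightarrow> real"
  where "top_time m x = Inf {t \<in> {0..m}. x t = 1}"

definition path_deriv :: "(real \<Rightarrow> real ^ 'n ^ 'n) \<Rightarrow> real \<Rightarrow> real ^ 'n ^ 'n"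
  where "path_deriv \<Phi> t = vector_derivative \<Phi> (at t within {0..real CARD('n)})"

definition psd_path :: "real ^ 'n ^ 'n \<Rightarrow> (real \<Rightarrow> real ^ 'n ^ 'n) \<Rightarrow> bool"
  where "psd_path Q \<Phi> \<longleftrightarrow> (let m = real CARD('n) in
           (\<forall>t\<in>{0..m}. psd (\<Phi> t)) \<and>
           \<Phi> differentiable_on {0..m} \<and> continuous_on {0..m} (path_deriv \<Phi>) \<and>
           (\<exists>L. L-lipschitz_on {0..m} \<Phi>) \<and> (\<exists>L. L-lipschitz_on {0..m} (path_deriv \<Phi>)) \<and>
           loewner_mono_on {0..m} \<Phi> \<and> \<Phi> 0 = 0 \<and> \<Phi> m = Q)"

definition admissible ::
    "real ^ 'n ^ 'n \<Rightarrow> (real \<Rightarrow> real) \<Rightarrow> (real \<Rightarrow> real ^ 'n ^ 'n) \<Rightarrow> bool"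
  where "admissible Q x \<Phi> \<longleftrightarrow> (let m = real CARD('n) in
           order_param m x \<and> psd_path Q \<Phi> \<and>
           (\<forall>t\<in>measure_support (parisi_measure m x). trace (\<Phi> t) = t) \<and>
           0 < det (Q - \<Phi> (top_time m x)))"

definition hat_path ::
    "(real \<Rightarrow> real) \<Rightarrow> (real \<Rightarrow> real ^ 'n ^ 'n) \<Rightarrow> real \<Rightarrow> real ^ 'n ^ 'n"
  where "hat_path x \<Phi> t = integral {t..real CARD('n)} (\<lambda>s. x s *\<^sub>R path_deriv \<Phi> s)"

definition crisanti_sommers_at ::
    "real \<Rightarrow> (nat \<Rightarrow> real ^ 'n) \<Rightarrow> real ^ 'n \<Rightarrow>
     (real \<Rightarrow> real) \<Rightarrow> (real \<Rightarrow> real ^ 'n ^ 'n) \<Rightarrow> real"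
  where "crisanti_sommers_at T \<beta> h x \<Phi> = (let m = real CARD('n) in
           1 / 2 * (integral {0..m} (\<lambda>t. x t * ((xi' \<beta> (\<Phi> t) + outer_prod h h) \<bullet> path_deriv \<Phi> t))
                    + ln (det (\<Phi> m - \<Phi> T))
                    + integral {0..T} (\<lambda>t. matrix_inv (hat_path x \<Phi> t) \<bullet> path_deriv \<Phi> t)))"

text \<open>
  For an admissible pair the value at \<open>T\<close> does not depend on the choice of \<open>T\<close> in \<open>(t\<^sub>x, m)\<close> with
  \<open>0 < det (Q - \<Phi> T)\<close>, and such a \<open>T\<close> exists, because \<open>det (Q - \<Phi> t)\<close> is continuous in \<open>t\<close>, positive
  at \<open>t\<^sub>x\<close> and zero at \<open>m\<close>.
\<close>

definition crisanti_sommers ::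
    "(nat \<Rightarrow> real ^ 'n) \<Rightarrow> real ^ 'n \<Rightarrow> (real \<Rightarrow> real) \<Rightarrow> (real \<Rightarrow> real ^ 'n ^ 'n) \<Rightarrow> real"
  where "crisanti_sommers \<beta> h x \<Phi> = (let m = real CARD('n) in
           crisanti_sommers_at
             (SOME T. top_time m x < T \<and> T < m \<and> 0 < det (\<Phi> m - \<Phi> T)) \<beta> h x \<Phi>)"

definition cs_minimizer ::
    "real ^ 'n ^ 'n \<Rightarrow> (nat \<Rightarrow> real ^ 'n) \<Rightarrow> real ^ 'n \<Rightarrow>
     (real \<Rightarrow> real) \<Rightarrow> (real \<Rightarrow> real ^ 'n ^ 'n) \<Rightarrow> bool"
  where "cs_minimizer Q \<beta> h x \<Phi> \<longleftrightarrow>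
           admissible Q x \<Phi> \<and>
           (\<forall>y \<Psi>. admissible Q y \<Psi> \<longrightarrow> crisanti_sommers \<beta> h x \<Phi> \<le> crisanti_sommers \<beta> h y \<Psi>)"

lemma parisi_measure_Icc:
  assumes x: "order_param m x" and m: "0 \<le> m"
  shows "t \<in> {0..m} \<Longrightarrow> emeasure (parisi_measure m x) {0..t} = ennreal (x t)"
    and "emeasure (parisi_measure m x) UNIV = 1"
proof -
  define F where "F = (\<lambda>t. if t < 0 then 0 else x (min t m))"
  have M: "parisi_measure m x = interval_measure F"
    by (simp add: parisi_measure_def F_def)
  have nonneg: "0 \<le> x t" if "t \<in> {0..m}" for t
    using x that by (force simp: order_param_def)
  have xm: "x m = 1" using x by (simp add: order_param_def)
  have mono: "F s \<le> F t" if "s \<le> t" for s t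
    using x that m nonneg[of "min t m"]
    by (auto simp: F_def order_param_def intro!: mono_onD[of "{0..m}" x])
  have rc: "continuous (at_right a) F" for a
  proof -
    consider "a < 0" | "0 \<le> a" "a < m" | "m \<le> a" by linarith
    then show ?thesis
    proof cases
      case 1
      have "\<forall>\<^sub>F t in at_right a. F t = 0"
        using eventually_at_right_real[OF 1] by eventually_elim (auto simp: F_def)
      then show ?thesis
        using 1 by (simp add: continuous_within F_def tendsto_eventually)
    next
      case 2
      have "\<forall>\<^sub>F t in at_right a. x t = F t"
        using eventually_at_right_real[OF 2(2)]
        by eventually_elim (use 2 in \<open>auto simp: F_def\<close>)
      moreover have "(x \<longlongrightarrow> x a) (at_right a)"
        using x 2 by (auto simp: order_param_def continuous_within)
      moreover have "F a = x a" using 2 by (simp add: F_def)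
      ultimately show ?thesis
        by (simp add: continuous_within Lim_transform_eventually)
    next
      case 3
      have "\<forall>\<^sub>F t in at_right a. F t = 1"
        using eventually_at_right_less[of a]
        by eventually_elim (use 3 m xm in \<open>auto simp: F_def min_def\<close>)
      moreover have "F a = 1" using 3 m xm by (auto simp: F_def min_def)
      ultimately show ?thesis
        by (simp add: continuous_within tendsto_eventually)
    qed
  qed
  have Ioc: "emeasure (interval_measure F) {a<..b} = ennreal (F b - F a)" if "a \<le> b" for a b
    using emeasure_interval_measure_Ioc[OF that mono rc] by simp
  show "emeasure (parisi_measure m x) {0..t} = ennreal (x t)" if t: "t \<in> {0..m}"
  proof -
    let ?A = "\<lambda>n::nat. {- inverse (real (Suc n))<..t}"
    have em: "emeasure (interval_measure F) (?A n) = ennreal (x t)" for n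
      using t Ioc[of "- inverse (real (Suc n))" t]
      by (simp add: F_def min_def) (smt (verit) inverse_nonnegative_iff_nonnegative of_nat_0_le_iff)
    have "(\<lambda>n. emeasure (interval_measure F) (?A n)) \<longlonglongrightarrow> emeasure (interval_measure F) (\<Inter>n. ?A n)"
    proof (rule Lim_emeasure_decseq)
      have "inverse (real (Suc n)) \<le> inverse (real (Suc k))" if "k \<le> n" for k n
        using that by (intro le_imp_inverse_le) auto
      then show "decseq ?A" unfolding decseq_def by (smt (verit) greaterThanAtMost_iff subsetI)
    qed (use em in auto)
    moreover have "(\<Inter>n. ?A n) = {0..t}"
    proof (intro set_eqI iffI)
      fix s assume s: "s \<in> (\<Inter>n. ?A n)"
      then have "\<forall>n. - inverse (real (Suc n)) < s" "s \<le> t" by auto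
      moreover have "0 \<le> s"
        using reals_Archimedean[of "- s"] \<open>\<forall>n. - inverse (real (Suc n)) < s\<close>
        by (meson not_less neg_0_less_iff_less minus_less_iff order_less_asym)
      ultimately show "s \<in> {0..t}" by simp
    next
      fix s assume "s \<in> {0..t}"
      moreover have "- inverse (real (Suc n)) < 0" for n by simp
      ultimately show "s \<in> (\<Inter>n. ?A n)" by (smt (verit) INT_I atLeastAtMost_iff greaterThanAtMost_iff)
    qed
    ultimately have "(\<lambda>n::nat. ennreal (x t)) \<longlonglongrightarrow> emeasure (interval_measure F) {0..t}"
      by (simp only: em)
    then show ?thesis
      unfolding M by (metis LIMSEQ_unique tendsto_const)
  qed
  let ?B = "\<lambda>n::nat. {- 1 - real n<..m + real n}"
  have em: "emeasure (interval_measure F) (?B n) = 1" for n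
    using Ioc[of "- 1 - real n" "m + real n"] m xm by (simp add: F_def min_def)
  have "(\<lambda>n. emeasure (interval_measure F) (?B n)) \<longlonglongrightarrow> emeasure (interval_measure F) (\<Union>n. ?B n)"
    by (rule Lim_emeasure_incseq) (auto simp: incseq_def)
  moreover have "(\<Union>n. ?B n) = UNIV"
  proof -
    have "s \<in> (\<Union>n. ?B n)" for s
    proof -
      obtain n :: nat where "\<bar>s\<bar> \<le> real n" using real_arch_simple by blast
      then show ?thesis using m by (intro UN_I[of n]) auto
    qed
    then show ?thesis by blast
  qed
  ultimately show "emeasure (parisi_measure m x) UNIV = 1"
    unfolding M em by (metis LIMSEQ_unique tendsto_const)
qed

end

theory Submission
  imports Defs
begin

text \<open>
  Write \<open>m\<close> for the dimension, \<open>\<mu>\<close> for the measure of \<open>x\<close>, \<open>T\<close> for the top time, \<open>H\<close> for the hat path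
  and \<open>D t\<close> for the difference of the two sides of the claimed identity. Only the restriction of \<open>\<Phi>\<close>
  to \<open>[0, T]\<close> matters, where \<open>H\<close> is uniformly positive definite. If \<open>\<eta>\<close> is a path whose initial value is
  positive definite and \<open>\<Phi>' + \<epsilon> \<eta>'\<close> is positive semidefinite for some \<open>\<epsilon> > 0\<close>, then for small \<open>\<epsilon>\<close>
  the path \<open>\<Phi> + \<epsilon> \<eta>\<close> can be joined to \<open>0\<close> and \<open>Q\<close>, and the new time \<open>t + \<epsilon> trace (\<eta> t)\<close> restores
  the trace condition on the support, so that minimality yields \<open>\<integral> \<langle>D, \<eta>\<rangle> d\<mu> \<le> 0\<close>.

  The direction \<open>\<eta> = H D H\<close> is a limit of such directions: \<open>\<eta> 0 = H 0 h h\<^sup>T H 0\<close>, and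
  \<open>\<eta>' = H (\<xi>'(\<Phi>))' H - \<Phi>' - x (\<Phi>' D H + H D \<Phi>')\<close>, where the first term is positive semidefinite by
  the Schur product theorem and the others are infinitesimal congruences of \<open>\<Phi>'\<close>. Hence
  \<open>\<integral> trace (D H D H) d\<mu> \<le> 0\<close>; since \<open>trace (D H D H) \<ge> c\<^sup>2 \<bar>D\<bar>\<^sup>2\<close> for some \<open>c > 0\<close>, \<open>D\<close> vanishes
  on the support.
\<close>

subsection \<open>Positive semidefinite matrices\<close>

text \<open>Monotonicity is a one-sided constraint: \<Phi>' may be singular, so a direction and its
  negative need not both be allowed, and the variation yields only an inequality. This is enough
  because the direction is built from the unknown defect D itself and pairs with it to a definite
  quadratic form. The factors H answer the constraint: D contains minus the integral of H^-1 \<Phi>'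
  H^-1, and flanking by H turns the derivative of this term into -\<Phi>', which a multiple of
  \<Phi>' absorbs. The order parameter is only transported to the new time. Positive definiteness of
  \<eta> 0 and of the gap to Q at T buys time at both ends: the traces of these two matrices are the
  lengths of the intervals on which the path is completed. There the order parameter is 0 and 1, and
  the functional sees only the increments of the path. Two defects keep H D H from being an allowed
  direction: its derivative jumps with x, while paths must have a Lipschitz derivative, and its
  initial value has rank at most one. Smoothing x and adding a small multiple of the identity repair
  them, and a second-order term completes the infinitesimal congruence to a genuine one.\<close>

lemma inner_outer_prod: "A \<bullet> outer_prod v w = v \<bullet> (A *v w)"
  for A :: "real ^ 'n ^ 'n"
  by (simp add: inner_vec_def outer_prod_def matrix_vector_mult_def sum_distrib_left mult_ac)

text \<open>Pairing with \<open>outer_prod v v\<close> makes the quadratic form a linear functional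
  of the matrix, so that positivity passes to sums, limits and integrals.\<close>

lemma psd_iff: "psd A \<longleftrightarrow> transpose A = A \<and> (\<forall>v. 0 \<le> A \<bullet> outer_prod v v)"
  by (simp add: psd_def inner_outer_prod)

lemma bounded_linear_transpose: "bounded_linear (transpose :: real ^ 'n ^ 'm \<Rightarrow> real ^ 'm ^ 'n)"
  by (rule linear_conv_bounded_linear[THEN iffD1], rule linearI)
     (simp_all add: transpose_def vec_eq_iff)

lemma bounded_linear_trace: "bounded_linear (trace :: real ^ 'n ^ 'n \<Rightarrow> real)"
  by (rule linear_conv_bounded_linear[THEN iffD1], rule linearI)
     (simp_all add: trace_def sum.distrib sum_distrib_left)

lemma transpose_add: "transpose (A + B) = transpose A + transpose B"
  and transpose_diff: "transpose (A - B) = transpose A - transpose B"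
  and transpose_minus: "transpose (- A) = - transpose A"
  for A B :: "real ^ 'n ^ 'm"
  by (simp_all add: transpose_def vec_eq_iff)

lemma bounded_bilinear_matrix_mult:
  "bounded_bilinear ((**) :: real ^ 'n ^ 'm \<Rightarrow> real ^ 'k ^ 'n \<Rightarrow> real ^ 'k ^ 'm)"
  by (rule bilinear_conv_bounded_bilinear[THEN iffD1])
     (auto simp: bilinear_def linear_iff matrix_matrix_mult_def vec_eq_iff algebra_simps
        sum.distrib sum_distrib_left)

lemmas matrix_mult_algebra =
  bounded_bilinear.add_left[OF bounded_bilinear_matrix_mult]
  bounded_bilinear.add_right[OF bounded_bilinear_matrix_mult]
  bounded_bilinear.diff_left[OF bounded_bilinear_matrix_mult]
  bounded_bilinear.diff_right[OF bounded_bilinear_matrix_mult]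
  bounded_bilinear.minus_left[OF bounded_bilinear_matrix_mult]
  bounded_bilinear.minus_right[OF bounded_bilinear_matrix_mult]
  bounded_bilinear.scaleR_left[OF bounded_bilinear_matrix_mult]
  bounded_bilinear.scaleR_right[OF bounded_bilinear_matrix_mult]

lemma inner_matrix_mult_left: "(A ** B) \<bullet> C = B \<bullet> (transpose A ** C)"
  for A B C :: "real ^ 'n ^ 'n"
proof -
  have "(A ** B) \<bullet> C = (\<Sum>i\<in>UNIV. \<Sum>j\<in>UNIV. \<Sum>k\<in>UNIV. A$i$k * B$k$j * C$i$j)"
    by (simp add: inner_vec_def matrix_matrix_mult_def sum_distrib_right)
  also have "\<dots> = (\<Sum>i\<in>UNIV. \<Sum>k\<in>UNIV. \<Sum>j\<in>UNIV. A$i$k * B$k$j * C$i$j)"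
    by (intro sum.cong refl sum.swap)
  also have "\<dots> = (\<Sum>k\<in>UNIV. \<Sum>i\<in>UNIV. \<Sum>j\<in>UNIV. A$i$k * B$k$j * C$i$j)"
    by (rule sum.swap)
  also have "\<dots> = (\<Sum>k\<in>UNIV. \<Sum>j\<in>UNIV. \<Sum>i\<in>UNIV. A$i$k * B$k$j * C$i$j)"
    by (intro sum.cong refl sum.swap)
  also have "\<dots> = B \<bullet> (transpose A ** C)"
    by (simp add: inner_vec_def matrix_matrix_mult_def transpose_def sum_distrib_left mult_ac)
  finally show ?thesis .
qed

lemma inner_transpose: "transpose A \<bullet> transpose B = A \<bullet> B"
  for A B :: "real ^ 'n ^ 'm"
  by (simp add: inner_vec_def transpose_def) (rule sum.swap)

lemma inner_matrix_mult_right: "(A ** B) \<bullet> C = A \<bullet> (C ** transpose B)"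
  for A B C :: "real ^ 'n ^ 'n"
proof -
  have "(A ** B) \<bullet> C = (transpose B ** transpose A) \<bullet> transpose C"
    by (simp add: inner_transpose matrix_transpose_mul[symmetric])
  also have "\<dots> = transpose A \<bullet> (B ** transpose C)"
    by (simp add: inner_matrix_mult_left)
  also have "\<dots> = transpose A \<bullet> transpose (C ** transpose B)"
    by (simp add: matrix_transpose_mul)
  also have "\<dots> = A \<bullet> (C ** transpose B)"
    by (rule inner_transpose)
  finally show ?thesis .
qed

lemma psd_add: "psd A \<Longrightarrow> psd B \<Longrightarrow> psd (A + B)"
  by (simp add: psd_iff transpose_add inner_add_left)

lemma psd_scaleR: "0 \<le> r \<Longrightarrow> psd A \<Longrightarrow> psd (r *\<^sub>R A)"
  by (simp add: psd_iff transpose_scalar)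

lemma psd_zero [simp]: "psd 0"
  by (simp add: psd_iff transpose_def vec_eq_iff)

lemma psd_mat_1: "psd (mat 1)"
  by (simp add: psd_def)

lemma psd_outer_prod: "psd (outer_prod u u)"
proof -
  have "v \<bullet> (outer_prod u u *v v) = (u \<bullet> v)\<^sup>2" for v
    by (simp add: outer_prod_def matrix_vector_mult_def inner_vec_def power2_eq_square
        sum_distrib_left sum_distrib_right mult_ac)
  then show ?thesis
    by (auto simp: psd_def outer_prod_def transpose_def vec_eq_iff mult.commute)
qed

lemma psd_congruence: "psd A \<Longrightarrow> psd (transpose B ** A ** B)"
  for A B :: "real ^ 'n ^ 'n"
proof -
  assume A: "psd A"
  have "v \<bullet> (transpose B *v z) = (B *v v) \<bullet> z" for v z :: "real ^ 'n"
    by (metis dot_lmul_matrix vector_transpose_matrix)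
  then have "v \<bullet> ((transpose B ** A ** B) *v v) = (B *v v) \<bullet> (A *v (B *v v))" for v
    by (simp add: matrix_vector_mul_assoc[symmetric])
  then show ?thesis
    using A by (simp add: psd_def matrix_transpose_mul matrix_mul_assoc)
qed

lemma psd_congruence_sym: "psd A \<Longrightarrow> transpose B = B \<Longrightarrow> psd (B ** A ** B)"
  for A B :: "real ^ 'n ^ 'n"
  using psd_congruence[of A B] by simp

lemma psd_transpose: "psd A \<Longrightarrow> transpose A = A"
  by (simp add: psd_def)

lemma psd_limit:
  assumes "(f \<longlongrightarrow> A) F" "eventually (\<lambda>s. psd (f s)) F" "F \<noteq> bot"
  shows "psd (A :: real ^ 'n ^ 'n)"
proof -
  have "((\<lambda>s. transpose (f s)) \<longlongrightarrow> transpose A) F"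
    by (rule bounded_linear.tendsto[OF bounded_linear_transpose assms(1)])
  moreover have "eventually (\<lambda>s. transpose (f s) = f s) F"
    using assms(2) by eventually_elim (simp add: psd_def)
  ultimately have "(f \<longlongrightarrow> transpose A) F"
    by (rule Lim_transform_eventually)
  then have "transpose A = A"
    by (rule tendsto_unique[OF assms(3) _ assms(1)])
  moreover have "0 \<le> A \<bullet> outer_prod v v" for v
  proof (rule tendsto_lowerbound[OF _ _ assms(3)])
    show "((\<lambda>s. f s \<bullet> outer_prod v v) \<longlongrightarrow> A \<bullet> outer_prod v v) F"
      by (intro tendsto_intros assms(1))
    show "\<forall>\<^sub>F s in F. 0 \<le> f s \<bullet> outer_prod v v"
      using assms(2) by eventually_elim (simp add: psd_iff)
  qed
  ultimately show ?thesis by (simp add: psd_iff)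
qed

lemma psd_integral:
  fixes f :: "real \<Rightarrow> real ^ 'n ^ 'n"
  assumes "f integrable_on S" "\<And>s. s \<in> S \<Longrightarrow> psd (f s)"
  shows "psd (integral S f)"
proof -
  have "transpose (integral S f) = integral S (\<lambda>s. transpose (f s))"
    using integral_linear[OF assms(1) bounded_linear_transpose] by (simp add: o_def)
  also have "\<dots> = integral S f"
    by (rule integral_cong) (use assms in \<open>simp add: psd_def\<close>)
  finally have "transpose (integral S f) = integral S f" .
  moreover have "0 \<le> integral S f \<bullet> outer_prod v v" for v
  proof -
    have "integral S f \<bullet> outer_prod v v = integral S (\<lambda>s. f s \<bullet> outer_prod v v)"
      using integral_linear[OF assms(1) bounded_linear_inner_left[of "outer_prod v v"]]
      by (simp add: o_def)
    also have "\<dots> \<ge> 0"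
      by (rule integral_nonneg)
         (use assms integrable_linear[OF assms(1) bounded_linear_inner_left[of "outer_prod v v"]]
            in \<open>auto simp: psd_iff o_def\<close>)
    finally show ?thesis .
  qed
  ultimately show ?thesis by (simp add: psd_iff)
qed

lemma psd_entry: "psd A \<Longrightarrow> A $ i $ j = A $ j $ i"
  by (simp add: psd_def transpose_def vec_eq_iff)

lemma axis_quad: "axis i a \<bullet> (A *v axis j b) = a * b * A $ i $ j"
  for A :: "real ^ 'n ^ 'n"
  by (simp add: inner_axis') (simp add: matrix_vector_mult_def axis_def if_distrib cong: if_cong)

lemma psd_diag_nonneg: "psd A \<Longrightarrow> 0 \<le> A $ i $ i"
  using axis_quad[of i 1 A i 1] by (metis mult_1 psd_def)

lemma psd_trace_nonneg: "psd A \<Longrightarrow> 0 \<le> trace A"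
  by (simp add: trace_def sum_nonneg psd_diag_nonneg)

lemma psd_entry_bound: assumes "psd A" shows "\<bar>A $ i $ j\<bar> \<le> (A $ i $ i + A $ j $ j) / 2"
proof -
  have "0 \<le> (axis i 1 + axis j r) \<bullet> (A *v (axis i 1 + axis j r))" for r
    using assms by (simp add: psd_def)
  then have "0 \<le> A $ i $ i + 2 * r * A $ i $ j + r * r * A $ j $ j" for r
    using psd_entry[OF assms, of i j]
    by (simp add: matrix_vector_right_distrib inner_add_left inner_add_right axis_quad algebra_simps)
  from this[of 1] this[of "-1"] show ?thesis by (simp add: abs_le_iff)
qed

text \<open>Keeps every path below \<open>Q\<close> well inside the domain of the covariance series:
  comparison with \<open>Q\<close> bounds the diagonal entries by 1, and these control the
  others.\<close>

lemma psd_mono_entries: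
  assumes "psd A" "psd (Q - A)" "\<And>i. Q $ i $ i = 1"
  shows "A $ i $ j \<in> {-1..1}"
proof -
  have "A $ k $ k \<le> 1" for k
    using psd_diag_nonneg[OF assms(2), of k] assms(3)[of k] by simp
  from psd_entry_bound[OF assms(1), of i j] this[of i] this[of j] show ?thesis
    by (auto simp: abs_le_iff)
qed

lemma psd_Cauchy_Schwarz:
  assumes "psd A"
  shows "(v \<bullet> (A *v w))\<^sup>2 \<le> (v \<bullet> (A *v v)) * (w \<bullet> (A *v w))"
proof -
  let ?B = "\<lambda>v w. v \<bullet> (A *v w)"
  have sym: "?B w v = ?B v w" for v w
    using assms by (metis dot_lmul_matrix inner_commute psd_def transpose_matrix_vector)
  have nn: "0 \<le> ?B v v + 2 * r * ?B v w + r * r * ?B w w" for r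
  proof -
    have "0 \<le> ?B (v + r *\<^sub>R w) (v + r *\<^sub>R w)" using assms by (simp add: psd_def)
    also have "\<dots> = ?B v v + 2 * r * ?B v w + r * r * ?B w w"
      using sym[of w v]
      by (simp add: matrix_vector_right_distrib matrix_vector_mult_scaleR inner_add_left inner_add_right algebra_simps)
    finally show ?thesis .
  qed
  have w: "0 \<le> ?B w w" using assms by (simp add: psd_def)
  show ?thesis
  proof (cases "?B w w = 0")
    case True
    have "?B v w = 0"
    proof (rule ccontr)
      assume nz: "?B v w \<noteq> 0"
      \<comment> \<open>Without its quadratic term the form is affine in \<open>r\<close>; this
        value of \<open>r\<close> would make it -1.\<close>
      have "0 \<le> ?B v v + 2 * (- (?B v v + 1) / (2 * ?B v w)) * ?B v w"
        using nn[of "- (?B v v + 1) / (2 * ?B v w)"] True by simp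
      then show False using nz by (simp add: field_simps)
    qed
    then show ?thesis using True by simp
  next
    case False
    with w have pos: "0 < ?B w w" by simp
    from nn[of "- ?B v w / ?B w w"] have "0 \<le> ?B v v - ?B v w * ?B v w / ?B w w"
      using pos by (simp add: field_simps)
    then show ?thesis using pos by (simp add: field_simps power2_eq_square)
  qed
qed

section \<open>Hadamard products\<close>

definition hadamard :: "real ^ 'n ^ 'n \<Rightarrow> real ^ 'n ^ 'n \<Rightarrow> real ^ 'n ^ 'n"
  where "hadamard A B = (\<chi> i j. A $ i $ j * B $ i $ j)"

text \<open>The Hadamard product with \<open>outer_prod u u\<close> is the congruence by the
  diagonal matrix of \<open>u\<close>.\<close>

lemma hadamard_outer_prod_psd: "psd B \<Longrightarrow> psd (hadamard (outer_prod u u) B)"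
proof -
  assume B: "psd B"
  have "v \<bullet> (hadamard (outer_prod u u) B *v v) = (\<chi> i. u $ i * v $ i) \<bullet> (B *v (\<chi> i. u $ i * v $ i))" for v
    by (simp add: hadamard_def outer_prod_def matrix_vector_mult_def inner_vec_def sum_distrib_left mult_ac)
  moreover have "transpose (hadamard (outer_prod u u) B) = hadamard (outer_prod u u) B"
    using B psd_entry[OF B] by (simp add: hadamard_def outer_prod_def transpose_def vec_eq_iff mult.commute)
  ultimately show ?thesis using B by (simp add: psd_def)
qed

text \<open>Subtracting from \<open>A\<close> the rank-one part spanned by a nonvanishing diagonal entry (a step of the
  Cholesky algorithm) keeps it positive semidefinite and clears a row, hence the induction on the
  number of nonzero diagonal entries.\<close>

theorem Schur_product: "psd A \<Longrightarrow> psd B \<Longrightarrow> psd (hadamard A B)"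
proof (induction "card {i. A $ i $ i \<noteq> 0}" arbitrary: A rule: less_induct)
  case less
  show ?case
  proof (cases "\<exists>i. A $ i $ i \<noteq> 0")
    case False
    then have "A = 0"
      using psd_entry_bound[OF less.prems(1)] by (simp add: vec_eq_iff)
    then have "hadamard A B = 0" by (simp add: hadamard_def vec_eq_iff)
    then show ?thesis by simp
  next
    case True
    then obtain k where k: "A $ k $ k \<noteq> 0" by blast
    then have kpos: "0 < A $ k $ k" using psd_diag_nonneg[OF less.prems(1), of k] by simp
    define u where "u = (\<chi> i. A $ i $ k)"
    define A' where "A' = A - (1 / A $ k $ k) *\<^sub>R outer_prod u u"
    have "transpose A' = A'"
      using less.prems(1) psd_outer_prod[of u]
      by (simp add: A'_def transpose_diff transpose_scalar psd_def)
    moreover have "0 \<le> v \<bullet> (A' *v v)" for v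
    proof -
      have uv: "u \<bullet> v = v \<bullet> (A *v axis k 1)"
        by (simp add: u_def matrix_vector_mult_basis column_def inner_commute)
      have "v \<bullet> (outer_prod u u *v v) = (u \<bullet> v)\<^sup>2"
        by (simp add: outer_prod_def matrix_vector_mult_def inner_vec_def power2_eq_square
            sum_distrib_left sum_distrib_right mult_ac)
      then have "v \<bullet> (A' *v v) = v \<bullet> (A *v v) - (u \<bullet> v)\<^sup>2 / A $ k $ k"
        by (simp add: A'_def matrix_vector_mult_diff_rdistrib inner_diff_right
            scaleR_matrix_vector_assoc[symmetric])
      moreover have "(u \<bullet> v)\<^sup>2 \<le> (v \<bullet> (A *v v)) * A $ k $ k"
        using psd_Cauchy_Schwarz[OF less.prems(1), of v "axis k 1"] by (simp add: uv axis_quad)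
      ultimately show ?thesis using kpos by (simp add: pos_divide_le_eq)
    qed
    ultimately have psd': "psd A'" by (simp add: psd_def)
    have diag: "A' $ i $ i = A $ i $ i - (A $ i $ k)\<^sup>2 / A $ k $ k" for i
      by (simp add: A'_def u_def outer_prod_def power2_eq_square)
    have "A' $ i $ i = 0" if "A $ i $ i = 0" for i
    proof -
      have "0 \<le> - ((A $ i $ k)\<^sup>2 / A $ k $ k)"
        using psd_diag_nonneg[OF psd', of i] diag[of i] that by simp
      moreover have "0 \<le> (A $ i $ k)\<^sup>2 / A $ k $ k" using kpos by simp
      ultimately show ?thesis using diag[of i] that by linarith
    qed
    moreover have "A' $ k $ k = 0" using diag[of k] k by (simp add: power2_eq_square)
    ultimately have "{i. A' $ i $ i \<noteq> 0} \<subset> {i. A $ i $ i \<noteq> 0}" using k by blast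
    then have "psd (hadamard A' B)"
      using less.hyps[of A'] psd' less.prems(2) by (simp add: psubset_card_mono)
    moreover have "hadamard A B = hadamard A' B + (1 / A $ k $ k) *\<^sub>R hadamard (outer_prod u u) B"
      by (simp add: hadamard_def A'_def vec_eq_iff algebra_simps)
    ultimately show ?thesis
      using hadamard_outer_prod_psd[OF less.prems(2), of u] kpos by (simp add: psd_add psd_scaleR)
  qed
qed

text \<open>The Frobenius product is the quadratic form of the Hadamard product at the all-ones
  vector.\<close>

lemma psd_inner_nonneg: assumes "psd A" "psd B" shows "0 \<le> A \<bullet> B"
proof -
  have "A \<bullet> B = (\<chi> i. 1) \<bullet> (hadamard A B *v (\<chi> i. 1))"
    by (simp add: hadamard_def matrix_vector_mult_def inner_vec_def)
  then show ?thesis using Schur_product[OF assms] by (simp add: psd_def)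
qed

subsection \<open>Positive definite matrices\<close>

text \<open>Symmetric, with least eigenvalue at least \<open>c\<close>. The explicit constant
  provides the uniformity in time and in the perturbation on which the bounds for inverse matrices
  depend.\<close>

definition pd_by :: "real \<Rightarrow> real ^ 'n ^ 'n \<Rightarrow> bool"
  where "pd_by c A \<longleftrightarrow> psd (A - c *\<^sub>R mat 1)"

lemma pd_by_iff: "pd_by c A \<longleftrightarrow> transpose A = A \<and> (\<forall>v. c * (v \<bullet> v) \<le> v \<bullet> (A *v v))"
  by (auto simp: pd_by_def psd_def transpose_diff transpose_scalar transpose_mat
      matrix_vector_mult_diff_rdistrib inner_diff_right scaleR_matrix_vector_assoc[symmetric])

lemma pd_by_add_psd: "pd_by c A \<Longrightarrow> psd B \<Longrightarrow> pd_by c (A + B)"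
  using psd_add[of "A - c *\<^sub>R mat 1" B] by (simp add: pd_by_def algebra_simps)

lemma pd_by_psd: "pd_by c A \<Longrightarrow> 0 \<le> c \<Longrightarrow> psd A"
  using psd_add[OF _ psd_scaleR[OF _ psd_mat_1], of "A - c *\<^sub>R mat 1" c] by (simp add: pd_by_def)

lemma pd_by_norm_bound:
  assumes "pd_by c A" shows "c * norm v \<le> norm (A *v v)"
proof (cases "v = 0")
  case False
  have "c * (v \<bullet> v) \<le> v \<bullet> (A *v v)" using assms by (simp add: pd_by_iff)
  also have "\<dots> \<le> norm v * norm (A *v v)" by (rule norm_cauchy_schwarz)
  finally have "norm v * (c * norm v) \<le> norm v * norm (A *v v)"
    by (simp add: dot_square_norm power2_eq_square mult_ac)
  then show ?thesis using False by simp
qed simp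

lemma pd_by_invertible: assumes "pd_by c A" "0 < c" shows "invertible A"
proof -
  have "v = 0" if "A *v v = 0" for v
    using pd_by_norm_bound[OF assms(1), of v] that assms(2) by (simp add: mult_le_0_iff)
  then show ?thesis
    by (metis invertible_left_inverse matrix_left_invertible_ker)
qed

text \<open>The segment from the identity to \<open>A\<close> consists of positive definite
  matrices, so the determinant has no zero on it, and it equals 1 at the identity.\<close>

lemma pd_by_det_pos: assumes "pd_by c A" "0 < c" shows "0 < det A"
proof (rule ccontr)
  assume "\<not> 0 < det A"
  define F where "F s = mat 1 + s *\<^sub>R (A - mat 1)" for s :: real
  have "pd_by (min c 1) (F s)" if "0 \<le> s" "s \<le> 1" for s
  proof -
    have "min c 1 * (v \<bullet> v) \<le> v \<bullet> (F s *v v)" for v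
    proof -
      have "v \<bullet> (F s *v v) = (1 - s) * (v \<bullet> v) + s * (v \<bullet> (A *v v))"
        by (simp add: F_def matrix_vector_mult_add_rdistrib matrix_vector_mult_diff_rdistrib
            inner_add_right inner_diff_right scaleR_matrix_vector_assoc[symmetric] algebra_simps)
      moreover have "(1 - s) * (min c 1 * (v \<bullet> v)) \<le> (1 - s) * (v \<bullet> v)"
        using that mult_right_mono[of "min c 1" 1 "v \<bullet> v"] by (intro mult_left_mono) auto
      moreover have "s * (min c 1 * (v \<bullet> v)) \<le> s * (v \<bullet> (A *v v))"
      proof (intro mult_left_mono that)
        have "min c 1 * (v \<bullet> v) \<le> c * (v \<bullet> v)" by (intro mult_right_mono) auto
        then show "min c 1 * (v \<bullet> v) \<le> v \<bullet> (A *v v)" using assms(1) by (meson order_trans pd_by_iff)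
      qed
      ultimately show ?thesis by (simp add: algebra_simps)
    qed
    moreover have "transpose (F s) = F s"
      using assms(1) by (simp add: F_def transpose_add transpose_diff transpose_scalar transpose_mat pd_by_iff)
    ultimately show ?thesis by (simp add: pd_by_iff)
  qed
  then have nz: "det (F s) \<noteq> 0" if "0 \<le> s" "s \<le> 1" for s
    using pd_by_invertible[of "min c 1" "F s"] assms(2) that by (simp add: invertible_det_nz)
  have "continuous_on {0..1} (\<lambda>s. det (F s))"
    unfolding det_def F_def by (intro continuous_intros)
  moreover have "det (F 1) \<le> 0" "0 \<le> det (F 0)"
    using \<open>\<not> 0 < det A\<close> by (simp_all add: F_def)
  ultimately obtain s where "0 \<le> s" "s \<le> 1" "det (F s) = 0"
    using IVT2'[of "\<lambda>s. det (F s)" 1 0 0] by auto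
  then show False using nz by blast
qed

text \<open>The constant is the minimum of the quadratic form on the unit sphere. Were it 0,
  Cauchy-Schwarz would put the minimizing vector into the kernel.\<close>

lemma psd_det_pd_by:
  assumes "psd A" "det A \<noteq> 0" obtains c where "0 < c" "pd_by c A"
proof -
  let ?S = "sphere (0 :: real ^ 'n) 1"
  have "?S \<noteq> {}" by (simp add: sphere_eq_empty)
  moreover have "compact ?S" by simp
  moreover have "continuous_on ?S (\<lambda>v. v \<bullet> (A *v v))"
    by (intro continuous_intros linear_continuous_on matrix_vector_mul_bounded_linear)
  ultimately obtain u where u: "u \<in> ?S" "\<And>v. v \<in> ?S \<Longrightarrow> u \<bullet> (A *v u) \<le> v \<bullet> (A *v v)"
    using continuous_attains_inf by (smt (verit, best))
  define c where "c = u \<bullet> (A *v u)"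
  have "c \<noteq> 0"
  proof
    assume c0: "c = 0"
    have "(A *v u) \<bullet> (A *v u) = 0"
      using psd_Cauchy_Schwarz[OF assms(1), of "A *v u" u] c0 by (simp add: c_def)
    then have "A *v u = 0" by simp
    then have "u = 0"
      using assms(2) by (metis invertible_det_nz invertible_left_inverse matrix_left_invertible_ker)
    then show False using u(1) by simp
  qed
  moreover have "0 \<le> c" using assms(1) by (simp add: c_def psd_def)
  ultimately have "0 < c" by simp
  moreover have "c * (v \<bullet> v) \<le> v \<bullet> (A *v v)" for v
  proof (cases "v = 0")
    case False
    let ?w = "(1 / norm v) *\<^sub>R v"
    have "c \<le> ?w \<bullet> (A *v ?w)" unfolding c_def by (rule u(2)) (use False in simp)
    also have "\<dots> = (v \<bullet> (A *v v)) / (norm v)\<^sup>2"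
      by (simp add: matrix_vector_mult_scaleR power2_eq_square)
    finally show ?thesis using False by (simp add: field_simps dot_square_norm)
  qed simp
  ultimately show ?thesis using that assms(1) by (auto simp: pd_by_iff psd_def)
qed

text \<open>The Frobenius norm dominates the operator norm, so \<open>B\<close> lowers the quadratic
  form by at most \<open>c\<close> times the squared length.\<close>

lemma psd_of_norm:
  fixes A B :: "real ^ 'n ^ 'n"
  assumes "pd_by c A" "transpose B = B" "norm B \<le> c" shows "psd (A + B)"
proof -
  have "0 \<le> v \<bullet> ((A + B) *v v)" for v
  proof -
    have "\<bar>v \<bullet> (B *v v)\<bar> \<le> norm v * norm (B *v v)" by (rule Cauchy_Schwarz_ineq2)
    also have "\<dots> \<le> norm v * (norm B * norm v)"
    proof (intro mult_left_mono)
      show "norm (B *v v) \<le> norm B * norm v"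
      proof (rule power2_le_imp_le)
        have "(norm (B *v v))\<^sup>2 = (\<Sum>i\<in>UNIV. (B $ i \<bullet> v)\<^sup>2)"
          by (simp add: norm_vec_def L2_set_def sum_nonneg matrix_vector_mult_def inner_vec_def)
        also have "\<dots> \<le> (\<Sum>i\<in>UNIV. (norm (B $ i))\<^sup>2 * (norm v)\<^sup>2)"
          by (intro sum_mono) (metis Cauchy_Schwarz_ineq dot_square_norm)
        also have "\<dots> = (norm B * norm v)\<^sup>2"
          by (simp add: norm_vec_def[of B] L2_set_def sum_nonneg sum_distrib_right power_mult_distrib)
        finally show "(norm (B *v v))\<^sup>2 \<le> (norm B * norm v)\<^sup>2" .
      qed simp
    qed simp
    also have "\<dots> \<le> c * (v \<bullet> v)"
      using mult_right_mono[OF assms(3), of "norm v * norm v"]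
      by (simp add: dot_square_norm power2_eq_square mult_ac)
    finally have "\<bar>v \<bullet> (B *v v)\<bar> \<le> c * (v \<bullet> v)" .
    moreover have "c * (v \<bullet> v) \<le> v \<bullet> (A *v v)" using assms(1) by (simp add: pd_by_iff)
    ultimately show ?thesis
      by (simp add: matrix_vector_mult_add_rdistrib inner_add_right abs_le_iff)
  qed
  then show ?thesis using assms(1,2) by (simp add: psd_def pd_by_iff transpose_add)
qed

lemma pd_by_of_norm:
  fixes A B :: "real ^ 'n ^ 'n"
  assumes "pd_by c A" "transpose B = B" "norm B \<le> r" shows "pd_by (c - r) (A + B)"
proof -
  have "pd_by r (A - (c - r) *\<^sub>R mat 1)"
    using assms(1) by (simp add: pd_by_def algebra_simps)
  from psd_of_norm[OF this assms(2,3)] show ?thesis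
    by (simp add: pd_by_def algebra_simps)
qed

text \<open>The right side is the trace of D H D H. The two factors \<open>H\<close> are replaced by
  \<open>c\<close> times the identity one after the other; each time the loss is the pairing of
  \<open>H - c *\<^sub>R mat 1\<close> with a positive semidefinite matrix, first
  \<open>D ** H ** D\<close> and then \<open>D ** D\<close>.\<close>

lemma pd_by_congruence_inner:
  fixes D H :: "real ^ 'n ^ 'n"
  assumes D: "transpose D = D" and H: "pd_by c H" "0 \<le> c"
  shows "c\<^sup>2 * (D \<bullet> D) \<le> D \<bullet> (H ** D ** H)"
proof -
  have tH: "transpose H = H" using H by (simp add: pd_by_iff)
  have "0 \<le> (H - c *\<^sub>R mat 1) \<bullet> (D ** H ** D)"
    by (intro psd_inner_nonneg psd_congruence_sym D)
       (use H pd_by_psd[OF H] in \<open>auto simp: pd_by_def\<close>)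
  moreover have "0 \<le> (H - c *\<^sub>R mat 1) \<bullet> (D ** mat 1 ** D)"
    by (intro psd_inner_nonneg psd_congruence_sym D psd_mat_1) (use H in \<open>auto simp: pd_by_def\<close>)
  moreover have "H \<bullet> (D ** H ** D) = D \<bullet> (H ** D ** H)"
    by (metis D tH inner_commute inner_matrix_mult_left inner_matrix_mult_right matrix_mul_assoc)
  moreover have "mat 1 \<bullet> (D ** H ** D) = H \<bullet> (D ** D)"
    by (metis D inner_commute inner_matrix_mult_left inner_matrix_mult_right matrix_mul_lid matrix_mul_rid)
  moreover have "mat 1 \<bullet> (D ** D) = D \<bullet> D"
    by (metis D inner_commute inner_matrix_mult_left matrix_mul_rid)
  ultimately have "c * (H \<bullet> (D ** D)) \<le> D \<bullet> (H ** D ** H)" "c * (D \<bullet> D) \<le> H \<bullet> (D ** D)"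
    by (simp_all add: inner_diff_left)
  then show ?thesis
    using mult_left_mono[of "c * (D \<bullet> D)" "H \<bullet> (D ** D)" c] H(2)
    by (simp add: power2_eq_square mult.assoc)
qed

subsection \<open>Lipschitz functions\<close>

text \<open>The constant is forgotten: admissibility asks only that there be one, and in this form
  the property composes freely.\<close>

definition lip :: "'a::metric_space set \<Rightarrow> ('a \<Rightarrow> 'b::metric_space) \<Rightarrow> bool"
  where "lip S f \<longleftrightarrow> (\<exists>L. L-lipschitz_on S f)"

lemma lipI: "(\<And>s t. s \<in> S \<Longrightarrow> t \<in> S \<Longrightarrow> dist (f s) (f t) \<le> L * dist s t) \<Longrightarrow> lip S f"
  unfolding lip_def
  by (rule exI[of _ "max L 0"], rule lipschitz_onI)
     (auto intro: order_trans[OF _ mult_right_mono[of L "max L 0"]])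

lemma lip_real_le:
  fixes f :: "real \<Rightarrow> 'b::real_normed_vector"
  assumes "\<And>s t. s \<in> S \<Longrightarrow> t \<in> S \<Longrightarrow> s \<le> t \<Longrightarrow> norm (f t - f s) \<le> L * (t - s)"
  shows "lip S f"
proof (rule lipI)
  fix s t assume "s \<in> S" "t \<in> S"
  then show "dist (f s) (f t) \<le> L * dist s t"
    using assms[of s t] assms[of t s]
    by (cases "s \<le> t") (auto simp: dist_norm norm_minus_commute)
qed

lemma lip_continuous: "lip S f \<Longrightarrow> continuous_on S f"
  by (auto simp: lip_def lipschitz_on_continuous_on)

lemma lip_subset: "lip S f \<Longrightarrow> T \<subseteq> S \<Longrightarrow> lip T f"
  by (auto simp: lip_def intro: lipschitz_on_subset)

lemma lip_cong: "lip S f \<Longrightarrow> (\<And>x. x \<in> S \<Longrightarrow> f x = g x) \<Longrightarrow> lip S g"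
  by (auto simp: lip_def intro: lipschitz_on_transform)

lemma lip_const: "lip S (\<lambda>x. c)" and lip_id: "lip S (\<lambda>x. x)"
  by (auto simp: lip_def intro: lipschitz_intros)

lemma lip_add: "lip S f \<Longrightarrow> lip S g \<Longrightarrow> lip S (\<lambda>x. f x + g x)"
  and lip_diff: "lip S f \<Longrightarrow> lip S g \<Longrightarrow> lip S (\<lambda>x. f x - g x)"
  and lip_minus: "lip S f \<Longrightarrow> lip S (\<lambda>x. - f x)"
  for f g :: "'a::metric_space \<Rightarrow> 'b::real_normed_vector"
  by (auto simp: lip_def intro: lipschitz_intros)

lemma lip_compose: "lip S f \<Longrightarrow> lip T g \<Longrightarrow> f ` S \<subseteq> T \<Longrightarrow> lip S (\<lambda>x. g (f x))"
  by (auto simp: lip_def intro: lipschitz_on_compose2 lipschitz_on_subset)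

lemma lip_bounded_linear: "bounded_linear h \<Longrightarrow> lip S f \<Longrightarrow> lip S (\<lambda>x. h (f x))"
  by (rule lip_compose[of S f UNIV h])
     (auto simp: lip_def elim: bounded_linear.lipschitz_boundE[of h UNIV])

lemma continuous_on_bounded_norm:
  fixes f :: "'a::topological_space \<Rightarrow> 'b::real_normed_vector"
  assumes "continuous_on S f" "compact S"
  obtains B where "0 < B" "\<And>x. x \<in> S \<Longrightarrow> norm (f x) \<le> B"
  using compact_imp_bounded[OF compact_continuous_image[OF assms]]
  by (auto simp: bounded_pos)

text \<open>Compactness bounds both factors, without which a product of Lipschitz functions can fail
  to be Lipschitz.\<close>

lemma lip_bilinear:
  fixes f :: "'c::metric_space \<Rightarrow> 'a::real_normed_vector" and g :: "'c \<Rightarrow> 'b::real_normed_vector"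
  assumes pr: "bounded_bilinear pr" and S: "compact S" and f: "lip S f" and g: "lip S g"
  shows "lip S (\<lambda>x. pr (f x) (g x))"
proof -
  interpret bounded_bilinear pr by fact
  obtain K where K: "0 < K" "\<And>a b. norm (pr a b) \<le> norm a * norm b * K" using pos_bounded by blast
  obtain A where A: "0 < A" "\<And>x. x \<in> S \<Longrightarrow> norm (f x) \<le> A"
    using continuous_on_bounded_norm[OF lip_continuous[OF f] S] by blast
  obtain B where B: "0 < B" "\<And>x. x \<in> S \<Longrightarrow> norm (g x) \<le> B"
    using continuous_on_bounded_norm[OF lip_continuous[OF g] S] by blast
  obtain L where L: "L-lipschitz_on S f" using f by (auto simp: lip_def)
  obtain M where M: "M-lipschitz_on S g" using g by (auto simp: lip_def)
  show ?thesis
  proof (rule lipI)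
    fix s t assume st: "s \<in> S" "t \<in> S"
    have "pr (f s) (g s) - pr (f t) (g t) = pr (f s - f t) (g s) + pr (f t) (g s - g t)"
      by (simp add: diff_left diff_right)
    then have "norm (pr (f s) (g s) - pr (f t) (g t))
        \<le> norm (f s - f t) * norm (g s) * K + norm (f t) * norm (g s - g t) * K"
      using K(2)[of "f s - f t" "g s"] K(2)[of "f t" "g s - g t"] norm_triangle_ineq
      by (smt (verit))
    also have "\<dots> \<le> (L * dist s t) * B * K + A * (M * dist s t) * K"
      using st A B L M K(1) lipschitz_onD[OF L st] lipschitz_onD[OF M st]
        lipschitz_on_nonneg[OF L] lipschitz_on_nonneg[OF M]
      by (intro add_mono mult_right_mono mult_mono) (auto simp: dist_norm[symmetric])
    finally show "dist (pr (f s) (g s)) (pr (f t) (g t)) \<le> (L * B * K + A * M * K) * dist s t"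
      by (simp add: dist_norm algebra_simps)
  qed
qed

lemmas lip_scaleR = lip_bilinear[OF bounded_bilinear_scaleR]
lemmas lip_mult = lip_bilinear[OF bounded_bilinear_mult]
lemmas lip_inner = lip_bilinear[OF bounded_bilinear_inner]
lemmas lip_matrix_mult = lip_bilinear[OF bounded_bilinear_matrix_mult]

lemma lip_C1:
  fixes f :: "real \<Rightarrow> 'b::real_inner"
  assumes "\<And>t. t \<in> {a..b} \<Longrightarrow> (f has_vector_derivative f' t) (at t within {a..b})"
    and "continuous_on {a..b} f'"
  shows "lip {a..b} f"
proof -
  obtain B where B: "0 < B" "\<And>x. x \<in> {a..b} \<Longrightarrow> norm (f' x) \<le> B"
    using continuous_on_bounded_norm[OF assms(2) compact_Icc] by blast
  show ?thesis
  proof (rule lipI)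
    fix s t assume "s \<in> {a..b}" "t \<in> {a..b}"
    then have "norm (f s - f t) \<le> B * norm (s - t)"
      using assms(1) B
      by (intro differentiable_bound[of "{a..b}" f "\<lambda>x h. h *\<^sub>R f' x"])
         (auto simp: has_vector_derivative_def mult.commute[of B] intro!: onorm_le mult_left_mono)
    then show "dist (f s) (f t) \<le> B * dist s t" by (simp add: dist_norm)
  qed
qed

lemmas integral_combine_Icc = Henstock_Kurzweil_Integration.integral_combine

lemma lip_integral:
  fixes g :: "real \<Rightarrow> 'b::euclidean_space"
  assumes "g integrable_on {a..b}" "\<And>t. t \<in> {a..b} \<Longrightarrow> norm (g t) \<le> B"
  shows "lip {a..b} (\<lambda>t. integral {a..t} g)" "lip {a..b} (\<lambda>t. integral {t..b} g)"
proof -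
  have int: "g integrable_on {s..t}" if "a \<le> s" "t \<le> b" for s t
    by (rule integrable_on_subinterval[OF assms(1)]) (use that in auto)
  have le: "norm (integral {s..t} g) \<le> B * (t - s)" if "a \<le> s" "s \<le> t" "t \<le> b" for s t
  proof -
    have "norm (integral (cbox s t) g) \<le> B * measure lborel (cbox s t)"
      using that order_trans[OF norm_ge_zero assms(2)[of s]] assms(2) int[of s t]
      by (intro integrable_bound) (auto intro: order_trans)
    then show ?thesis using that by simp
  qed
  show "lip {a..b} (\<lambda>t. integral {a..t} g)"
  proof (rule lip_real_le)
    fix s t assume st: "s \<in> {a..b}" "t \<in> {a..b}" "s \<le> t"
    have "integral {a..s} g + integral {s..t} g = integral {a..t} g"
      using st by (intro integral_combine_Icc int) auto
    then have "integral {a..t} g - integral {a..s} g = integral {s..t} g" by (simp add: algebra_simps)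
    then show "norm (integral {a..t} g - integral {a..s} g) \<le> B * (t - s)" using le[of s t] st by simp
  qed
  show "lip {a..b} (\<lambda>t. integral {t..b} g)"
  proof (rule lip_real_le)
    fix s t assume st: "s \<in> {a..b}" "t \<in> {a..b}" "s \<le> t"
    have "integral {s..t} g + integral {t..b} g = integral {s..b} g"
      using st by (intro integral_combine_Icc int) auto
    then have "integral {t..b} g - integral {s..b} g = - integral {s..t} g" by (simp add: algebra_simps)
    then show "norm (integral {t..b} g - integral {s..b} g) \<le> B * (t - s)" using le[of s t] st by simp
  qed
qed

subsection \<open>Right derivatives and integrals\<close>

lemma has_vector_derivative_iff_quotient:
  "(f has_vector_derivative f') (at t within S) \<longleftrightarrow>
     ((\<lambda>s. (1 / (s - t)) *\<^sub>R (f s - f t)) \<longlongrightarrow> f') (at t within S)"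
proof -
  have "(f has_vector_derivative f') (at t within S) \<longleftrightarrow>
      ((\<lambda>s. (1 / norm (s - t)) *\<^sub>R (f s - (f t + (s - t) *\<^sub>R f'))) \<longlongrightarrow> 0) (at t within S)"
    by (simp add: has_vector_derivative_def has_derivative_within bounded_linear_scaleR_left)
  also have "\<dots> \<longleftrightarrow> ((\<lambda>s. norm ((1 / norm (s - t)) *\<^sub>R (f s - (f t + (s - t) *\<^sub>R f')))) \<longlongrightarrow> 0) (at t within S)"
    by (rule tendsto_norm_zero_iff[symmetric])
  also have "\<dots> \<longleftrightarrow> ((\<lambda>s. norm ((1 / (s - t)) *\<^sub>R (f s - f t) - f')) \<longlongrightarrow> 0) (at t within S)"
  proof (rule tendsto_cong)
    have "\<forall>\<^sub>F s in at t within S. s \<noteq> t" by (simp add: eventually_at_filter)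
    then show "\<forall>\<^sub>F s in at t within S. norm ((1 / norm (s - t)) *\<^sub>R (f s - (f t + (s - t) *\<^sub>R f')))
         = norm ((1 / (s - t)) *\<^sub>R (f s - f t) - f')"
    proof eventually_elim
      case (elim s)
      have "(1 / (s - t)) *\<^sub>R (f s - f t) - f' = (1 / (s - t)) *\<^sub>R (f s - (f t + (s - t) *\<^sub>R f'))"
      proof -
        have "(1 / (s - t)) *\<^sub>R ((s - t) *\<^sub>R f') = f'" using elim by simp
        then show ?thesis by (simp only: scaleR_diff_right diff_diff_eq[symmetric])
      qed
      then show ?case by simp
    qed
  qed
  also have "\<dots> \<longleftrightarrow> ((\<lambda>s. (1 / (s - t)) *\<^sub>R (f s - f t)) \<longlongrightarrow> f') (at t within S)"
    by (simp add: tendsto_norm_zero_iff Lim_null[symmetric])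
  finally show ?thesis .
qed

lemma integral_right_derivative:
  fixes g :: "real \<Rightarrow> 'b::banach"
  assumes "g integrable_on {a..b}" "a \<le> t" "t < b" "continuous (at_right t) g"
  shows "((\<lambda>s. integral {a..s} g) has_vector_derivative g t) (at_right t)"
    and "((\<lambda>s. integral {s..b} g) has_vector_derivative - g t) (at_right t)"
proof -
  have int: "g integrable_on {s..u}" if "a \<le> s" "u \<le> b" for s u
    by (rule integrable_on_subinterval[OF assms(1)]) (use that in auto)
  have atr: "at t within {t..b} = at_right t" using assms(3) by (rule at_within_Icc_at_right)
  have "((\<lambda>u. integral {t..u} g) has_vector_derivative g t) (at t within {t..b} - {})"
    using assms by (intro integral_has_vector_derivative_continuous_at int) (auto simp: atr)
  then have D: "((\<lambda>u. integral {t..u} g) has_vector_derivative g t) (at t within {t..b})" by simp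
  have "((\<lambda>s. integral {a..t} g + integral {t..s} g) has_vector_derivative g t) (at t within {t..b})"
    using D by (auto intro!: derivative_eq_intros)
  moreover have "integral {a..t} g + integral {t..s} g = integral {a..s} g" if "s \<in> {t..b}" for s
    using that assms by (intro integral_combine_Icc int) auto
  ultimately show "((\<lambda>s. integral {a..s} g) has_vector_derivative g t) (at_right t)"
    unfolding atr[symmetric] using assms(3)
    by (auto intro: has_vector_derivative_transform[of t "{t..b}", rotated 2])
  have "((\<lambda>s. integral {t..b} g - integral {t..s} g) has_vector_derivative - g t) (at t within {t..b})"
    using D by (auto intro!: derivative_eq_intros)
  moreover have "integral {t..b} g - integral {t..s} g = integral {s..b} g" if "s \<in> {t..b}" for s
  proof -
    have "integral {t..s} g + integral {s..b} g = integral {t..b} g"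
      using that assms by (intro integral_combine_Icc int) auto
    then show ?thesis by (simp add: algebra_simps)
  qed
  ultimately show "((\<lambda>s. integral {s..b} g) has_vector_derivative - g t) (at_right t)"
    unfolding atr[symmetric] using assms(3)
    by (auto intro: has_vector_derivative_transform[of t "{t..b}", rotated 2])
qed

text \<open>Only right derivatives are available, since the order parameter is merely right-continuous.
  The difference quotients are bounded by the Lipschitz constant, so that they converge in mean.\<close>

theorem fundamental_theorem_of_calculus_right:
  fixes f :: "real \<Rightarrow> 'b::euclidean_space"
  assumes ab: "a \<le> b" and lip: "lip {a..b} f"
    and deriv: "\<And>t. a \<le> t \<Longrightarrow> t < b \<Longrightarrow> (f has_vector_derivative g t) (at_right t)"
  shows "(g has_integral (f b - f a)) {a..b}"
proof (cases "a = b")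
  case True then show ?thesis using has_integral_refl(2)[of g a] by simp
next
  case False
  with ab have ab: "a < b" by simp
  obtain L where L: "L-lipschitz_on {a..b} f" using lip by (auto simp: lip_def)
  have L0: "0 \<le> L" by (rule lipschitz_on_nonneg[OF L])
  define F where "F u = f (max a (min u b))" for u
  have FL: "norm (F s - F t) \<le> L * \<bar>s - t\<bar>" for s t
  proof -
    have "norm (F s - F t) \<le> L * \<bar>max a (min s b) - max a (min t b)\<bar>"
      using lipschitz_onD[OF L, of "max a (min s b)" "max a (min t b)"] ab
      by (simp add: F_def dist_norm)
    also have "\<dots> \<le> L * \<bar>s - t\<bar>" by (intro mult_left_mono L0) (auto simp: max_def min_def)
    finally show ?thesis .
  qed
  have contF: "continuous_on S F" for S
  proof -
    have "lip UNIV F" by (rule lipI[of _ _ L]) (use FL in \<open>auto simp: dist_norm\<close>)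
    from lip_continuous[OF this] show ?thesis by (rule continuous_on_subset) simp
  qed
  \<comment> \<open>An antiderivative with a margin on both sides, to make room for shifts up to
    \<open>h n \<le> 1\<close>. Through it the integral of the difference quotient becomes a
    difference of two averages, which tend to \<open>F b\<close> and \<open>F a\<close>.\<close>
  define P where "P u = integral {a-1..u} F" for u
  have P: "(P has_vector_derivative F u) (at u)" if "a - 1 < u" "u < b + 2" for u
    using integral_has_vector_derivative[OF contF, of u "a-1" "b+2"] that
    by (simp add: P_def[abs_def] at_within_Icc_at)
  define h where "h n = 1 / real (Suc n)" for n
  have h: "0 < h n" "h n \<le> 1" for n by (simp_all add: h_def)
  have h0: "h \<longlonglongrightarrow> 0" unfolding h_def
    using LIMSEQ_inverse_real_of_nat by (simp add: inverse_eq_divide)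
  define \<phi> where "\<phi> n t = (1 / h n) *\<^sub>R (F (t + h n) - F t)" for n t
  have \<phi>int: "(\<phi> n has_integral (1 / h n) *\<^sub>R ((P (b + h n) - P b) - (P (a + h n) - P a))) {a..b}" for n
  proof -
    have "((\<lambda>t. F (t + h n) - F t) has_integral (P (b + h n) - P b) - (P (a + h n) - P a)) {a..b}"
    proof (rule fundamental_theorem_of_calculus)
      show "a \<le> b" using ab by simp
      fix t assume t: "t \<in> {a..b}"
      have "((\<lambda>t. P (t + h n)) has_vector_derivative F (t + h n)) (at t)"
      proof -
        have "((\<lambda>t. t + h n) has_vector_derivative 1) (at t)"
          by (auto intro!: derivative_eq_intros)
        moreover have "(P has_vector_derivative F (t + h n)) (at (t + h n))"
          using P[of "t + h n"] t h[of n] by simp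
        ultimately show ?thesis
          using vector_diff_chain_at[of "\<lambda>t. t + h n" 1 t P "F (t + h n)"] by (simp add: o_def)
      qed
      moreover have "(P has_vector_derivative F t) (at t)" using P[of t] t by simp
      ultimately have "((\<lambda>t. P (t + h n) - P t) has_vector_derivative F (t + h n) - F t) (at t)"
        by (rule has_vector_derivative_diff)
      then show "((\<lambda>t. P (t + h n) - P t) has_vector_derivative F (t + h n) - F t) (at t within {a..b})"
        by (rule has_vector_derivative_at_within)
    qed
    from has_integral_cmul[OF this, of "1 / h n"] show ?thesis by (simp add: \<phi>_def[abs_def])
  qed
  have hquot: "(\<lambda>n. (1 / h n) *\<^sub>R (p (u + h n) - p u)) \<longlonglongrightarrow> d"
    if "(p has_vector_derivative d) (at_right u)" for p :: "real \<Rightarrow> 'b" and d u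
  proof -
    have "((\<lambda>s. (1 / (s - u)) *\<^sub>R (p s - p u)) \<longlongrightarrow> d) (at_right u)"
      using that by (simp add: has_vector_derivative_iff_quotient)
    moreover have "filterlim (\<lambda>n. u + h n) (at_right u) sequentially"
      unfolding filterlim_at using h tendsto_add[OF tendsto_const[of u] h0]
      by (auto simp: eventually_sequentially order_less_imp_le less_imp_neq[OF h(1), symmetric] intro!: exI[of _ 0])
    ultimately have "(\<lambda>n. (1 / ((u + h n) - u)) *\<^sub>R (p (u + h n) - p u)) \<longlonglongrightarrow> d"
      by (rule filterlim_compose)
    then show ?thesis by simp
  qed
  \<comment> \<open>At \<open>b\<close> the hypothesis says nothing about \<open>g\<close>; the
    quotients of the constant extension \<open>F\<close> are 0 there.\<close>
  define g' where "g' t = (if t < b then g t else 0)" for t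
  have bound: "norm (\<phi> n t) \<le> L" for n t
    using FL[of "t + h n" t] h(1)[of n] by (simp add: \<phi>_def divide_le_eq)
  have conv: "(\<lambda>n. \<phi> n t) \<longlonglongrightarrow> g' t" if t: "t \<in> {a..b}" for t
  proof (cases "t < b")
    case True
    have "(F has_vector_derivative g t) (at t within {t..b})"
    proof (rule has_vector_derivative_transform)
      show "(f has_vector_derivative g t) (at t within {t..b})"
        using deriv[of t] t True by (simp add: at_within_Icc_at_right)
    qed (use t True in \<open>auto simp: F_def max_def min_def\<close>)
    then have "(F has_vector_derivative g t) (at_right t)"
      using True by (simp add: at_within_Icc_at_right)
    from hquot[OF this] show ?thesis using True by (simp add: \<phi>_def g'_def)
  next
    case False
    then have "t = b" using t by simp
    moreover have "F (b + h n) = F b" for n using ab h(1)[of n] by (simp add: F_def)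
    ultimately show ?thesis by (simp add: \<phi>_def g'_def)
  qed
  have g': "g' integrable_on {a..b}" "(\<lambda>n. integral {a..b} (\<phi> n)) \<longlonglongrightarrow> integral {a..b} g'"
    using dominated_convergence[of \<phi> "{a..b}" "\<lambda>_. L" g'] \<phi>int bound conv
    by (auto simp: has_integral_integrable_integral)
  have "(\<lambda>n. integral {a..b} (\<phi> n)) \<longlonglongrightarrow> F b - F a"
  proof -
    have "integral {a..b} (\<phi> n) = (1 / h n) *\<^sub>R (P (b + h n) - P b) - (1 / h n) *\<^sub>R (P (a + h n) - P a)" for n
      using \<phi>int[of n] by (simp add: has_integral_integrable_integral scaleR_diff_right)
    moreover have "(\<lambda>n. (1 / h n) *\<^sub>R (P (u + h n) - P u)) \<longlonglongrightarrow> F u" if "u \<in> {a..b}" for u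
      using that by (intro hquot has_vector_derivative_at_within[OF P]) auto
    ultimately show ?thesis using ab by (auto intro!: tendsto_diff)
  qed
  then have "integral {a..b} g' = F b - F a" using g'(2) LIMSEQ_unique by blast
  then have "(g' has_integral f b - f a) {a..b}"
    using g'(1) ab by (simp add: has_integral_integrable_integral F_def)
  then show ?thesis
    by (rule has_integral_spike_finite[of "{b}", rotated 2]) (auto simp: g'_def)
qed

section \<open>Integration with a monotone weight\<close>

lemma mono_scaleR_integrable:
  fixes g :: "real \<Rightarrow> 'b::euclidean_space"
  assumes "mono_on {a..b} x" "continuous_on {a..b} g"
  shows "(\<lambda>t. x t *\<^sub>R g t) integrable_on {a..b}"
proof -
  have "(\<lambda>t. x t *\<^sub>R g t) absolutely_integrable_on {a..b}"
  proof (rule absolutely_integrable_bounded_measurable_product[OF bounded_bilinear_scaleR[THEN bilinear_conv_bounded_bilinear[THEN iffD2]]])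
    have "x integrable_on {a..b}" by (rule integrable_on_mono_on[OF assms(1)])
    then show "x \<in> borel_measurable (lebesgue_on {a..b})" by (rule integrable_imp_measurable)
    show "{a..b} \<in> sets lebesgue" by simp
    show "bounded (x ` {a..b})"
      unfolding bounded_iff
    proof (intro exI ballI)
      fix y assume "y \<in> x ` {a..b}"
      then obtain t where "y = x t" "t \<in> {a..b}" by blast
      moreover have "x a \<le> x t" "x t \<le> x b"
        using \<open>t \<in> {a..b}\<close> by (auto intro!: mono_onD[OF assms(1)])
      ultimately show "norm y \<le> max \<bar>x a\<bar> \<bar>x b\<bar>" by auto
    qed
    show "g absolutely_integrable_on {a..b}" by (rule absolutely_integrable_continuous_real[OF assms(2)])
  qed
  then show ?thesis by (simp add: absolutely_integrable_on_def)
qed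

text \<open>The weight may be discontinuous, so the integrand is not jointly continuous. The mean
  value theorem bounds the difference quotients of \<open>f\<close> uniformly, and dominated
  convergence applies along every sequence tending to 0.\<close>

lemma integral_param_right_derivative:
  fixes f f' :: "real \<Rightarrow> real \<Rightarrow> real"
  assumes e: "0 < e"
    and deriv: "\<And>r t. r \<in> {0..e} \<Longrightarrow> t \<in> {a..b} \<Longrightarrow>
        ((\<lambda>r. f r t) has_real_derivative f' r t) (at r within {0..e})"
    and cont: "continuous_on ({0..e} \<times> {a..b}) (\<lambda>(r, t). f' r t)"
    and int: "\<And>r. r \<in> {0..e} \<Longrightarrow> (\<lambda>t. x t * f r t) integrable_on {a..b}"
    and x: "\<And>t. t \<in> {a..b} \<Longrightarrow> \<bar>x t\<bar> \<le> 1"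
  shows "((\<lambda>r. integral {a..b} (\<lambda>t. x t * f r t)) has_real_derivative
      integral {a..b} (\<lambda>t. x t * f' 0 t)) (at_right 0)"
proof -
  have atr: "at 0 within {0..e} = at_right 0" using e by (rule at_within_Icc_at_right)
  obtain B where B: "0 < B" "\<And>p. p \<in> {0..e} \<times> {a..b} \<Longrightarrow> norm ((\<lambda>(r, t). f' r t) p) \<le> B"
    using continuous_on_bounded_norm[OF cont compact_Times[OF compact_Icc compact_Icc]] by blast
  have bound: "\<bar>f r t - f 0 t\<bar> \<le> B * r" if "r \<in> {0..e}" "t \<in> {a..b}" for r t
  proof -
    have "norm (f r t - f 0 t) \<le> B * norm (r - 0)"
      using that e deriv B(2)[of "(s, t)" for s]
      by (intro field_differentiable_bound[of "{0..e}" "\<lambda>r. f r t" "\<lambda>r. f' r t"]) auto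
    then show ?thesis using that by simp
  qed
  show ?thesis
    unfolding has_field_derivative_iff atr[symmetric] tendsto_at_iff_sequentially
  proof (intro allI impI)
    fix X :: "nat \<Rightarrow> real" assume X: "\<forall>i. X i \<in> {0..e} - {0}" "X \<longlonglongrightarrow> 0"
    define \<phi> where "\<phi> n t = x t * ((f (X n) t - f 0 t) / X n)" for n t
    have pos: "0 < X n" "X n \<in> {0..e}" for n using X(1)[rule_format, of n] by auto
    have \<phi>int: "(\<phi> n has_integral
        (integral {a..b} (\<lambda>t. x t * f (X n) t) - integral {a..b} (\<lambda>t. x t * f 0 t)) / X n) {a..b}" for n
    proof -
      have "((\<lambda>t. (x t * f (X n) t - x t * f 0 t) * (1 / X n)) has_integral
        (integral {a..b} (\<lambda>t. x t * f (X n) t) - integral {a..b} (\<lambda>t. x t * f 0 t)) * (1 / X n)) {a..b}"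
        using int[of "X n"] int[of 0] pos(2)[of n] e
        by (intro has_integral_mult_left has_integral_diff integrable_integral) auto
      then show ?thesis by (simp add: \<phi>_def[abs_def] right_diff_distrib)
    qed
    have "(\<lambda>n. integral {a..b} (\<phi> n)) \<longlonglongrightarrow> integral {a..b} (\<lambda>t. x t * f' 0 t)"
    proof (rule dominated_convergence(2))
      show "\<phi> n integrable_on {a..b}" for n using \<phi>int by blast
      show "(\<lambda>_. B) integrable_on {a..b}" by (rule integrable_const_ivl)
      show "norm (\<phi> n t) \<le> B" if "t \<in> {a..b}" for n t
      proof -
        have "\<bar>(f (X n) t - f 0 t) / X n\<bar> \<le> B"
          using bound[OF pos(2)[of n] that] pos(1)[of n] by (simp add: abs_divide divide_le_eq)
        then have "\<bar>x t\<bar> * \<bar>(f (X n) t - f 0 t) / X n\<bar> \<le> 1 * B"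
          using x[OF that] by (intro mult_mono) auto
        then show ?thesis by (simp add: \<phi>_def abs_mult)
      qed
      show "(\<lambda>n. \<phi> n t) \<longlonglongrightarrow> x t * f' 0 t" if t: "t \<in> {a..b}" for t
      proof -
        have "((\<lambda>r. (f r t - f 0 t) / (r - 0)) \<longlongrightarrow> f' 0 t) (at 0 within {0..e})"
          using deriv[of 0 t] t e by (simp add: has_field_derivative_iff)
        then have "((\<lambda>r. (f r t - f 0 t) / (r - 0)) \<circ> X) \<longlonglongrightarrow> f' 0 t"
          using X unfolding tendsto_at_iff_sequentially by blast
        then show ?thesis unfolding \<phi>_def o_def by (intro tendsto_intros) simp
      qed
    qed
    then show "((\<lambda>r. (integral {a..b} (\<lambda>t. x t * f r t) - integral {a..b} (\<lambda>t. x t * f 0 t)) / (r - 0)) \<circ> X)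
        \<longlonglongrightarrow> integral {a..b} (\<lambda>t. x t * f' 0 t)"
      using \<phi>int by (simp add: o_def has_integral_integrable_integral)
  qed
qed

text \<open>Right derivatives obey the chain rule because the increasing \<sigma> maps
  \<open>{s..b}\<close> to the right of \<open>\<sigma> s\<close>.\<close>

lemma integral_substitution_right:
  fixes F :: "real \<Rightarrow> 'b::euclidean_space"
  assumes ab: "a \<le> b" and lip: "lip {a..b} \<sigma>"
    and mono: "\<And>s t. a \<le> s \<Longrightarrow> s < t \<Longrightarrow> t \<le> b \<Longrightarrow> \<sigma> s < \<sigma> t"
    and deriv: "\<And>s. a \<le> s \<Longrightarrow> s < b \<Longrightarrow> (\<sigma> has_vector_derivative q s) (at_right s)"
    and F: "F integrable_on {\<sigma> a..\<sigma> b}" "\<And>t. t \<in> {\<sigma> a..\<sigma> b} \<Longrightarrow> norm (F t) \<le> B"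
      "\<And>t. \<sigma> a \<le> t \<Longrightarrow> t < \<sigma> b \<Longrightarrow> continuous (at_right t) F"
  shows "((\<lambda>s. q s *\<^sub>R F (\<sigma> s)) has_integral integral {\<sigma> a..\<sigma> b} F) {a..b}"
proof -
  let ?P = "\<lambda>t. integral {\<sigma> a..t} F"
  have le: "\<sigma> s \<le> \<sigma> t" if "a \<le> s" "s \<le> t" "t \<le> b" for s t
    using mono[of s t] that by (cases "s = t") auto
  have "((\<lambda>s. q s *\<^sub>R F (\<sigma> s)) has_integral ((?P \<circ> \<sigma>) b - (?P \<circ> \<sigma>) a)) {a..b}"
  proof (rule fundamental_theorem_of_calculus_right[OF ab])
    show "lip {a..b} (?P \<circ> \<sigma>)"
      unfolding o_def using le lip_integral(1)[OF F(1,2)]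
      by (intro lip_compose[OF lip, of "{\<sigma> a..\<sigma> b}" ?P]) auto
    fix s assume s: "a \<le> s" "s < b"
    have lt: "\<sigma> s < \<sigma> b" and ge: "\<sigma> a \<le> \<sigma> s" using mono[of s b] le[of a s] s by auto
    have "(\<sigma> has_vector_derivative q s) (at s within {s..b})"
      using deriv[OF s] s by (simp add: at_within_Icc_at_right)
    moreover have "(?P has_vector_derivative F (\<sigma> s)) (at (\<sigma> s) within \<sigma> ` {s..b})"
    proof (rule has_vector_derivative_within_subset)
      show "(?P has_vector_derivative F (\<sigma> s)) (at (\<sigma> s) within {\<sigma> s..\<sigma> b})"
        using integral_right_derivative(1)[OF F(1) ge lt F(3)[OF ge lt]] lt
        by (simp add: at_within_Icc_at_right)
      show "\<sigma> ` {s..b} \<subseteq> {\<sigma> s..\<sigma> b}" using le s by auto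
    qed
    ultimately have "(?P \<circ> \<sigma> has_vector_derivative q s *\<^sub>R F (\<sigma> s)) (at s within {s..b})"
      by (rule vector_diff_chain_within)
    then show "(?P \<circ> \<sigma> has_vector_derivative q s *\<^sub>R F (\<sigma> s)) (at_right s)"
      using s by (simp add: at_within_Icc_at_right)
  qed
  then show ?thesis by simp
qed

text \<open>An error that is a product of two increments is of second order: over N equal
  subintervals the increments of \<open>X\<close> telescope, and the errors add up to
  \<open>C * (b - a) * (X b - X a) / N\<close>. This replaces Stieltjes integration against
  \<open>X\<close>.\<close>

lemma subdivision_mono:
  fixes V X :: "real \<Rightarrow> real"
  assumes ab: "a \<le> b" and C: "0 \<le> C"
    and X: "\<And>s t. a \<le> s \<Longrightarrow> s \<le> t \<Longrightarrow> t \<le> b \<Longrightarrow> X s \<le> X t"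
    and V: "\<And>s t. a \<le> s \<Longrightarrow> s \<le> t \<Longrightarrow> t \<le> b \<Longrightarrow> - C * (X t - X s) * (t - s) \<le> V t - V s"
  shows "V a \<le> V b"
proof -
  have *: "- (C * (b - a) * (X b - X a)) * (1 / real (Suc N)) \<le> V b - V a" for N
  proof -
    define d where "d = (b - a) / real (Suc N)"
    define p where "p i = a + real i * d" for i
    have d: "0 \<le> d" using ab by (simp add: d_def)
    have pN: "p (Suc N) = b" and p0: "p 0 = a" by (simp_all add: p_def d_def)
    have pS: "p (Suc i) = p i + d" for i by (simp add: p_def algebra_simps)
    have pm: "p i \<le> p j" if "i \<le> j" for i j using that d by (simp add: p_def mult_right_mono)
    have "- C * (X (p (Suc i)) - X (p i)) * d \<le> V (p (Suc i)) - V (p i)" if "i < Suc N" for i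
      using V[of "p i" "p (Suc i)"] pm[of 0 i] pm[of i "Suc i"] pm[of "Suc i" "Suc N"] that pS[of i]
      by (simp add: p0 pN)
    then have "(\<Sum>i<Suc N. - C * (X (p (Suc i)) - X (p i)) * d) \<le> (\<Sum>i<Suc N. V (p (Suc i)) - V (p i))"
      by (intro sum_mono) auto
    also have "(\<Sum>i<Suc N. V (p (Suc i)) - V (p i)) = V b - V a"
      by (subst sum_lessThan_telescope) (simp add: pN p0)
    also have "(\<Sum>i<Suc N. - C * (X (p (Suc i)) - X (p i)) * d)
        = - C * d * (\<Sum>i<Suc N. X (p (Suc i)) - X (p i))"
      unfolding sum_distrib_left by (intro sum.cong) auto
    also have "\<dots> = - C * d * (X b - X a)"
      by (subst sum_lessThan_telescope) (simp add: pN p0)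
    finally show ?thesis by (simp add: d_def field_simps)
  qed
  have "(\<lambda>N. - (C * (b - a) * (X b - X a)) * (1 / real (Suc N))) \<longlonglongrightarrow> - (C * (b - a) * (X b - X a)) * 0"
    using LIMSEQ_inverse_real_of_nat by (intro tendsto_intros) (simp add: inverse_eq_divide)
  then have "- (C * (b - a) * (X b - X a)) * 0 \<le> V b - V a"
    by (rule LIMSEQ_le_const2) (use * in auto)
  then show ?thesis by simp
qed

text \<open>The approximants are the averages over \<open>[t, t + 1/n]\<close>.\<close>

lemma mono_Lipschitz_approximation:
  fixes X :: "real \<Rightarrow> real"
  assumes mono: "mono X" and rc: "\<And>t. continuous (at_right t) X" and X01: "\<And>t. X t \<in> {0..1}"
  obtains y :: "nat \<Rightarrow> real \<Rightarrow> real"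
  where "\<And>n a b. lip {a..b} (y n)" "\<And>n t. y n t \<in> {0..1}" "\<And>t. (\<lambda>n. y n t) \<longlonglongrightarrow> X t"
proof -
  have int: "X integrable_on {s..t}" for s t
    by (rule integrable_on_mono_on) (use mono in \<open>auto simp: mono_on_def mono_def\<close>)
  have bd: "integral {s..t} X \<in> {X s * (t - s)..X t * (t - s)}" if "s \<le> t" for s t
  proof -
    have "integral {s..t} (\<lambda>_. X s) \<le> integral {s..t} X" "integral {s..t} X \<le> integral {s..t} (\<lambda>_. X t)"
      by (rule integral_le; auto intro: int monoD[OF mono])+
    then show ?thesis using that by (simp add: mult.commute)
  qed
  define h where "h n = 1 / real (Suc n)" for n
  have h: "0 < h n" for n by (simp add: h_def)
  define y where "y n t = integral {t..t + h n} X / h n" for n t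
  have ybd: "X t \<le> y n t" "y n t \<le> X (t + h n)" for n t
    using bd[of t "t + h n"] h[of n] by (simp_all add: y_def field_simps)
  show thesis
  proof
    show "y n t \<in> {0..1}" for n t using ybd(1)[of t n] ybd(2)[of n t] X01[of t] X01[of "t + h n"] by auto
    show "(\<lambda>n. y n t) \<longlonglongrightarrow> X t" for t
    proof (rule tendsto_sandwich[of "\<lambda>_. X t" _ _ "\<lambda>n. X (t + h n)"])
      have h0: "h \<longlonglongrightarrow> 0" unfolding h_def
        using LIMSEQ_inverse_real_of_nat by (simp add: inverse_eq_divide)
      have "filterlim (\<lambda>n. t + h n) (at_right t) sequentially"
        unfolding filterlim_at using h tendsto_add[OF tendsto_const[of t] h0]
        by (auto simp: order_less_imp_le less_imp_neq[OF h, symmetric])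
      with rc[of t] show "(\<lambda>n. X (t + h n)) \<longlonglongrightarrow> X t"
        unfolding continuous_within by (rule filterlim_compose)
    qed (use ybd in auto)
    show "lip {a..b} (y n)" for n a b
    proof (rule lip_real_le)
      fix s t assume "s \<in> {a..b}" "t \<in> {a..b}" "s \<le> t"
      have c: "integral {u..v} X + integral {v..w} X = integral {u..w} X" if "u \<le> v" "v \<le> w" for u v w
        using that by (intro integral_combine_Icc int) auto
      \<comment> \<open>Two decompositions of the integral over \<open>{s..t + h n}\<close>: the
        windows at \<open>s\<close> and at \<open>t\<close> differ by two pieces of length
        \<open>t - s\<close>.\<close>
      have "integral {s..s + h n} X + integral {s + h n..t + h n} X
          = integral {s..t} X + integral {t..t + h n} X"
        using h[of n] \<open>s \<le> t\<close> by (subst (1 2) c) auto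
      moreover have "integral {u..v} X \<in> {0..v - u}" if "u \<le> v" for u v
      proof -
        have "0 \<le> X u * (v - u)" "X v * (v - u) \<le> 1 * (v - u)"
          using X01[of u] X01[of v] that mult_right_mono[of "X v" 1 "v - u"] by auto
        then show ?thesis using bd[OF that] by auto
      qed
      from this[of "s + h n" "t + h n"] this[of s t] have "integral {s + h n..t + h n} X \<in> {0..t - s}"
        "integral {s..t} X \<in> {0..t - s}" using \<open>s \<le> t\<close> by auto
      ultimately have "\<bar>integral {t..t + h n} X - integral {s..s + h n} X\<bar> \<le> t - s" by auto
      moreover have "y n t - y n s = (integral {t..t + h n} X - integral {s..s + h n} X) * (1 / h n)"
        by (simp add: y_def diff_divide_distrib)
      ultimately show "norm (y n t - y n s) \<le> 1 / h n * (t - s)"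
        using h[of n] by (simp add: abs_mult divide_right_mono)
    qed
  qed
qed

lemma lip_concat:
  fixes f g :: "real \<Rightarrow> 'b::real_normed_vector"
  assumes "lip {a..b} f" "lip {b..c} g" "f b = g b"
  shows "lip {a..c} (\<lambda>x. if x \<le> b then f x else g x)"
proof -
  obtain L M where "L-lipschitz_on {a..b} f" "M-lipschitz_on {b..c} g"
    using assms(1,2) by (auto simp: lip_def)
  then have "(max L M)-lipschitz_on {a..b} f" "(max L M)-lipschitz_on {b..c} g"
    by (auto elim: lipschitz_on_mono)
  from lipschitz_on_concat[OF this assms(3)] show ?thesis by (auto simp: lip_def)
qed

subsection \<open>Differentiation of the inverse and of the determinant\<close>

lemma matrix_inv_inverse:
  assumes "invertible (A :: real ^ 'n ^ 'n)"
  shows "A ** matrix_inv A = mat 1" "matrix_inv A ** A = mat 1"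
  using someI_ex[OF assms[unfolded invertible_def]] by (simp_all add: matrix_inv_def)

lemma matrix_inv_symmetric:
  assumes "invertible (A :: real ^ 'n ^ 'n)" "transpose A = A"
  shows "transpose (matrix_inv A) = matrix_inv A"
  by (metis assms matrix_inv_inverse matrix_mul_assoc matrix_mul_lid matrix_mul_rid matrix_transpose_mul
      transpose_mat)

text \<open>Each row of the symmetric inverse solves a system with a unit vector on the right, so
  its norm is at most \<open>1 / c\<close>; the dimension comes from adding up the rows.\<close>

lemma matrix_inv_norm:
  fixes A :: "real ^ 'n ^ 'n"
  assumes "pd_by c A" "0 < c"
  shows "norm (matrix_inv A) \<le> real CARD('n) / c"
proof -
  let ?B = "matrix_inv A"
  have inv: "invertible A" by (rule pd_by_invertible[OF assms])
  have sym: "transpose ?B = ?B" using assms(1) by (intro matrix_inv_symmetric inv) (simp add: pd_by_iff)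
  have "norm (?B $ i) \<le> 1 / c" for i
  proof -
    have "?B $ i = ?B *v axis i 1"
      by (subst sym[symmetric]) (simp add: matrix_vector_mult_basis column_def transpose_def)
    moreover have "A *v (?B *v axis i 1) = axis i 1"
      by (simp add: matrix_vector_mul_assoc matrix_inv_inverse inv)
    ultimately show ?thesis
      using pd_by_norm_bound[OF assms(1), of "?B $ i"] assms(2) by (simp add: field_simps)
  qed
  then have "(\<Sum>i\<in>UNIV. norm (?B $ i)) \<le> (\<Sum>i\<in>(UNIV :: 'n set). 1 / c)" by (intro sum_mono)
  moreover have "norm ?B \<le> (\<Sum>i\<in>UNIV. norm (?B $ i))"
    unfolding norm_vec_def by (rule L2_set_le_sum) simp
  ultimately show ?thesis by simp
qed

text \<open>The resolvent identity, source of both the Lipschitz bound and the derivative of the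
  inverse.\<close>

lemma matrix_inv_diff:
  fixes A B :: "real ^ 'n ^ 'n"
  assumes "invertible A" "invertible B"
  shows "matrix_inv A - matrix_inv B = - (matrix_inv A ** (A - B) ** matrix_inv B)"
  by (simp add: matrix_mult_algebra matrix_inv_inverse assms matrix_mul_assoc[symmetric])

lemma lip_matrix_inv:
  assumes "0 < c" shows "lip {A :: real ^ 'n ^ 'n. pd_by c A} matrix_inv"
proof -
  let ?N = "real CARD('n) / c"
  obtain K where K: "0 < K" "\<And>(A :: real ^ 'n ^ 'n) (B :: real ^ 'n ^ 'n). norm (A ** B) \<le> norm A * norm B * K"
    using bounded_bilinear.pos_bounded[OF bounded_bilinear_matrix_mult] by blast
  show ?thesis
  proof (rule lipI)
    fix A B :: "real ^ 'n ^ 'n" assume "A \<in> {A. pd_by c A}" "B \<in> {A. pd_by c A}"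
    then have AB: "pd_by c A" "pd_by c B" by auto
    have "norm (matrix_inv A - matrix_inv B) \<le> norm (matrix_inv A ** (A - B)) * norm (matrix_inv B) * K"
      using K(2)[of "matrix_inv A ** (A - B)" "matrix_inv B"] by (simp add: matrix_inv_diff pd_by_invertible[OF AB(1) assms] pd_by_invertible[OF AB(2) assms])
    also have "\<dots> \<le> (?N * norm (A - B) * K) * ?N * K"
      using AB assms K matrix_inv_norm[OF AB(1) assms] matrix_inv_norm[OF AB(2) assms]
      by (intro mult_right_mono mult_mono order_trans[OF K(2)]) (auto intro!: mult_nonneg_nonneg)
    finally show "dist (matrix_inv A) (matrix_inv B) \<le> (?N * K * ?N * K) * dist A B"
      by (simp add: dist_norm mult_ac)
  qed
qed

lemma matrix_inv_has_vector_derivative: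
  fixes A :: "real \<Rightarrow> real ^ 'n ^ 'n"
  assumes A: "(A has_vector_derivative A') (at t within S)" and t: "t \<in> S"
    and c: "0 < c" "\<And>s. s \<in> S \<Longrightarrow> pd_by c (A s)"
  shows "((\<lambda>s. matrix_inv (A s)) has_vector_derivative
      - (matrix_inv (A t) ** A' ** matrix_inv (A t))) (at t within S)"
  unfolding has_vector_derivative_iff_quotient
proof (rule Lim_transform_eventually)
  have "continuous (at t within S) A" by (rule has_vector_derivative_continuous[OF A])
  moreover have "continuous (at (A t) within A ` S) matrix_inv"
    using lip_continuous[OF lip_matrix_inv[OF c(1)]] c(2) t
    by (auto simp: continuous_on_eq_continuous_within intro: continuous_within_subset)
  ultimately have "continuous (at t within S) (\<lambda>s. matrix_inv (A s))"
    by (rule continuous_within_compose2[of t S A matrix_inv])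
  then have inv: "((\<lambda>s. matrix_inv (A s)) \<longlongrightarrow> matrix_inv (A t)) (at t within S)"
    by (simp add: continuous_within)
  show "((\<lambda>s. - (matrix_inv (A s) ** ((1 / (s - t)) *\<^sub>R (A s - A t)) ** matrix_inv (A t)))
      \<longlongrightarrow> - (matrix_inv (A t) ** A' ** matrix_inv (A t))) (at t within S)"
    using A by (intro tendsto_intros bounded_bilinear.tendsto[OF bounded_bilinear_matrix_mult] inv)
      (simp add: has_vector_derivative_iff_quotient)
  have "\<forall>\<^sub>F s in at t within S. s \<in> S" by (simp add: eventually_at_filter)
  then show "\<forall>\<^sub>F s in at t within S. - (matrix_inv (A s) ** ((1 / (s - t)) *\<^sub>R (A s - A t)) ** matrix_inv (A t))
      = (1 / (s - t)) *\<^sub>R (matrix_inv (A s) - matrix_inv (A t))"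
  proof eventually_elim
    case (elim s)
    have "matrix_inv (A s) - matrix_inv (A t) = - (matrix_inv (A s) ** (A s - A t) ** matrix_inv (A t))"
      using c t elim by (intro matrix_inv_diff) (auto intro: pd_by_invertible)
    then show ?case by (simp only: matrix_mult_algebra scaleR_minus_right)
  qed
qed

lemma det_mat_1_add_has_derivative:
  fixes X :: "real \<Rightarrow> real ^ 'n ^ 'n"
  assumes X: "(X has_vector_derivative X') (at t within S)" and X0: "X t = 0"
  shows "((\<lambda>s. det (mat 1 + X s)) has_real_derivative trace X') (at t within S)"
proof -
  let ?U = "UNIV :: 'n set"
  define m where "m i j s = (if i = j then 1 else 0) + X s $ i $ j" for i j s
  have m: "(m i j has_real_derivative X' $ i $ j) (at t within S)" for i j
  proof -
    have "bounded_linear (\<lambda>A :: real ^ 'n ^ 'n. A $ i $ j)"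
      by (intro bounded_linear_compose[OF bounded_linear_vec_nth bounded_linear_vec_nth])
    from bounded_linear.has_vector_derivative[OF this X] show ?thesis
      unfolding m_def[abs_def] has_real_derivative_iff_has_vector_derivative
      by (auto intro!: derivative_eq_intros)
  qed
  have mt: "m i j t = (if i = j then 1 else 0)" for i j by (simp add: m_def X0)
  have "((\<lambda>s. \<Sum>p\<in>{p. p permutes ?U}. of_int (sign p) * (\<Prod>i\<in>?U. m i (p i) s)) has_real_derivative
      (\<Sum>p\<in>{p. p permutes ?U}. of_int (sign p) *
         (\<Sum>i\<in>?U. X' $ i $ p i * (\<Prod>j\<in>?U - {i}. m j (p j) t)))) (at t within S)"
  proof (intro DERIV_sum DERIV_cmult)
    fix p
    have "((\<lambda>s. \<Prod>i\<in>?U. m i (p i) s) has_derivative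
        (\<lambda>y. \<Sum>i\<in>?U. X' $ i $ p i * y * (\<Prod>j\<in>?U - {i}. m j (p j) t))) (at t within S)"
      by (rule has_derivative_prod) (rule m[unfolded has_field_derivative_def])
    moreover have "(\<lambda>y. \<Sum>i\<in>?U. X' $ i $ p i * y * (\<Prod>j\<in>?U - {i}. m j (p j) t))
        = (*) (\<Sum>i\<in>?U. X' $ i $ p i * (\<Prod>j\<in>?U - {i}. m j (p j) t))"
      by (auto simp: fun_eq_iff sum_distrib_left mult_ac)
    ultimately show "((\<lambda>s. \<Prod>i\<in>?U. m i (p i) s) has_real_derivative
        (\<Sum>i\<in>?U. X' $ i $ p i * (\<Prod>j\<in>?U - {i}. m j (p j) t))) (at t within S)"
      by (simp add: has_field_derivative_def)
  qed
  moreover have "(\<Sum>p\<in>{p. p permutes ?U}. of_int (sign p) *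
         (\<Sum>i\<in>?U. X' $ i $ p i * (\<Prod>j\<in>?U - {i}. m j (p j) t))) = trace X'"
  proof -
    have "(\<Sum>p\<in>{p. p permutes ?U}. of_int (sign p) *
         (\<Sum>i\<in>?U. X' $ i $ p i * (\<Prod>j\<in>?U - {i}. m j (p j) t)))
       = (\<Sum>p\<in>{id}. of_int (sign p) *
         (\<Sum>i\<in>?U. X' $ i $ p i * (\<Prod>j\<in>?U - {i}. m j (p j) t)))"
    proof (rule sum.mono_neutral_right)
      show "\<forall>p\<in>{p. p permutes ?U} - {id}. of_int (sign p) *
         (\<Sum>i\<in>?U. X' $ i $ p i * (\<Prod>j\<in>?U - {i}. m j (p j) t)) = 0"
      proof
        fix p assume p: "p \<in> {p. p permutes ?U} - {id}"
        have "(\<Prod>j\<in>?U - {i}. m j (p j) t) = 0" for i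
        proof -
          \<comment> \<open>A permutation other than the identity moves at least two indices,
            \<open>k\<close> and \<open>p k\<close>. One of them survives the removal of
            \<open>i\<close> and contributes an off-diagonal entry of the identity.\<close>
          obtain k where k: "p k \<noteq> k" using p by (auto simp: fun_eq_iff)
          have inj: "inj p" using p by (auto intro: permutes_inj)
          then have "p (p k) \<noteq> p k" using k by (auto dest: injD)
          then obtain j where "j \<noteq> i" "p j \<noteq> j" using k by metis
          then show ?thesis by (intro prod_zero) (auto simp: mt intro!: bexI[of _ j])
        qed
        then show "of_int (sign p) * (\<Sum>i\<in>?U. X' $ i $ p i * (\<Prod>j\<in>?U - {i}. m j (p j) t)) = 0"
          by (simp only: mult_zero_right sum.neutral_const)
      qed
    qed (auto simp: finite_permutations permutes_id)
    also have "\<dots> = trace X'" by (simp add: mt trace_def)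
    finally show ?thesis .
  qed
  ultimately show ?thesis by (simp add: det_def m_def mat_def if_distrib)
qed

text \<open>Jacobi's formula, reduced to the derivative of the determinant at the identity by
  factoring out \<open>A t\<close>.\<close>

lemma ln_det_has_derivative:
  fixes A :: "real \<Rightarrow> real ^ 'n ^ 'n"
  assumes A: "(A has_vector_derivative A') (at t within S)"
    and sym: "transpose (A t) = A t" and pos: "0 < det (A t)"
  shows "((\<lambda>s. ln (det (A s))) has_real_derivative matrix_inv (A t) \<bullet> A') (at t within S)"
proof -
  let ?B = "matrix_inv (A t)"
  have inv: "invertible (A t)" using pos by (simp add: invertible_det_nz)
  have "((\<lambda>s. ?B ** (A s - A t)) has_vector_derivative ?B ** A') (at t within S)"
    by (rule bounded_linear.has_vector_derivative[OF
        bounded_bilinear.bounded_linear_right[OF bounded_bilinear_matrix_mult]])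
       (use A in \<open>auto intro!: derivative_eq_intros\<close>)
  then have "((\<lambda>s. det (mat 1 + ?B ** (A s - A t))) has_real_derivative trace (?B ** A')) (at t within S)"
    by (rule det_mat_1_add_has_derivative) (simp add: matrix_matrix_mult_def vec_eq_iff)
  then have "((\<lambda>s. det (A t) * det (mat 1 + ?B ** (A s - A t))) has_real_derivative
      det (A t) * trace (?B ** A')) (at t within S)"
    by (rule DERIV_cmult)
  moreover have "det (A t) * det (mat 1 + ?B ** (A s - A t)) = det (A s)" for s
  proof -
    have "A t ** (mat 1 + ?B ** (A s - A t)) = A s"
      by (simp add: matrix_mult_algebra matrix_mul_assoc matrix_inv_inverse inv)
    then show ?thesis by (metis det_mul)
  qed
  moreover have "trace (?B ** A') = ?B \<bullet> A'"
  proof -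
    have "trace (?B ** A') = transpose ?B \<bullet> A'"
      by (simp add: trace_def matrix_matrix_mult_def transpose_def inner_vec_def) (rule sum.swap)
    then show ?thesis by (simp add: matrix_inv_symmetric inv sym)
  qed
  ultimately have "((\<lambda>s. det (A s)) has_real_derivative det (A t) * (?B \<bullet> A')) (at t within S)" by simp
  from DERIV_chain2[OF DERIV_ln_divide[OF pos] this] show ?thesis using pos by simp
qed

subsection \<open>Connecting paths\<close>

text \<open>Here \<open>w\<close> is the derivative of a monotone path with initial slope
  \<open>G\<close> and total increment \<open>R\<close>. The slope is faded out by the weight
  \<open>(1 - s / l) ^ k\<close>, whose integral is \<open>d = l / (k + 1)\<close>. For large
  \<open>k\<close> the rest \<open>R - d *\<^sub>R G\<close> is positive semidefinite, and it is
  spread with a weight that vanishes at 0 and has integral 1.\<close>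

lemma connecting_path:
  fixes G R :: "real ^ 'n ^ 'n" and l :: real
  assumes l: "0 < l" and G: "psd G" and R: "pd_by c R" "0 < c"
  obtains w where "lip {0..l} w" "\<And>s. s \<in> {0..l} \<Longrightarrow> psd (w s)" "w 0 = G" "(w has_integral R) {0..l}"
proof -
  obtain k :: nat where k: "l * norm G / c \<le> real k" using real_arch_simple by blast
  define d where "d = l / real (Suc k)"
  have d: "0 < d" using l by (simp add: d_def)
  have "norm (- (d *\<^sub>R G)) \<le> c"
  proof -
    have "l * norm G \<le> c * real k" using k R(2) by (simp add: field_simps)
    then have "l * norm G \<le> c * real (Suc k)" using R(2) by (simp add: algebra_simps)
    then show ?thesis using d by (simp add: d_def field_simps)
  qed
  moreover have "transpose (- (d *\<^sub>R G)) = - (d *\<^sub>R G)"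
    using G by (simp add: psd_def transpose_minus transpose_scalar)
  ultimately have "psd (R + - (d *\<^sub>R G))" by (intro psd_of_norm[OF R(1)])
  then have E: "psd (R - d *\<^sub>R G)" by simp
  define w where "w s = (1 - s / l) ^ k *\<^sub>R G + (2 * s / l\<^sup>2) *\<^sub>R (R - d *\<^sub>R G)" for s
  define W where "W s = (- d * (1 - s / l) ^ Suc k) *\<^sub>R G + (s\<^sup>2 / l\<^sup>2) *\<^sub>R (R - d *\<^sub>R G)" for s
  show thesis
  proof
    show "lip {0..l} w" unfolding w_def[abs_def]
    proof (intro lip_add lip_scaleR lip_const)
      show "lip {0..l} (\<lambda>s. (1 - s / l) ^ k)" "lip {0..l} (\<lambda>s. 2 * s / l\<^sup>2)"
        using l by (auto intro!: lip_C1 derivative_eq_intros continuous_intros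
            simp: has_real_derivative_iff_has_vector_derivative[symmetric])
    qed auto
    show "psd (w s)" if "s \<in> {0..l}" for s
      unfolding w_def using that l by (intro psd_add psd_scaleR G E) auto
    show "w 0 = G" by (simp add: w_def)
    have "(w has_integral W l - W 0) {0..l}"
    proof (rule fundamental_theorem_of_calculus)
      show "(W has_vector_derivative w s) (at s within {0..l})" if "s \<in> {0..l}" for s
      proof -
        have "((\<lambda>s. - d * (1 - s / l) ^ Suc k) has_real_derivative (1 - s / l) ^ k) (at s within {0..l})"
          by (rule derivative_eq_intros refl | (use l in \<open>simp add: d_def\<close>))+
        moreover have "((\<lambda>s. s\<^sup>2 / l\<^sup>2) has_real_derivative 2 * s / l\<^sup>2) (at s within {0..l})"
          by (rule DERIV_cdivide) (auto intro!: derivative_eq_intros)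
        ultimately have "(W has_vector_derivative
            (((- d * (1 - s / l) ^ Suc k) *\<^sub>R 0 + (1 - s / l) ^ k *\<^sub>R G)
             + ((s\<^sup>2 / l\<^sup>2) *\<^sub>R 0 + (2 * s / l\<^sup>2) *\<^sub>R (R - d *\<^sub>R G)))) (at s within {0..l})"
          unfolding W_def[abs_def]
          by (intro has_vector_derivative_add has_vector_derivative_scaleR has_vector_derivative_const)
        then show ?thesis by (simp add: w_def)
      qed
    qed (use l in simp)
    moreover have "W l - W 0 = R" using l by (simp add: W_def)
    ultimately show "(w has_integral R) {0..l}" by simp
  qed
qed

subsection \<open>The covariance function\<close>

lemma lip_vec:
  fixes f :: "'b::metric_space \<Rightarrow> 'a::real_normed_vector ^ 'n"
  assumes "\<And>i. lip S (\<lambda>s. f s $ i)" shows "lip S f"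
proof -
  obtain L where L: "\<And>i. (L i)-lipschitz_on S (\<lambda>s. f s $ i)" using assms unfolding lip_def by metis
  show ?thesis
  proof (rule lipI)
    fix s t assume st: "s \<in> S" "t \<in> S"
    have "dist (f s) (f t) \<le> (\<Sum>i\<in>UNIV. dist (f s $ i) (f t $ i))"
      unfolding dist_vec_def by (rule L2_set_le_sum) simp
    also have "\<dots> \<le> (\<Sum>i\<in>UNIV. L i * dist s t)"
      by (intro sum_mono lipschitz_onD[OF L] st)
    finally show "dist (f s) (f t) \<le> (\<Sum>i\<in>UNIV. L i) * dist s t" by (simp add: sum_distrib_right)
  qed
qed

lemma has_vector_derivative_vec:
  fixes f :: "real \<Rightarrow> 'a::real_normed_vector ^ 'n"
  assumes "\<And>i. ((\<lambda>s. f s $ i) has_vector_derivative f' $ i) (at t within S)"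
  shows "(f has_vector_derivative f') (at t within S)"
  using assms unfolding has_vector_derivative_iff_quotient by (intro vec_tendstoI) simp

lemma bounded_linear_entry: "bounded_linear (\<lambda>A :: real ^ 'n ^ 'm. A $ i $ j)"
  by (intro bounded_linear_compose[OF bounded_linear_vec_nth bounded_linear_vec_nth])

lemma has_real_derivative_entry:
  fixes A :: "real \<Rightarrow> real ^ 'n ^ 'm"
  assumes "(A has_vector_derivative A') (at t within S)"
  shows "((\<lambda>s. A s $ i $ j) has_real_derivative A' $ i $ j) (at t within S)"
  using bounded_linear.has_vector_derivative[OF bounded_linear_entry assms]
  by (simp add: has_real_derivative_iff_has_vector_derivative)

section \<open>Power series for the entries of the covariance function\<close>

definition cov_coeff :: "(nat \<Rightarrow> real ^ 'n) \<Rightarrow> 'n \<Rightarrow> 'n \<Rightarrow> nat \<Rightarrow> real"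
  where "cov_coeff \<beta> i j p = (if 2 \<le> p then \<beta> p $ i * \<beta> p $ j else 0)"

text \<open>The \<open>k\<close>-th derivative of the scalar function by which \<xi> acts on the
  entry \<open>(i, j)\<close>: the orders 0, 1, 2 belong to \<xi>, \<xi>' and the differential of
  \<xi>'.\<close>

definition cov :: "(nat \<Rightarrow> real ^ 'n) \<Rightarrow> nat \<Rightarrow> 'n \<Rightarrow> 'n \<Rightarrow> real \<Rightarrow> real"
  where "cov \<beta> k i j z = (\<Sum>p. (diffs ^^ k) (cov_coeff \<beta> i j) p * z ^ p)"

locale covariance =
  fixes \<beta> :: "nat \<Rightarrow> real ^ 'n" and h :: "real ^ 'n"
  assumes summable_coeff: "\<And>j. (\<lambda>p. 2 ^ p * (\<beta> p $ j)\<^sup>2) summable_on {2..}"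
begin

text \<open>The inequality between arithmetic and geometric mean dominates the mixed series by two
  diagonal ones. Summability at 2 puts the closed interval \<open>{-1..1}\<close> strictly inside
  the domain of convergence, at every order of differentiation.\<close>

lemma cov_coeff_summable: "summable (\<lambda>p. cov_coeff \<beta> i j p * 2 ^ p)"
proof -
  let ?s = "\<lambda>j p. if 2 \<le> p then 2 ^ p * (\<beta> p $ j)\<^sup>2 else 0"
  have s: "summable (?s j)" for j
  proof -
    have "?s j summable_on UNIV"
      using summable_coeff[of j] by (rule summable_on_cong_neutral[THEN iffD1, rotated -1]) auto
    then show ?thesis by (subst (asm) summable_on_UNIV_nonneg_real_iff) auto
  qed
  show ?thesis
  proof (rule summable_comparison_test')
    show "summable (\<lambda>p. ?s i p + ?s j p)" by (intro summable_add s)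
    fix p :: nat
    have "2 * \<bar>a * b\<bar> \<le> a\<^sup>2 + b\<^sup>2" for a b :: real
      using sum_squares_bound[of "\<bar>a\<bar>" "\<bar>b\<bar>"] by (simp add: abs_mult mult.assoc)
    then have "\<bar>a * b\<bar> \<le> a\<^sup>2 + b\<^sup>2" for a b :: real by (smt (verit) abs_ge_zero)
    then have "2 ^ p * \<bar>\<beta> p $ i * \<beta> p $ j\<bar> \<le> 2 ^ p * ((\<beta> p $ i)\<^sup>2 + (\<beta> p $ j)\<^sup>2)"
      by (intro mult_left_mono) auto
    then show "norm (cov_coeff \<beta> i j p * 2 ^ p) \<le> ?s i p + ?s j p"
      by (simp add: cov_coeff_def abs_mult algebra_simps)
  qed
qed

lemma cov_series_summable: "\<bar>z\<bar> < 2 \<Longrightarrow> summable (\<lambda>p. (diffs ^^ k) (cov_coeff \<beta> i j) p * z ^ p)"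
proof (induction k arbitrary: z)
  case 0
  then show ?case using powser_inside[OF cov_coeff_summable[of i j], of z] by simp
next
  case (Suc k)
  then show ?case using termdiff_converges[of z 2 "(diffs ^^ k) (cov_coeff \<beta> i j)"] by simp
qed

lemma cov_has_derivative: "\<bar>z\<bar> < 2 \<Longrightarrow> (cov \<beta> k i j has_real_derivative cov \<beta> (Suc k) i j z) (at z)"
  using termdiffs_strong'[of 2 "(diffs ^^ k) (cov_coeff \<beta> i j)" z] cov_series_summable[of _ k i j]
  by (simp add: cov_def[abs_def])

lemma cov_path_derivative:
  assumes "(f has_real_derivative f') (at t within S)" "\<bar>f t\<bar> < 2"
  shows "((\<lambda>s. cov \<beta> k i j (f s)) has_real_derivative cov \<beta> (Suc k) i j (f t) * f') (at t within S)"
  by (rule DERIV_chain2[OF cov_has_derivative[OF assms(2)] assms(1)])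

lemma cov_continuous: "continuous_on {-1..1} (cov \<beta> k i j)"
  by (rule DERIV_continuous_on, rule has_field_derivative_at_within, rule cov_has_derivative) auto

lemma lip_cov: "lip {-1..1} (cov \<beta> k i j)"
  by (rule lip_C1[of _ _ _ "cov \<beta> (Suc k) i j"])
     (auto intro!: cov_continuous has_field_derivative_at_within[OF cov_has_derivative]
       simp: has_real_derivative_iff_has_vector_derivative[symmetric])

lemma xi'_entry: assumes "\<bar>A $ i $ j\<bar> < 2" shows "xi' \<beta> A $ i $ j = cov \<beta> 1 i j (A $ i $ j)"
proof -
  let ?a = "A $ i $ j"
  let ?f = "\<lambda>p. diffs (cov_coeff \<beta> i j) p * ?a ^ p"
  let ?g = "\<lambda>p. real p * cov_coeff \<beta> i j p * ?a ^ (p - 1)"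
  obtain r where r: "\<bar>?a\<bar> < r" "r < 2" using dense[OF assms] by blast
  have "summable (\<lambda>p. diffs (cov_coeff \<beta> i j) p * r ^ p)"
    using cov_series_summable[of r 1 i j] r by simp
  then have "summable (\<lambda>p. norm (?f p))"
    by (rule powser_insidea) (use r in auto)
  moreover have "?f sums cov \<beta> 1 i j ?a"
    using cov_series_summable[of ?a 1 i j] assms by (simp add: cov_def summable_sums)
  ultimately have "(?f has_sum cov \<beta> 1 i j ?a) UNIV" by (rule norm_summable_imp_has_sum)
  \<comment> \<open>\<open>?g\<close> is indexed by the exponent before differentiation and
    \<open>?f\<close> by the one after it. The shift skips \<open>p = 0\<close>, where
    \<open>p - 1\<close> would be truncated; the term at \<open>p = 1\<close> vanishes with its
    coefficient.\<close>
  moreover have "?g \<circ> Suc = ?f" by (simp add: fun_eq_iff diffs_def)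
  ultimately have "(?g has_sum cov \<beta> 1 i j ?a) (Suc ` UNIV)"
    by (simp add: has_sum_reindex)
  then have "((\<lambda>p. real p * outer_prod (\<beta> p) (\<beta> p) $ i $ j * ?a ^ (p - 1)) has_sum cov \<beta> 1 i j ?a) {2..}"
  proof (rule has_sum_cong_neutral[THEN iffD1, rotated -1])
    fix p assume "p \<in> {2..} - Suc ` UNIV"
    then have False by (cases p) auto
    then show "real p * outer_prod (\<beta> p) (\<beta> p) $ i $ j * ?a ^ (p - 1) = 0" ..
  qed (auto simp: cov_coeff_def outer_prod_def)
  then show ?thesis by (simp add: xi'_def infsumI)
qed

section \<open>The field, its primitive and its differential\<close>

definition xi_field :: "real ^ 'n ^ 'n \<Rightarrow> real ^ 'n ^ 'n"
  where "xi_field A = xi' \<beta> A + outer_prod h h"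

text \<open>A primitive of \<open>xi_field\<close> for the Frobenius product. Where the order
  parameter is 1 it turns the field integral into boundary values.\<close>

definition potential :: "real ^ 'n ^ 'n \<Rightarrow> real"
  where "potential A = (\<Sum>i\<in>UNIV. \<Sum>j\<in>UNIV. cov \<beta> 0 i j (A $ i $ j)) + outer_prod h h \<bullet> A"

definition xi_field_deriv :: "real ^ 'n ^ 'n \<Rightarrow> real ^ 'n ^ 'n \<Rightarrow> real ^ 'n ^ 'n"
  where "xi_field_deriv A B = (\<chi> i j. cov \<beta> 2 i j (A $ i $ j) * B $ i $ j)"

text \<open>The differential of a gradient field is self-adjoint. In the first variation this moves
  the differential from the direction \<eta> to the derivative of the path.\<close>

lemma xi_field_deriv_inner: "xi_field_deriv A B \<bullet> C = xi_field_deriv A C \<bullet> B"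
  by (simp add: xi_field_deriv_def inner_vec_def mult_ac)

lemma potential_derivative:
  assumes A: "(A has_vector_derivative A') (at t within S)" and "\<And>i j. A t $ i $ j \<in> {-1..1}"
  shows "((\<lambda>s. potential (A s)) has_real_derivative xi_field (A t) \<bullet> A') (at t within S)"
proof -
  have b: "\<bar>A t $ i $ j\<bar> < 2" for i j using assms(2)[of i j] by auto
  have "((\<lambda>s. \<Sum>i\<in>UNIV. \<Sum>j\<in>UNIV. cov \<beta> 0 i j (A s $ i $ j)) has_real_derivative
      (\<Sum>i\<in>UNIV. \<Sum>j\<in>UNIV. cov \<beta> (Suc 0) i j (A t $ i $ j) * A' $ i $ j)) (at t within S)"
    by (intro DERIV_sum cov_path_derivative has_real_derivative_entry A b)
  moreover have "(\<Sum>i\<in>UNIV. \<Sum>j\<in>UNIV. cov \<beta> (Suc 0) i j (A t $ i $ j) * A' $ i $ j) = xi' \<beta> (A t) \<bullet> A'"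
    using xi'_entry[OF b] by (simp add: inner_vec_def)
  moreover have "((\<lambda>s. outer_prod h h \<bullet> A s) has_real_derivative outer_prod h h \<bullet> A') (at t within S)"
    using bounded_linear.has_vector_derivative[OF bounded_linear_inner_right A, of "outer_prod h h"]
    by (simp add: has_real_derivative_iff_has_vector_derivative)
  ultimately show ?thesis
    unfolding potential_def xi_field_def inner_add_left by (auto intro: DERIV_add)
qed

lemma xi_field_derivative:
  assumes A: "(A has_vector_derivative A') (at t within S)" and "t \<in> S"
    and b: "\<And>s i j. s \<in> S \<Longrightarrow> A s $ i $ j \<in> {-1..1}"
  shows "((\<lambda>s. xi_field (A s)) has_vector_derivative xi_field_deriv (A t) A') (at t within S)"
proof (rule has_vector_derivative_vec, rule has_vector_derivative_vec)
  fix i j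
  have b: "\<bar>A s $ i $ j\<bar> < 2" if "s \<in> S" for s i j using b[OF that, of i j] by auto
  have "((\<lambda>s. cov \<beta> 1 i j (A s $ i $ j) + outer_prod h h $ i $ j) has_real_derivative
      cov \<beta> (Suc 1) i j (A t $ i $ j) * A' $ i $ j + 0) (at t within S)"
    by (intro DERIV_add cov_path_derivative has_real_derivative_entry A b \<open>t \<in> S\<close> DERIV_const)
  then have "((\<lambda>s. cov \<beta> 1 i j (A s $ i $ j) + outer_prod h h $ i $ j) has_vector_derivative
      xi_field_deriv (A t) A' $ i $ j) (at t within S)"
    by (simp add: has_real_derivative_iff_has_vector_derivative xi_field_deriv_def numeral_2_eq_2)
  then show "((\<lambda>s. xi_field (A s) $ i $ j) has_vector_derivative xi_field_deriv (A t) A' $ i $ j) (at t within S)"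
    by (rule has_vector_derivative_transform[OF \<open>t \<in> S\<close>, rotated]) (simp add: xi_field_def xi'_entry b)
qed

lemma lip_entry: "lip S A \<Longrightarrow> lip S (\<lambda>s. A s $ i $ j)"
  for A :: "'b::metric_space \<Rightarrow> real ^ 'k ^ 'm"
  by (rule lip_bounded_linear[OF bounded_linear_entry])

lemma lip_xi_field:
  assumes "lip S A" "\<And>s i j. s \<in> S \<Longrightarrow> A s $ i $ j \<in> {-1..1}"
  shows "lip S (\<lambda>s. xi_field (A s))"
proof (intro lip_vec)
  fix i j
  have "lip S (\<lambda>s. cov \<beta> 1 i j (A s $ i $ j) + outer_prod h h $ i $ j)"
    using assms by (intro lip_add lip_const lip_compose[OF lip_entry lip_cov]) auto
  moreover have "\<bar>A s $ i $ j\<bar> < 2" if "s \<in> S" for s using assms(2)[OF that, of i j] by auto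
  ultimately show "lip S (\<lambda>s. xi_field (A s) $ i $ j)"
    by (elim lip_cong) (simp add: xi_field_def xi'_entry)
qed

lemma lip_xi_field_deriv:
  assumes "compact S" "lip S A" "\<And>s i j. s \<in> S \<Longrightarrow> A s $ i $ j \<in> {-1..1}" "lip S B"
  shows "lip S (\<lambda>s. xi_field_deriv (A s) (B s))"
proof (intro lip_vec)
  fix i j
  show "lip S (\<lambda>s. xi_field_deriv (A s) (B s) $ i $ j)"
    unfolding xi_field_deriv_def vec_lambda_beta
    using assms by (intro lip_mult lip_entry lip_compose[OF lip_entry lip_cov]) auto
qed

text \<open>The series of \<xi>' begins with exponent 1, so only the external field remains at 0.
  This makes the initial value of H D H positive semidefinite.\<close>

lemma xi_field_zero: "xi_field 0 = outer_prod h h"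
  unfolding xi_field_def by (simp add: vec_eq_iff xi'_entry cov_def diffs_def cov_coeff_def)

lemma hadamard_power_psd: "psd A \<Longrightarrow> psd (\<chi> i j. (A $ i $ j) ^ p)"
proof (induction p)
  case 0
  have "(\<chi> i j. (A $ i $ j) ^ 0) = outer_prod (\<chi> i. 1) (\<chi> i. 1)"
    by (simp add: outer_prod_def)
  then show ?case by (simp only: psd_outer_prod)
next
  case (Suc p)
  have "(\<chi> i j. (A $ i $ j) ^ Suc p) = hadamard A (\<chi> i j. (A $ i $ j) ^ p)"
    by (simp add: hadamard_def)
  then show ?case using Schur_product[OF Suc.prems Suc.IH[OF Suc.prems]] by (simp only:)
qed

text \<open>The term of the second derivative with index \<open>N\<close> comes from
  \<open>p = N + 2\<close>: it is a nonnegative multiple of the Hadamard product of a rank-one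
  matrix, the Hadamard power \<open>N\<close> of \<open>A\<close>, and \<open>B\<close>. Positive
  semidefiniteness survives sums and limits.\<close>

lemma xi_field_deriv_psd:
  assumes A: "psd A" "\<And>i j. A $ i $ j \<in> {-1..1}" and B: "psd B"
  shows "psd (xi_field_deriv A B)"
proof (rule psd_limit)
  let ?t = "\<lambda>p i j. (diffs ^^ 2) (cov_coeff \<beta> i j) p * (A $ i $ j) ^ p"
  show "(\<lambda>N. (\<chi> i j. (\<Sum>p<N. ?t p i j) * B $ i $ j)) \<longlonglongrightarrow> xi_field_deriv A B"
    unfolding xi_field_deriv_def
  proof (intro vec_tendstoI, unfold vec_lambda_beta, rule tendsto_mult[OF _ tendsto_const])
    fix i j
    have "\<bar>A $ i $ j\<bar> < 2" using A(2)[of i j] by auto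
    from summable_LIMSEQ[OF cov_series_summable[OF this, of 2 i j]]
    show "(\<lambda>N. \<Sum>p<N. ?t p i j) \<longlonglongrightarrow> cov \<beta> 2 i j (A $ i $ j)" by (simp add: cov_def)
  qed
  have "psd (\<chi> i j. (\<Sum>p<N. ?t p i j) * B $ i $ j)" for N
  proof (induction N)
    case 0
    have "(\<chi> i j. (\<Sum>p<0. ?t p i j) * B $ i $ j) = 0" by (simp add: vec_eq_iff)
    then show ?case by (simp only: psd_zero)
  next
    case (Suc N)
    have "(\<chi> i j. (\<Sum>p<Suc N. ?t p i j) * B $ i $ j) = (\<chi> i j. (\<Sum>p<N. ?t p i j) * B $ i $ j)
       + (real (Suc N) * real (Suc (Suc N))) *\<^sub>R
          hadamard (outer_prod (\<beta> (Suc (Suc N))) (\<beta> (Suc (Suc N))))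
            (hadamard (\<chi> i j. (A $ i $ j) ^ N) B)"
      by (simp add: vec_eq_iff hadamard_def outer_prod_def numeral_2_eq_2 diffs_def cov_coeff_def
          algebra_simps del: of_nat_Suc)
    then show ?case
      using Suc.IH by (auto simp del: sum.lessThan_Suc
          intro!: psd_add psd_scaleR Schur_product psd_outer_prod hadamard_power_psd A B)
  qed
  then show "\<forall>\<^sub>F N in sequentially. psd (\<chi> i j. (\<Sum>p<N. ?t p i j) * B $ i $ j)" by simp
qed simp

end

subsection \<open>The order parameter\<close>

text \<open>The distribution function behind \<open>parisi_measure\<close> on the whole line; the
  values of \<open>x\<close> itself outside \<open>[0, m]\<close> are arbitrary.\<close>

definition cdf_ext :: "real \<Rightarrow> (real \<Rightarrow> real) \<Rightarrow> real \<Rightarrow> real"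
  where "cdf_ext m x t = (if t < 0 then 0 else x (min t m))"

locale order_parameter =
  fixes m :: real and x :: "real \<Rightarrow> real"
  assumes param: "order_param m x" and m: "0 \<le> m"
begin

abbreviation "X \<equiv> cdf_ext m x"

lemma x01: "t \<in> {0..m} \<Longrightarrow> x t \<in> {0..1}"
  and x_mono: "mono_on {0..m} x"
  and x_m: "x m = 1"
  using param by (auto simp: order_param_def dest: subsetD[OF _ imageI])

lemma X_eq: "t \<in> {0..m} \<Longrightarrow> X t = x t"
  by (auto simp: cdf_ext_def)

lemma X01: "X t \<in> {0..1}"
  using x01[of "min t m"] m by (auto simp: cdf_ext_def)

lemma X_mono: "mono X"
proof (rule monoI)
  fix s t :: real assume "s \<le> t"
  then show "X s \<le> X t"
    using m X01[of t] by (auto simp: cdf_ext_def intro!: mono_onD[OF x_mono])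
qed

lemma X_right_continuous: "continuous (at_right a) X"
proof -
  consider "a < 0" | "0 \<le> a" "a < m" | "m \<le> a" by linarith
  then show ?thesis
  proof cases
    case 1
    have "\<forall>\<^sub>F t in at_right a. X t = 0"
      using eventually_at_right_real[OF 1] by eventually_elim (auto simp: cdf_ext_def)
    then show ?thesis using 1 by (simp add: continuous_within cdf_ext_def tendsto_eventually)
  next
    case 2
    have "\<forall>\<^sub>F t in at_right a. x t = X t"
      using eventually_at_right_real[OF 2(2)]
      by eventually_elim (use 2 in \<open>auto simp: cdf_ext_def\<close>)
    moreover have "(x \<longlongrightarrow> x a) (at_right a)"
      using param 2 by (auto simp: order_param_def continuous_within)
    ultimately show ?thesis
      using 2 by (simp add: continuous_within Lim_transform_eventually X_eq)
  next
    case 3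
    have "\<forall>\<^sub>F t in at_right a. X t = 1"
      using eventually_at_right_less[of a]
      by eventually_elim (use 3 m x_m in \<open>auto simp: cdf_ext_def min_def\<close>)
    moreover have "X a = 1" using 3 m x_m by (auto simp: cdf_ext_def min_def)
    ultimately show ?thesis by (simp add: continuous_within tendsto_eventually)
  qed
qed

text \<open>The Stieltjes measure is explicit on half-open intervals, which are compared with the
  open and closed balls around \<open>t\<close>. From here on the support is handled through
  \<open>X\<close> alone.\<close>

lemma support_iff: "t \<in> measure_support (parisi_measure m x) \<longleftrightarrow> (\<forall>r>0. X (t - r) < X (t + r))"
proof -
  have M: "parisi_measure m x = interval_measure X"
    by (simp add: parisi_measure_def cdf_ext_def[abs_def])
  have Ioc: "emeasure (interval_measure X) {a<..b} = ennreal (X b - X a)" if "a \<le> b" for a b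
    using emeasure_interval_measure_Ioc[OF that, of X] X_mono X_right_continuous
    by (auto simp: mono_def)
  show ?thesis
  proof
    assume t: "t \<in> measure_support (parisi_measure m x)"
    show "\<forall>r>0. X (t - r) < X (t + r)"
    proof (intro allI impI)
      fix r :: real assume r: "0 < r"
      have "0 < emeasure (interval_measure X) {t - r<..<t + r}"
        using t r by (auto simp: measure_support_def M)
      also have "\<dots> \<le> emeasure (interval_measure X) {t - r<..t + r}"
        by (rule emeasure_mono) auto
      also have "\<dots> = ennreal (X (t + r) - X (t - r))" using r by (intro Ioc) simp
      finally show "X (t - r) < X (t + r)" by simp
    qed
  next
    assume *: "\<forall>r>0. X (t - r) < X (t + r)"
    have "0 < emeasure (interval_measure X) U" if U: "open U" "t \<in> U" for U
    proof -
      obtain e where e: "0 < e" "cball t e \<subseteq> U" using U open_contains_cball by blast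
      have "0 < ennreal (X (t + e) - X (t - e))" using *[rule_format, OF e(1)] by simp
      also have "\<dots> = emeasure (interval_measure X) {t - e<..t + e}" using e(1) by (intro Ioc[symmetric]) simp
      also have "\<dots> \<le> emeasure (interval_measure X) U"
        using U(1) e(2) by (intro emeasure_mono) (auto simp: dist_real_def intro!: subsetD[OF e(2)])
      finally show ?thesis .
    qed
    then show "t \<in> measure_support (parisi_measure m x)" by (simp add: measure_support_def M)
  qed
qed

definition T :: real where "T = top_time m x"

text \<open>Right continuity makes the infimum that defines \<open>T\<close> a minimum.\<close>

lemma T_bounds: "0 \<le> T" "T \<le> m" and x_T: "x T = 1"
proof -
  let ?S = "{t \<in> {0..m}. x t = 1}"
  have ne: "m \<in> ?S" using x_m m by simp
  have bdd: "bdd_below ?S" by (intro bdd_belowI[of _ 0]) auto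
  show T0: "0 \<le> T" unfolding T_def top_time_def using ne by (intro cInf_greatest) auto
  show Tm: "T \<le> m" unfolding T_def top_time_def by (rule cInf_lower[OF ne bdd])
  have one: "X t = 1" if "T < t" for t
  proof -
    have "Inf ?S < t" using that by (simp add: T_def top_time_def)
    then have "\<exists>s\<in>?S. s < t" by (rule cInf_lessD[rotated]) (use ne in blast)
    then obtain s where "s \<in> ?S" "s < t" by blast
    then have "1 \<le> X t" using monoD[OF X_mono, of s t] by (simp add: X_eq)
    then show ?thesis using X01[of t] by simp
  qed
  have "\<forall>\<^sub>F t in at_right T. X t = 1"
    using eventually_at_right_less[of T] by eventually_elim (rule one)
  then have "(X \<longlongrightarrow> 1) (at_right T)" by (rule tendsto_eventually)
  moreover have "(X \<longlongrightarrow> X T) (at_right T)" using X_right_continuous[of T] by (simp add: continuous_within)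
  ultimately have "X T = 1" by (metis tendsto_unique trivial_limit_at_right_real)
  then show "x T = 1" using T0 Tm by (simp add: X_eq)
qed

lemma X_after: "T \<le> t \<Longrightarrow> X t = 1"
  using monoD[OF X_mono, of T t] X01[of t] X_eq[of T] x_T T_bounds by simp

lemma x_after: "T \<le> t \<Longrightarrow> t \<le> m \<Longrightarrow> x t = 1"
  using X_after[of t] X_eq[of t] T_bounds by simp

lemma X_before: assumes "t < T" shows "X t < 1"
proof (rule ccontr)
  assume "\<not> X t < 1"
  then have "X t = 1" using X01[of t] by simp
  then have "0 \<le> t" by (auto simp: cdf_ext_def split: if_splits)
  then have "x t = 1" using \<open>X t = 1\<close> assms T_bounds by (simp add: X_eq)
  then have "T \<le> t" unfolding T_def top_time_def
    using \<open>0 \<le> t\<close> assms T_bounds by (intro cInf_lower bdd_belowI[of _ 0]) auto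
  then show False using assms by simp
qed

lemma T_support: "T \<in> measure_support (parisi_measure m x)"
  unfolding support_iff using X_before X_after by simp

lemma support_subset: assumes "t \<in> measure_support (parisi_measure m x)" shows "t \<in> {0..T}"
proof (rule ccontr)
  assume "t \<notin> {0..T}"
  then consider "t < 0" | "T < t" by fastforce
  then show False
  proof cases
    case 1
    then have "X (t + (- t / 2)) = 0" by (simp add: cdf_ext_def)
    then show False
      using assms[unfolded support_iff, rule_format, of "- t / 2"] 1 X01[of "t - (- t / 2)"] by simp
  next
    case 2
    have "X (t - (t - T)) = 1" by (rule X_after) simp
    then show False
      using assms[unfolded support_iff, rule_format, of "t - T"] 2 X01[of "t + (t - T)"] by simp
  qed
qed

lemma T_unique:
  assumes "s \<in> {0..m}" "x s = 1" "\<And>t. 0 \<le> t \<Longrightarrow> t < s \<Longrightarrow> x t \<noteq> 1"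
  shows "T = s"
proof (rule antisym)
  show "T \<le> s" unfolding T_def top_time_def
    using assms by (intro cInf_lower bdd_belowI[of _ 0]) auto
  show "s \<le> T" using assms(3)[of T] x_T T_bounds by force
qed

end

subsection \<open>Admissible pairs\<close>

locale cs_setting = covariance \<beta> h for \<beta> :: "nat \<Rightarrow> real ^ 'n" and h :: "real ^ 'n" +
  fixes Q :: "real ^ 'n ^ 'n" and m :: real
  assumes m_def: "m = real CARD('n)" and Q_psd: "psd Q" and Q_diag: "\<And>i. Q $ i $ i = 1"

locale cs_pair = cs_setting \<beta> h Q m
  for \<beta> :: "nat \<Rightarrow> real ^ 'n" and h :: "real ^ 'n" and Q :: "real ^ 'n ^ 'n" and m :: real +
  fixes x :: "real \<Rightarrow> real" and \<Phi> :: "real \<Rightarrow> real ^ 'n ^ 'n"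
  assumes adm: "admissible Q x \<Phi>"
begin

sublocale order_parameter m x
  using adm by unfold_locales (auto simp: admissible_def Let_def m_def)

lemma m_pos: "0 < m" by (simp add: m_def)

text \<open>The clamp extends the derivative of the path constantly beyond \<open>[0, m]\<close>,
  which makes it Lipschitz and positive semidefinite on the whole line.\<close>

definition \<phi> :: "real \<Rightarrow> real ^ 'n ^ 'n"
  where "\<phi> t = path_deriv \<Phi> (max 0 (min m t))"

lemma path: "psd_path Q \<Phi>" and trace_support: "t \<in> measure_support (parisi_measure m x) \<Longrightarrow> trace (\<Phi> t) = t"
  and det_T: "0 < det (Q - \<Phi> T)"
  using adm by (auto simp: admissible_def Let_def T_def simp flip: m_def)

lemma \<phi>_eq: "t \<in> {0..m} \<Longrightarrow> \<phi> t = path_deriv \<Phi> t"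
  by (simp add: \<phi>_def)

lemma \<Phi>_psd: "t \<in> {0..m} \<Longrightarrow> psd (\<Phi> t)"
  and \<Phi>_mono: "0 \<le> s \<Longrightarrow> s \<le> t \<Longrightarrow> t \<le> m \<Longrightarrow> psd (\<Phi> t - \<Phi> s)"
  and \<Phi>_0: "\<Phi> 0 = 0" and \<Phi>_m: "\<Phi> m = Q" and lip_\<Phi>: "lip {0..m} \<Phi>"
  using path by (auto simp: psd_path_def Let_def loewner_mono_on_def lip_def m_def)

lemma lip_\<phi>: "lip S \<phi>"
proof -
  have "lip S (\<lambda>t :: real. max 0 (min m t))"
    by (rule lipI[of _ _ 1]) (auto simp: dist_real_def max_def min_def)
  moreover have "lip {0..m} (path_deriv \<Phi>)" using path by (auto simp: psd_path_def Let_def lip_def m_def)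
  moreover have "(\<lambda>t. max 0 (min m t)) ` S \<subseteq> {0..m}" using m_pos by auto
  ultimately show ?thesis unfolding \<phi>_def[abs_def] by (rule lip_compose)
qed

lemma \<Phi>_deriv: assumes "t \<in> {0..m}" shows "(\<Phi> has_vector_derivative \<phi> t) (at t within {0..m})"
proof -
  have "\<Phi> differentiable (at t within {0..m})"
    using path assms by (auto simp: psd_path_def Let_def differentiable_on_def m_def)
  then show ?thesis
    using assms by (simp add: \<phi>_eq path_deriv_def vector_derivative_works flip: m_def)
qed

lemma \<Phi>_right_deriv: assumes "0 \<le> t" "t < m" shows "(\<Phi> has_vector_derivative \<phi> t) (at_right t)"
proof -
  have "(\<Phi> has_vector_derivative \<phi> t) (at t within {t..m})"
    using assms by (intro has_vector_derivative_within_subset[OF \<Phi>_deriv]) auto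
  then show ?thesis using assms by (simp add: at_within_Icc_at_right)
qed

lemma \<phi>_psd: "psd (\<phi> t)"
proof -
  have *: "psd (\<phi> t)" if t: "0 \<le> t" "t < m" for t
  proof (rule psd_limit)
    show "((\<lambda>s. (1 / (s - t)) *\<^sub>R (\<Phi> s - \<Phi> t)) \<longlongrightarrow> \<phi> t) (at_right t)"
      using \<Phi>_right_deriv[OF t] by (simp add: has_vector_derivative_iff_quotient)
    show "\<forall>\<^sub>F s in at_right t. psd ((1 / (s - t)) *\<^sub>R (\<Phi> s - \<Phi> t))"
      using eventually_at_right_real[OF t(2)]
      by eventually_elim (use t in \<open>auto intro!: psd_scaleR \<Phi>_mono\<close>)
  qed simp
  \<comment> \<open>There are no difference quotients to the right of \<open>m\<close>; continuity
    of the derivative takes over.\<close>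
  have "psd (\<phi> m)"
  proof (rule psd_limit)
    have "continuous (at m within UNIV) \<phi>"
      using lip_continuous[OF lip_\<phi>[of UNIV]] by (simp add: continuous_on_eq_continuous_within)
    then have "continuous (at_left m) \<phi>" by (rule continuous_within_subset) simp
    then show "(\<phi> \<longlongrightarrow> \<phi> m) (at_left m)" by (simp add: continuous_within)
    show "\<forall>\<^sub>F s in at_left m. psd (\<phi> s)"
      using eventually_at_left_real[OF m_pos] by eventually_elim (auto intro: *)
  qed simp
  moreover have "\<phi> t = \<phi> (max 0 (min m t))" using m_pos by (simp add: \<phi>_def max_def min_def)
  moreover have "max 0 (min m t) = m \<or> 0 \<le> max 0 (min m t) \<and> max 0 (min m t) < m"
    using m_pos by (auto simp: max_def min_def)
  ultimately show ?thesis using * by metis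
qed

lemma \<phi>_integral: assumes "0 \<le> s" "s \<le> t" "t \<le> m" shows "(\<phi> has_integral \<Phi> t - \<Phi> s) {s..t}"
  using assms by (intro fundamental_theorem_of_calculus has_vector_derivative_within_subset[OF \<Phi>_deriv]) auto

lemma Q_minus_\<Phi>_psd: "t \<in> {0..m} \<Longrightarrow> psd (Q - \<Phi> t)"
  using \<Phi>_mono[of t m] \<Phi>_m by simp

lemma \<Phi>_entries: "t \<in> {0..m} \<Longrightarrow> \<Phi> t $ i $ j \<in> {-1..1}"
  by (rule psd_mono_entries[OF \<Phi>_psd Q_minus_\<Phi>_psd Q_diag])

lemma T_less_m: "T < m"
proof -
  have "(mat 0 :: real ^ 'n ^ 'n) = 0" by (simp add: mat_def vec_eq_iff)
  then have "det (0 :: real ^ 'n ^ 'n) = 0" using det_0[where 'n = 'n and 'a = real] by simp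
  then have "T \<noteq> m" using det_T \<Phi>_m by auto
  then show ?thesis using T_bounds by simp
qed

text \<open>A lower bound for the spectrum of \<open>Q - \<Phi> T\<close>. The hat path decreases to
  this matrix at \<open>T\<close>, so the same constant serves on all of
  \<open>[0, T]\<close>.\<close>

definition c :: real where "c = (SOME c. 0 < c \<and> pd_by c (Q - \<Phi> T))"

lemma c_pos: "0 < c" and c_T: "pd_by c (Q - \<Phi> T)"
proof -
  have "\<exists>c>0. pd_by c (Q - \<Phi> T)"
    using psd_det_pd_by[OF Q_minus_\<Phi>_psd[of T]] det_T T_bounds by force
  from someI_ex[OF this] show "0 < c" "pd_by c (Q - \<Phi> T)" by (simp_all add: c_def)
qed

lemma x\<phi>_integrable: "0 \<le> s \<Longrightarrow> t \<le> m \<Longrightarrow> (\<lambda>u. x u *\<^sub>R \<phi> u) integrable_on {s..t}"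
  by (intro mono_scaleR_integrable mono_on_subset[OF x_mono] lip_continuous lip_\<phi>) auto

abbreviation "H \<equiv> hat_path x \<Phi>"

lemma H_eq: "t \<in> {0..m} \<Longrightarrow> H t = integral {t..m} (\<lambda>s. x s *\<^sub>R \<phi> s)"
  unfolding hat_path_def m_def[symmetric] by (intro integral_cong) (simp add: \<phi>_eq)

lemma H_after: assumes "T \<le> t" "t \<le> m" shows "H t = Q - \<Phi> t"
proof -
  have "H t = integral {t..m} \<phi>"
    using assms T_bounds by (subst H_eq) (auto intro!: integral_cong simp: x_after)
  also have "\<dots> = Q - \<Phi> t" using \<phi>_integral[of t m] assms T_bounds \<Phi>_m by (simp add: integral_unique)
  finally show ?thesis .
qed

lemma H_before: assumes "0 \<le> t" "t \<le> T" shows "H t = Q - \<Phi> T + integral {t..T} (\<lambda>s. x s *\<^sub>R \<phi> s)"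
proof -
  have "H t = integral {t..T} (\<lambda>s. x s *\<^sub>R \<phi> s) + integral {T..m} (\<lambda>s. x s *\<^sub>R \<phi> s)"
    using assms T_bounds
    by (subst H_eq) (auto intro!: integral_combine_Icc[symmetric] x\<phi>_integrable)
  also have "integral {T..m} (\<lambda>s. x s *\<^sub>R \<phi> s) = Q - \<Phi> T"
    using H_after[of T] H_eq[of T] T_bounds by simp
  finally show ?thesis by simp
qed

lemma x\<phi>_bounded: "\<exists>B. \<forall>t\<in>{0..m}. norm (x t *\<^sub>R \<phi> t) \<le> B"
proof -
  obtain B where B: "0 < B" "\<And>t. t \<in> {0..m} \<Longrightarrow> norm (\<phi> t) \<le> B"
    using continuous_on_bounded_norm[OF lip_continuous[OF lip_\<phi>] compact_Icc] by metis
  have "norm (x t *\<^sub>R \<phi> t) \<le> 1 * B" if "t \<in> {0..m}" for t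
    using B(2)[OF that] x01[OF that] unfolding norm_scaleR by (intro mult_mono) auto
  then show ?thesis by blast
qed

lemma lip_H: "lip {0..m} H"
proof -
  obtain B where "\<forall>t\<in>{0..m}. norm (x t *\<^sub>R \<phi> t) \<le> B" using x\<phi>_bounded by blast
  then have "lip {0..m} (\<lambda>t. integral {t..m} (\<lambda>s. x s *\<^sub>R \<phi> s))"
    by (intro lip_integral x\<phi>_integrable) auto
  then show ?thesis by (rule lip_cong) (simp add: H_eq)
qed

lemma x_right_continuous: "0 \<le> t \<Longrightarrow> t < m \<Longrightarrow> continuous (at_right t) x"
  using param by (simp add: order_param_def)

lemma x\<phi>_right_continuous: "0 \<le> t \<Longrightarrow> t < m \<Longrightarrow> continuous (at_right t) (\<lambda>s. x s *\<^sub>R \<phi> s)"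
proof -
  have "continuous (at_right t) \<phi>"
    using lip_continuous[OF lip_\<phi>[of UNIV]]
    by (auto simp: continuous_on_eq_continuous_within intro: continuous_within_subset)
  then show "0 \<le> t \<Longrightarrow> t < m \<Longrightarrow> ?thesis" by (intro continuous_scaleR x_right_continuous)
qed

lemma H_right_deriv: assumes "0 \<le> t" "t < m"
  shows "(H has_vector_derivative - (x t *\<^sub>R \<phi> t)) (at_right t)"
proof -
  have "((\<lambda>s. integral {s..m} (\<lambda>s. x s *\<^sub>R \<phi> s)) has_vector_derivative - (x t *\<^sub>R \<phi> t)) (at_right t)"
    using assms by (intro integral_right_derivative[of _ 0] x\<phi>_integrable x\<phi>_right_continuous) auto
  then have "((\<lambda>s. integral {s..m} (\<lambda>s. x s *\<^sub>R \<phi> s)) has_vector_derivative - (x t *\<^sub>R \<phi> t)) (at t within {t..m})"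
    using assms by (simp add: at_within_Icc_at_right)
  then have "(H has_vector_derivative - (x t *\<^sub>R \<phi> t)) (at t within {t..m})"
    by (rule has_vector_derivative_transform[rotated 2]) (use assms in \<open>auto simp: H_eq\<close>)
  then show ?thesis using assms by (simp add: at_within_Icc_at_right)
qed

lemma H_pd: assumes "t \<in> {0..T}" shows "pd_by c (H t)"
proof -
  have "psd (integral {t..T} (\<lambda>s. x s *\<^sub>R \<phi> s))"
    using assms T_bounds x01 by (intro psd_integral x\<phi>_integrable psd_scaleR \<phi>_psd) auto
  then show ?thesis using assms by (simp add: H_before pd_by_add_psd c_T)
qed

lemma H_inv_lip: "lip {0..T} (\<lambda>t. matrix_inv (H t))"
  using T_bounds H_pd by (intro lip_compose[OF lip_subset[OF lip_H] lip_matrix_inv[OF c_pos]]) auto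

lemma T_trace: "trace (\<Phi> T) = T"
  by (rule trace_support[OF T_support])

lemma xi_field_integrable:
  "0 \<le> s \<Longrightarrow> t \<le> m \<Longrightarrow> (\<lambda>u. x u * (xi_field (\<Phi> u) \<bullet> \<phi> u)) integrable_on {s..t}"
  using mono_scaleR_integrable[of s t x "\<lambda>u. xi_field (\<Phi> u) \<bullet> \<phi> u"]
    mono_on_subset[OF x_mono, of "{s..t}"]
    lip_continuous[OF lip_inner[OF compact_Icc lip_xi_field[OF lip_subset[OF lip_\<Phi>, of "{s..t}"]] lip_\<phi>]]
    \<Phi>_entries
  by fastforce

text \<open>After \<open>T\<close> the order parameter is 1 and both integrands are exact
  derivatives, of \<open>potential (\<Phi> t)\<close> and of
  \<open>- ln (det (Q - \<Phi> t))\<close>. The logarithm at the auxiliary time cancels, and besides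
  a constant only values on \<open>[0, T]\<close> are left.\<close>

theorem cs_evaluation:
  "2 * crisanti_sommers \<beta> h x \<Phi> = integral {0..T} (\<lambda>t. x t * (xi_field (\<Phi> t) \<bullet> \<phi> t))
     + potential Q - potential (\<Phi> T) + ln (det (Q - \<Phi> T))
     + integral {0..T} (\<lambda>t. matrix_inv (H t) \<bullet> \<phi> t)"
proof -
  define P where "P T' \<longleftrightarrow> top_time m x < T' \<and> T' < m \<and> 0 < det (\<Phi> m - \<Phi> T')" for T'
  have "\<exists>T'. P T'"
  proof -
    have "continuous_on {T..m} (\<lambda>t. det (Q - \<Phi> t))"
      unfolding det_def using lip_continuous[OF lip_\<Phi>] T_bounds
      by (intro continuous_intros) (auto intro: continuous_on_subset)
    then have "((\<lambda>t. det (Q - \<Phi> t)) \<longlongrightarrow> det (Q - \<Phi> T)) (at T within {T..m})"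
      using T_bounds by (auto simp: continuous_on)
    then have "\<forall>\<^sub>F t in at_right T. 0 < det (Q - \<Phi> t)"
      using det_T T_less_m by (auto simp: at_within_Icc_at_right intro: order_tendstoD(1))
    moreover have "\<forall>\<^sub>F t in at_right T. t \<in> {T<..<m}"
      by (rule eventually_at_right_real[OF T_less_m])
    ultimately have "\<forall>\<^sub>F t in at_right T. P t"
      by eventually_elim (simp add: P_def \<Phi>_m T_def)
    then show ?thesis by (rule eventually_happens'[rotated]) simp
  qed
  then have "P (SOME T'. P T')" by (rule someI_ex)
  moreover define T' where "T' = (SOME T'. P T')"
  ultimately have T': "T < T'" "T' < m" "0 < det (Q - \<Phi> T')"
    by (simp_all add: P_def \<Phi>_m T_def)
  have C: "2 * crisanti_sommers \<beta> h x \<Phi>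
      = integral {0..m} (\<lambda>t. x t * ((xi' \<beta> (\<Phi> t) + outer_prod h h) \<bullet> path_deriv \<Phi> t))
        + ln (det (\<Phi> m - \<Phi> T')) + integral {0..T'} (\<lambda>t. matrix_inv (H t) \<bullet> path_deriv \<Phi> t)"
    by (simp add: crisanti_sommers_def crisanti_sommers_at_def T'_def P_def Let_def flip: m_def)
  have "integral {0..m} (\<lambda>t. x t * ((xi' \<beta> (\<Phi> t) + outer_prod h h) \<bullet> path_deriv \<Phi> t))
      = integral {0..m} (\<lambda>t. x t * (xi_field (\<Phi> t) \<bullet> \<phi> t))"
    by (intro integral_cong) (simp add: xi_field_def \<phi>_eq)
  also have "\<dots> = integral {0..T} (\<lambda>t. x t * (xi_field (\<Phi> t) \<bullet> \<phi> t))
      + integral {T..m} (\<lambda>t. x t * (xi_field (\<Phi> t) \<bullet> \<phi> t))"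
    using T_bounds by (intro integral_combine_Icc[symmetric] xi_field_integrable) auto
  also have "integral {T..m} (\<lambda>t. x t * (xi_field (\<Phi> t) \<bullet> \<phi> t)) = integral {T..m} (\<lambda>t. xi_field (\<Phi> t) \<bullet> \<phi> t)"
    by (intro integral_cong) (simp add: x_after)
  also have "((\<lambda>t. xi_field (\<Phi> t) \<bullet> \<phi> t) has_integral potential (\<Phi> m) - potential (\<Phi> T)) {T..m}"
  proof (rule fundamental_theorem_of_calculus[OF T_bounds(2)])
    fix t assume "t \<in> {T..m}"
    then have "((\<lambda>t. potential (\<Phi> t)) has_real_derivative xi_field (\<Phi> t) \<bullet> \<phi> t) (at t within {T..m})"
      using T_bounds
      by (intro potential_derivative has_vector_derivative_within_subset[OF \<Phi>_deriv] \<Phi>_entries) auto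
    then show "((\<lambda>t. potential (\<Phi> t)) has_vector_derivative xi_field (\<Phi> t) \<bullet> \<phi> t) (at t within {T..m})"
      by (simp add: has_real_derivative_iff_has_vector_derivative)
  qed
  then have "integral {T..m} (\<lambda>t. xi_field (\<Phi> t) \<bullet> \<phi> t) = potential Q - potential (\<Phi> T)"
    by (simp add: integral_unique \<Phi>_m)
  finally have 1: "integral {0..m} (\<lambda>t. x t * ((xi' \<beta> (\<Phi> t) + outer_prod h h) \<bullet> path_deriv \<Phi> t))
     = integral {0..T} (\<lambda>t. x t * (xi_field (\<Phi> t) \<bullet> \<phi> t)) + (potential Q - potential (\<Phi> T))" .
  obtain c' where c': "0 < c'" "pd_by c' (Q - \<Phi> T')"
    using psd_det_pd_by[OF Q_minus_\<Phi>_psd[of T']] T' T_bounds by force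
  have pd: "pd_by c' (Q - \<Phi> t)" if "t \<in> {T..T'}" for t
    using pd_by_add_psd[OF c'(2) \<Phi>_mono[of t T']] that T' T_bounds by simp
  have 2: "((\<lambda>t. matrix_inv (H t) \<bullet> \<phi> t) has_integral ln (det (Q - \<Phi> T)) - ln (det (Q - \<Phi> T'))) {T..T'}"
  proof -
    have "((\<lambda>t. matrix_inv (Q - \<Phi> t) \<bullet> \<phi> t) has_integral - ln (det (Q - \<Phi> T')) - - ln (det (Q - \<Phi> T))) {T..T'}"
    proof (rule fundamental_theorem_of_calculus)
      fix t assume t: "t \<in> {T..T'}"
      have "((\<lambda>t. Q - \<Phi> t) has_vector_derivative 0 - \<phi> t) (at t within {T..T'})"
        using t T' T_bounds
        by (intro has_vector_derivative_diff has_vector_derivative_const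
            has_vector_derivative_within_subset[OF \<Phi>_deriv]) auto
      then have "((\<lambda>t. ln (det (Q - \<Phi> t))) has_real_derivative matrix_inv (Q - \<Phi> t) \<bullet> (0 - \<phi> t)) (at t within {T..T'})"
        using pd[OF t] c'(1) by (intro ln_det_has_derivative pd_by_det_pos) (auto simp: pd_by_iff)
      from DERIV_minus[OF this]
      show "((\<lambda>t. - ln (det (Q - \<Phi> t))) has_vector_derivative matrix_inv (Q - \<Phi> t) \<bullet> \<phi> t) (at t within {T..T'})"
        by (simp add: has_real_derivative_iff_has_vector_derivative)
    qed (use T' in simp)
    then have "((\<lambda>t. matrix_inv (Q - \<Phi> t) \<bullet> \<phi> t) has_integral ln (det (Q - \<Phi> T)) - ln (det (Q - \<Phi> T'))) {T..T'}"
      by simp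
    then show ?thesis by (rule has_integral_eq[rotated]) (use T' in \<open>auto simp: H_after\<close>)
  qed
  have int1: "(\<lambda>t. matrix_inv (H t) \<bullet> \<phi> t) integrable_on {0..T}"
    by (intro integrable_continuous_real lip_continuous lip_inner lip_\<phi> H_inv_lip compact_Icc)
  have "integral {0..T'} (\<lambda>t. matrix_inv (H t) \<bullet> path_deriv \<Phi> t) = integral {0..T'} (\<lambda>t. matrix_inv (H t) \<bullet> \<phi> t)"
    using T' by (intro integral_cong) (simp add: \<phi>_eq)
  also have "\<dots> = integral {0..T} (\<lambda>t. matrix_inv (H t) \<bullet> \<phi> t) + (ln (det (Q - \<Phi> T)) - ln (det (Q - \<Phi> T')))"
    using has_integral_combine[OF _ _ integrable_integral[OF int1] 2] T' T_bounds
    by (simp add: integral_unique)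
  finally show ?thesis using C 1 by (simp add: \<Phi>_m)
qed

end

subsection \<open>Perturbed pairs\<close>

lemma has_integral_reverse:
  fixes f :: "real \<Rightarrow> 'b::real_normed_vector"
  assumes "(f has_integral i) {0..l}" shows "((\<lambda>s. f (l - s)) has_integral i) {0..l}"
proof -
  have "(\<lambda>s. - s + l) ` {0..l} = {0..l}"
    using image_diff_atLeastAtMost[of l 0 l] by simp
  then show ?thesis
    using has_integral_affinity[of f i 0 l "-1" l] assms by (simp add: algebra_simps)
qed

lemma has_integral_shift_right:
  fixes f :: "real \<Rightarrow> 'b::real_normed_vector"
  assumes "(f has_integral i) {0..l}" shows "((\<lambda>s. f (s - a)) has_integral i) {a..a + l}"
proof -
  have "(\<lambda>s. s + a) ` {0..l} = {a..a + l}"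
    by (simp add: add.commute)
  then show ?thesis
    using has_integral_affinity[of f i 0 l 1 "-a"] assms by (simp add: add.commute)
qed

lemma continuous_on_at_right:
  fixes g :: "real \<Rightarrow> 'b::topological_space"
  assumes "continuous_on {a..b} g" "a \<le> t" "t < b" shows "continuous (at_right t) g"
proof -
  have "continuous (at t within {a..b}) g"
    using assms by (simp add: continuous_on_eq_continuous_within)
  then have "continuous (at t within {t..b}) g"
    by (rule continuous_within_subset) (use assms in auto)
  then show ?thesis using assms by (simp add: at_within_Icc_at_right)
qed

lemma pd_by_trace_pos:
  fixes A :: "real ^ 'n ^ 'n"
  assumes "pd_by k A" "0 < k" shows "0 < trace A"
proof -
  have "0 \<le> trace (A - k *\<^sub>R mat 1)" using assms by (intro psd_trace_nonneg) (simp add: pd_by_def)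
  also have "\<dots> = trace A - k * real CARD('n)"
    by (simp add: trace_def sum_subtractf mat_def)
  finally show ?thesis using assms(2) by (smt (verit) mult_pos_pos of_nat_0_less_iff zero_less_card_finite)
qed

text \<open>New paths are specified by their derivative, because smoothness, the Lipschitz
  conditions and monotonicity can all be read off it.\<close>

lemma (in cs_setting) psd_path_integral:
  fixes p :: "real \<Rightarrow> real ^ 'n ^ 'n"
  assumes p: "lip {0..m} p" "\<And>s. s \<in> {0..m} \<Longrightarrow> psd (p s)" "integral {0..m} p = Q"
  shows "psd_path Q (\<lambda>t. integral {0..t} p)"
    and "\<And>s. s \<in> {0..m} \<Longrightarrow> path_deriv (\<lambda>t. integral {0..t} p) s = p s"
proof -
  let ?P = "\<lambda>t. integral {0..t} p"
  have m: "0 < m" by (simp add: m_def)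
  have cont: "continuous_on {0..m} p" by (rule lip_continuous[OF p(1)])
  have int: "p integrable_on {s..t}" if "0 \<le> s" "t \<le> m" for s t
    using that by (intro integrable_continuous_real continuous_on_subset[OF cont]) auto
  have d: "(?P has_vector_derivative p s) (at s within {0..m})" if "s \<in> {0..m}" for s
    by (rule integral_has_vector_derivative[OF cont that])
  show pd: "path_deriv ?P s = p s" if "s \<in> {0..m}" for s
    unfolding path_deriv_def m_def[symmetric]
    using vector_derivative_within_cbox[of 0 m s ?P "p s"] d[OF that] m that by simp
  have mono: "psd (?P t - ?P s)" if "0 \<le> s" "s \<le> t" "t \<le> m" for s t
  proof -
    have "?P s + integral {s..t} p = ?P t"
      using that by (intro integral_combine_Icc int) auto
    then have "?P t - ?P s = integral {s..t} p" by (simp add: algebra_simps)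
    then show ?thesis using that p(2) by (auto intro!: psd_integral int)
  qed
  have "lip {0..m} ?P"
    using d cont by (rule lip_C1)
  moreover have "lip {0..m} (path_deriv ?P)" by (rule lip_cong[OF p(1)]) (simp add: pd)
  ultimately show "psd_path Q ?P"
    using mono mono[of 0] differentiableI_vector[OF d] p(3)
    by (auto simp: psd_path_def Let_def lip_def[symmetric] loewner_mono_on_def differentiable_on_def
        lip_continuous simp flip: m_def)
qed

text \<open>The perturbation of the path has derivative \<open>e\<close> and initial value
  \<open>J\<close>. The bound 1/2 on the trace keeps the new time strictly increasing.
  \<open>J\<close> and the gap to \<open>Q\<close> at \<open>T\<close> are positive definite so that
  \<open>connecting_path\<close> can bridge both.\<close>

locale cs_perturbation = cs_pair \<beta> h Q m x \<Phi>
  for \<beta> :: "nat \<Rightarrow> real ^ 'n" and h :: "real ^ 'n" and Q :: "real ^ 'n ^ 'n" and m :: real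
    and x :: "real \<Rightarrow> real" and \<Phi> :: "real \<Rightarrow> real ^ 'n ^ 'n" +
  fixes e :: "real \<Rightarrow> real ^ 'n ^ 'n" and J :: "real ^ 'n ^ 'n" and k :: real
  assumes e_lip: "lip UNIV e" and e_trace: "\<And>t. \<bar>trace (e t)\<bar> \<le> 1 / 2"
    and e_psd: "\<And>t. t \<in> {0..T} \<Longrightarrow> psd (\<phi> t + e t)"
    and k: "0 < k" and J_pd: "pd_by k J"
    and end_pd: "pd_by k (Q - (\<Phi> T + J + integral {0..T} e))"
begin

definition \<Theta> :: "real \<Rightarrow> real ^ 'n ^ 'n" where "\<Theta> t = \<Phi> t + J + integral {0..t} e"
definition \<theta> :: "real \<Rightarrow> real ^ 'n ^ 'n" where "\<theta> t = \<phi> t + e t"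
text \<open>The hat path of the perturbed pair, expressed in the old time.\<close>

definition K :: "real \<Rightarrow> real ^ 'n ^ 'n"
  where "K t = Q - \<Theta> T + integral {t..T} (\<lambda>s. x s *\<^sub>R \<theta> s)"

lemma e_integrable: "e integrable_on {s..t}"
  by (intro integrable_continuous_real lip_continuous lip_subset[OF e_lip]) simp

lemma lip_\<theta>: "lip S \<theta>"
  unfolding \<theta>_def[abs_def] by (intro lip_add lip_\<phi> lip_subset[OF e_lip]) simp

lemma \<theta>_integral: assumes "0 \<le> s" "s \<le> t" "t \<le> m" shows "(\<theta> has_integral \<Theta> t - \<Theta> s) {s..t}"
proof -
  have "integral {0..s} e + integral {s..t} e = integral {0..t} e"
    using assms by (intro integral_combine_Icc e_integrable) auto
  then have "\<Theta> t - \<Theta> s = (\<Phi> t - \<Phi> s) + integral {s..t} e" by (simp add: \<Theta>_def algebra_simps)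
  then show ?thesis unfolding \<theta>_def[abs_def]
    using has_integral_add[OF \<phi>_integral[OF assms] integrable_integral[OF e_integrable]] by simp
qed

lemma \<Theta>_0: "\<Theta> 0 = J" by (simp add: \<Theta>_def \<Phi>_0)

lemma Q_minus_\<Theta>_pd: "pd_by k (Q - \<Theta> T)"
  using end_pd by (simp add: \<Theta>_def)

text \<open>The new time agrees with \<open>trace (\<Theta> t)\<close> on the support, where \<open>trace (\<Phi> t) = t\<close>; unlike
  \<open>trace (\<Theta> t)\<close> it is strictly increasing everywhere.\<close>

definition \<tau> :: "real \<Rightarrow> real"
  where "\<tau> t = trace J + t + integral {0..max 0 (min T t)} (\<lambda>s. trace (e s))"

lemma lip_trace_e: "lip S (\<lambda>s. trace (e s))"
  by (intro lip_bounded_linear[OF bounded_linear_trace] lip_subset[OF e_lip]) simp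

lemma \<tau>_eq: assumes "t \<in> {0..T}" shows "\<tau> t = trace (\<Theta> t) + (t - trace (\<Phi> t))"
proof -
  have "integral {0..t} (\<lambda>s. trace (e s)) = trace (integral {0..t} e)"
    using integral_linear[OF e_integrable bounded_linear_trace] by (simp add: o_def)
  then show ?thesis using assms by (simp add: \<tau>_def \<Theta>_def trace_add)
qed

text \<open>A slope of at least 1/2 makes \<tau> a bijection of the line whose inverse has Lipschitz
  constant 2.\<close>

lemma \<tau>_increase: assumes "s \<le> t" shows "(t - s) / 2 \<le> \<tau> t - \<tau> s"
proof -
  define u v where "u = max 0 (min T s)" and "v = max 0 (min T t)"
  have uv: "0 \<le> u" "u \<le> v" "v - u \<le> t - s"
    using assms T_bounds by (auto simp: u_def v_def max_def min_def)
  have int: "(\<lambda>s. trace (e s)) integrable_on {a..b}" for a b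
    by (intro integrable_continuous_real lip_continuous lip_trace_e)
  have "integral {0..u} (\<lambda>s. trace (e s)) + integral {u..v} (\<lambda>s. trace (e s)) = integral {0..v} (\<lambda>s. trace (e s))"
    using uv by (intro integral_combine_Icc int) auto
  then have "\<tau> t - \<tau> s = t - s + integral {u..v} (\<lambda>s. trace (e s))"
    by (simp add: \<tau>_def u_def[symmetric] v_def[symmetric])
  moreover have "integral {u..v} (\<lambda>_. - 1 / 2) \<le> integral {u..v} (\<lambda>s. trace (e s))"
  proof (rule integral_le[OF _ int])
    show "- 1 / 2 \<le> trace (e s)" for s using e_trace[of s] by (simp add: abs_le_iff)
  qed (rule integrable_const_ivl)
  moreover have "integral {u..v} (\<lambda>_. - 1 / 2 :: real) = - ((v - u) / 2)"
    using uv by (simp add: field_simps)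
  ultimately show ?thesis using uv(3) by argo
qed

lemma \<tau>_strict: "s < t \<Longrightarrow> \<tau> s < \<tau> t"
  using \<tau>_increase[of s t] by simp

lemma \<tau>_continuous: "continuous_on S \<tau>"
proof -
  have "lip {0..T} (\<lambda>t. integral {0..t} (\<lambda>s. trace (e s)))"
    using e_trace by (intro lip_integral(1)[of _ 0 T "1/2"] integrable_continuous_real lip_continuous lip_trace_e) auto
  then have "continuous_on ((\<lambda>t. max 0 (min T t)) ` S) (\<lambda>t. integral {0..t} (\<lambda>s. trace (e s)))"
    using T_bounds by (intro continuous_on_subset[OF lip_continuous]) auto
  moreover have "continuous_on S (\<lambda>t. max 0 (min T t))" by (intro continuous_intros)
  ultimately have "continuous_on S ((\<lambda>t. integral {0..t} (\<lambda>s. trace (e s))) \<circ> (\<lambda>t. max 0 (min T t)))"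
    by (rule continuous_on_compose[rotated])
  then show ?thesis unfolding \<tau>_def[abs_def] o_def by (intro continuous_intros)
qed

definition \<sigma> :: "real \<Rightarrow> real" where "\<sigma> = inv \<tau>"

lemma \<sigma>_\<tau> [simp]: "\<sigma> (\<tau> t) = t"
proof -
  have "inj \<tau>" by (rule injI) (metis \<tau>_strict less_irrefl linorder_neqE_linordered_idom)
  then show ?thesis by (simp add: \<sigma>_def)
qed

lemma \<tau>_\<sigma> [simp]: "\<tau> (\<sigma> s) = s"
proof -
  \<comment> \<open>By the slope bound, \<tau> is at most \<open>s\<close> at \<open>a\<close> and
    at least \<open>s\<close> at \<open>b\<close>.\<close>
  define a where "a = min 0 (2 * (s - \<tau> 0))"
  define b where "b = max 0 (2 * (s - \<tau> 0))"
  have a: "a \<le> 0" "a / 2 \<le> s - \<tau> 0" by (auto simp: a_def min_def)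
  have b: "0 \<le> b" "s - \<tau> 0 \<le> b / 2" by (auto simp: b_def max_def)
  have "\<tau> a \<le> s" using \<tau>_increase[OF a(1)] a(2) by argo
  moreover have "s \<le> \<tau> b" using \<tau>_increase[OF b(1)] b(2) by argo
  moreover have "a \<le> b" using a(1) b(1) by simp
  ultimately obtain t where "\<tau> t = s"
    using IVT'[of \<tau> a s b] \<tau>_continuous by auto
  then have "\<tau> (inv \<tau> s) = s" by (intro f_inv_into_f) auto
  then show ?thesis by (simp add: \<sigma>_def)
qed

lemma \<sigma>_strict: "s < t \<Longrightarrow> \<sigma> s < \<sigma> t"
  by (metis \<tau>_\<sigma> \<tau>_strict linorder_neqE_linordered_idom order_less_asym)

lemma \<sigma>_mono: "s \<le> t \<Longrightarrow> \<sigma> s \<le> \<sigma> t"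
  using \<sigma>_strict[of s t] by (cases "s = t") auto

lemma \<sigma>_le: "s \<le> t \<Longrightarrow> \<sigma> t - \<sigma> s \<le> 2 * (t - s)"
  using \<tau>_increase[OF \<sigma>_mono, of s t] by simp

lemma lip_\<sigma>: "lip S \<sigma>"
  by (rule lip_real_le[of _ _ 2]) (use \<sigma>_le \<sigma>_mono in auto)

text \<open>The right derivative of \<tau> on \<open>[0, T)\<close>, so that the reciprocal belongs
  to \<sigma>.\<close>

definition a :: "real \<Rightarrow> real" where "a t = 1 + trace (e t)"

lemma a_bounds: "a t \<in> {1/2..2}"
  using e_trace[of t] by (auto simp: a_def abs_le_iff)

definition \<tau>0 :: real where "\<tau>0 = \<tau> 0"
definition \<tau>1 :: real where "\<tau>1 = \<tau> T"

lemma \<sigma>_ends [simp]: "\<sigma> \<tau>0 = 0" "\<sigma> \<tau>1 = T"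
  by (simp_all add: \<tau>0_def \<tau>1_def)

text \<open>The new time starts at the trace of \<open>J\<close>, which leaves an interval for the
  climb from 0 to \<open>J\<close>. In the same way the trace of \<open>Q - \<Theta> T\<close> is
  the time left at the end.\<close>

lemma \<tau>0_pos: "0 < \<tau>0"
  using pd_by_trace_pos[OF J_pd k] T_bounds by (simp add: \<tau>0_def \<tau>_def)

lemma \<tau>01: "\<tau>0 \<le> \<tau>1"
  using \<tau>_increase[of 0 T] T_bounds by (simp add: \<tau>0_def \<tau>1_def)

lemma \<tau>1_less: "\<tau>1 < m"
proof -
  have "\<tau>1 = trace (\<Theta> T)" using T_bounds by (simp add: \<tau>1_def \<tau>_eq T_trace)
  moreover have "0 < trace (Q - \<Theta> T)" by (rule pd_by_trace_pos[OF Q_minus_\<Theta>_pd k])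
  moreover have "trace Q = m" by (simp add: trace_def Q_diag m_def)
  ultimately show ?thesis by (simp add: trace_sub)
qed

lemma \<sigma>_range: "s \<in> {\<tau>0..\<tau>1} \<Longrightarrow> \<sigma> s \<in> {0..T}"
  using \<sigma>_mono[of \<tau>0 s] \<sigma>_mono[of s \<tau>1] by simp

text \<open>Strict monotonicity carries right neighbourhoods into punctured right neighbourhoods, so
  right limits survive the change of time.\<close>

lemma \<sigma>_at_right: "filterlim \<sigma> (at_right (\<sigma> s)) (at_right s)"
proof -
  have "continuous (at s within UNIV) \<sigma>"
    using lip_continuous[OF lip_\<sigma>[of UNIV]] by (simp add: continuous_on_eq_continuous_within)
  then have "continuous (at_right s) \<sigma>" by (rule continuous_within_subset) simp
  then have "(\<sigma> \<longlongrightarrow> \<sigma> s) (at_right s)" by (simp add: continuous_within)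
  moreover have "\<forall>\<^sub>F u in at_right s. \<sigma> u \<in> {\<sigma> s<..} \<and> \<sigma> u \<noteq> \<sigma> s"
    using eventually_at_right_less[of s] by eventually_elim (use \<sigma>_strict[of s] in force)
  ultimately show ?thesis by (simp add: filterlim_at)
qed

lemma \<sigma>_right_deriv:
  assumes "\<tau>0 \<le> s" "s < \<tau>1"
  shows "(\<sigma> has_vector_derivative 1 / a (\<sigma> s)) (at_right s)"
proof -
  have t: "0 \<le> \<sigma> s" "\<sigma> s < T" using \<sigma>_mono[OF assms(1)] \<sigma>_strict[OF assms(2)] by auto
  let ?t = "\<sigma> s"
  let ?B = "\<lambda>t. integral {0..t} (\<lambda>s. trace (e s))"
  have "(?B has_vector_derivative trace (e ?t)) (at_right ?t)"
    using t by (intro integral_right_derivative(1)[of _ 0 T] integrable_continuous_real lip_continuous lip_trace_e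
        continuous_on_at_right[of 0 T]) auto
  then have "((\<lambda>t. trace J + t + ?B t) has_vector_derivative a ?t) (at ?t within {?t..T})"
    unfolding a_def using t
    by (auto intro!: derivative_eq_intros simp: at_within_Icc_at_right)
  then have "(\<tau> has_vector_derivative a ?t) (at ?t within {?t..T})"
    by (rule has_vector_derivative_transform[rotated 2]) (use t in \<open>auto simp: \<tau>_def\<close>)
  then have "((\<lambda>u. (1 / (u - ?t)) *\<^sub>R (\<tau> u - \<tau> ?t)) \<longlongrightarrow> a ?t) (at_right ?t)"
    using t by (simp add: at_within_Icc_at_right has_vector_derivative_iff_quotient)
  then have "((\<lambda>u. (1 / (\<sigma> u - ?t)) *\<^sub>R (\<tau> (\<sigma> u) - \<tau> ?t)) \<longlongrightarrow> a ?t) (at_right s)"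
    by (rule filterlim_compose[OF _ \<sigma>_at_right])
  then have "((\<lambda>u. 1 / ((1 / (\<sigma> u - ?t)) *\<^sub>R (\<tau> (\<sigma> u) - \<tau> ?t))) \<longlongrightarrow> 1 / a ?t) (at_right s)"
    using a_bounds[of ?t] by (intro tendsto_intros) auto
  moreover have "1 / ((1 / (\<sigma> u - ?t)) *\<^sub>R (\<tau> (\<sigma> u) - \<tau> ?t)) = (1 / (u - s)) *\<^sub>R (\<sigma> u - ?t)" for u
    by simp
  ultimately show ?thesis by (simp only: has_vector_derivative_iff_quotient)
qed

section \<open>Change of variables and the transported order parameter\<close>

text \<open>The regularity that the change of variables asks for. It holds for continuous functions
  and also for their products with \<open>x\<close>.\<close>

definition good :: "(real \<Rightarrow> 'b::euclidean_space) \<Rightarrow> bool"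
  where "good F \<longleftrightarrow> F integrable_on {0..T} \<and> (\<exists>B. \<forall>t\<in>{0..T}. norm (F t) \<le> B)
    \<and> (\<forall>t\<in>{0..<T}. continuous (at_right t) F)"

lemma good_continuous:
  fixes F :: "real \<Rightarrow> 'b::euclidean_space"
  assumes "continuous_on {0..T} F" shows "good F" "good (\<lambda>t. x t *\<^sub>R F t)"
proof -
  obtain B where B: "\<forall>t\<in>{0..T}. norm (F t) \<le> B"
    using continuous_on_bounded_norm[OF assms compact_Icc] by metis
  then show "good F"
    using continuous_on_at_right[OF assms] integrable_continuous_real[OF assms] by (auto simp: good_def)
  have "norm (x t *\<^sub>R F t) \<le> 1 * B" if "t \<in> {0..T}" for t
    using B that x01[of t] T_bounds unfolding norm_scaleR by (intro mult_mono) auto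
  moreover have "continuous (at_right t) (\<lambda>t. x t *\<^sub>R F t)" if "t \<in> {0..<T}" for t
    using that T_bounds by (intro continuous_scaleR x_right_continuous continuous_on_at_right[OF assms]) auto
  moreover have "(\<lambda>t. x t *\<^sub>R F t) integrable_on {0..T}"
    using T_bounds by (intro mono_scaleR_integrable assms mono_on_subset[OF x_mono]) auto
  ultimately show "good (\<lambda>t. x t *\<^sub>R F t)" unfolding good_def by blast
qed

lemma substitution:
  fixes F :: "real \<Rightarrow> 'b::euclidean_space"
  assumes F: "good F" and uv: "\<tau>0 \<le> u" "u \<le> v" "v \<le> \<tau>1"
  shows "((\<lambda>s. (1 / a (\<sigma> s)) *\<^sub>R F (\<sigma> s)) has_integral integral {\<sigma> u..\<sigma> v} F) {u..v}"
proof -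
  obtain B where B: "\<And>t. t \<in> {0..T} \<Longrightarrow> norm (F t) \<le> B" using F unfolding good_def by blast
  have r: "0 \<le> \<sigma> u" "\<sigma> v \<le> T" using \<sigma>_range[of u] \<sigma>_range[of v] uv by auto
  show ?thesis
  proof (rule integral_substitution_right[of u v \<sigma> _ F B])
    show "F integrable_on {\<sigma> u..\<sigma> v}"
      using F r by (auto simp: good_def intro: integrable_on_subinterval)
  qed (use uv r B F in \<open>auto intro: lip_\<sigma> \<sigma>_strict \<sigma>_right_deriv simp: good_def\<close>)
qed

text \<open>The right derivative of \<open>\<Theta> \<circ> \<sigma>\<close>, that is, of the
  perturbed path in the new time.\<close>

definition core :: "real \<Rightarrow> real ^ 'n ^ 'n"
  where "core s = (1 / a (\<sigma> s)) *\<^sub>R \<theta> (\<sigma> s)"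

lemma lip_core: "lip {\<tau>0..\<tau>1} core"
proof -
  have a_lip: "lip UNIV (\<lambda>s. a (\<sigma> s))"
    unfolding a_def by (intro lip_add lip_const lip_compose[OF lip_\<sigma> lip_trace_e]) auto
  have inv_lip: "lip {1/2..2} (\<lambda>r :: real. 1 / r)"
    by (rule lip_C1[of _ _ _ "\<lambda>r. - 1 / (r * r)"])
       (auto intro!: continuous_intros derivative_eq_intros
         simp: has_real_derivative_iff_has_vector_derivative[symmetric])
  have "lip {\<tau>0..\<tau>1} (\<lambda>s. 1 / a (\<sigma> s))"
    by (rule lip_compose[OF lip_subset[OF a_lip subset_UNIV] inv_lip]) (use a_bounds in auto)
  then show ?thesis unfolding core_def[abs_def]
    by (intro lip_scaleR compact_Icc lip_compose[OF lip_\<sigma> lip_\<theta>[of UNIV]]) auto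
qed

lemma core_psd: "s \<in> {\<tau>0..\<tau>1} \<Longrightarrow> psd (core s)"
  unfolding core_def \<theta>_def using a_bounds[of "\<sigma> s"] by (intro psd_scaleR e_psd \<sigma>_range) auto

text \<open>The distribution function of the old measure transported by \<tau>. It is composed from
  \<open>X\<close> and not from \<open>x\<close>, since \<sigma> is negative before
  \<open>\<tau>0\<close>.\<close>

definition y :: "real \<Rightarrow> real" where "y s = X (\<sigma> s)"

lemma y_core: "s \<in> {\<tau>0..\<tau>1} \<Longrightarrow> y s = x (\<sigma> s)"
  using \<sigma>_range[of s] T_bounds by (simp add: y_def X_eq)

lemma y_before: "s < \<tau>0 \<Longrightarrow> y s = 0"
  using \<sigma>_strict[of s \<tau>0] by (simp add: y_def cdf_ext_def)

lemma y_after: "\<tau>1 \<le> s \<Longrightarrow> y s = 1"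
  using \<sigma>_mono[of \<tau>1 s] by (simp add: y_def X_after)

lemma y_order_param: "order_param m y"
  unfolding order_param_def
proof (intro conjI ballI)
  show "y ` {0..m} \<subseteq> {0..1}" using X01 by (auto simp: y_def)
  show "mono_on {0..m} y" by (auto intro!: mono_onI monoD[OF X_mono] \<sigma>_mono simp: y_def)
  show "y m = 1" using \<tau>1_less by (intro y_after) simp
  show "continuous (at_right s) y" for s
  proof -
    have "(X \<longlongrightarrow> X (\<sigma> s)) (at_right (\<sigma> s))" using X_right_continuous by (simp add: continuous_within)
    from filterlim_compose[OF this \<sigma>_at_right] show ?thesis by (simp add: continuous_within y_def[abs_def])
  qed
qed

lemma y_cdf: "cdf_ext m y s = X (\<sigma> s)"
proof -
  consider "s < 0" | "0 \<le> s" "s \<le> m" | "m < s" by linarith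
  then show ?thesis
  proof cases
    case 1
    then show ?thesis using y_before[of s] \<tau>0_pos by (simp add: cdf_ext_def y_def)
  next
    case 2
    then show ?thesis by (simp add: cdf_ext_def y_def)
  next
    case 3
    then show ?thesis using y_after[of s] y_after[of m] \<tau>1_less m by (simp add: cdf_ext_def y_def)
  qed
qed

text \<open>\<sigma> stretches distances by a factor of at most 2, whence the radius
  \<open>r / 2\<close>.\<close>

lemma y_support:
  assumes "s \<in> measure_support (parisi_measure m y)"
  shows "\<sigma> s \<in> measure_support (parisi_measure m x)"
proof -
  interpret Y: order_parameter m y by unfold_locales (simp_all add: y_order_param m)
  show ?thesis
    unfolding support_iff
  proof (intro allI impI)
    fix r :: real assume r: "0 < r"
    have "X (\<sigma> s - r) \<le> X (\<sigma> (s - r / 2))"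
      using \<sigma>_le[of "s - r / 2" s] r by (intro monoD[OF X_mono]) simp
    also have "\<dots> < X (\<sigma> (s + r / 2))"
      using assms[unfolded Y.support_iff, rule_format, of "r / 2"] r by (simp add: y_cdf)
    also have "\<dots> \<le> X (\<sigma> s + r)"
      using \<sigma>_le[of s "s + r / 2"] r by (intro monoD[OF X_mono]) simp
    finally show "X (\<sigma> s - r) < X (\<sigma> s + r)" .
  qed
qed

lemma y_top_time: "top_time m y = \<tau>1"
proof -
  interpret Y: order_parameter m y by unfold_locales (simp_all add: y_order_param m)
  have "Y.T = \<tau>1"
  proof (rule Y.T_unique)
    show "\<tau>1 \<in> {0..m}" using \<tau>0_pos \<tau>01 \<tau>1_less by simp
    show "y \<tau>1 = 1" by (rule y_after) simp
    fix t assume "t < \<tau>1"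
    then show "y t \<noteq> 1" using X_before[of "\<sigma> t"] \<sigma>_strict[of t \<tau>1] by (simp add: y_def)
  qed
  then show ?thesis by (simp add: Y.T_def)
qed

lemma K_pd: assumes "t \<in> {0..T}" shows "pd_by k (K t)"
proof -
  have "(\<lambda>s. x s *\<^sub>R \<theta> s) integrable_on {0..T}"
    using good_continuous(2)[OF lip_continuous[OF lip_\<theta>]] by (simp add: good_def)
  then have "(\<lambda>s. x s *\<^sub>R \<theta> s) integrable_on {t..T}"
    using assms by (auto intro: integrable_on_subinterval)
  then have "psd (integral {t..T} (\<lambda>s. x s *\<^sub>R \<theta> s))"
    using assms T_bounds x01 e_psd by (intro psd_integral psd_scaleR) (auto simp: \<theta>_def)
  then show ?thesis unfolding K_def by (intro pd_by_add_psd Q_minus_\<Theta>_pd)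
qed

lemma lip_K: "lip {0..T} K"
proof -
  have "good (\<lambda>s. x s *\<^sub>R \<theta> s)" by (intro good_continuous lip_continuous lip_\<theta>)
  then obtain B where "(\<lambda>s. x s *\<^sub>R \<theta> s) integrable_on {0..T}" "\<And>t. t \<in> {0..T} \<Longrightarrow> norm (x t *\<^sub>R \<theta> t) \<le> B"
    unfolding good_def by blast
  then show ?thesis unfolding K_def[abs_def] by (intro lip_add lip_const lip_integral)
qed

text \<open>The new path climbs from 0 to \<open>J\<close>, follows \<Theta> in the new time, and
  climbs from \<open>\<Theta> T\<close> to \<open>Q\<close>. On the first piece the order parameter
  is 0, so the hat path is constantly \<open>K 0\<close> and the climb costs
  \<open>matrix_inv (K 0) \<bullet> J\<close>. On the middle piece both integrands are linear in the
  derivative, hence invariant under the change of time. The last piece enters only through its ends,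
  by \<open>cs_evaluation\<close>.\<close>

theorem perturbed_pair:
  "\<exists>y \<Psi>. admissible Q y \<Psi> \<and> 2 * crisanti_sommers \<beta> h y \<Psi> =
     integral {0..T} (\<lambda>t. x t * (xi_field (\<Theta> t) \<bullet> \<theta> t)) + potential Q - potential (\<Theta> T)
     + ln (det (Q - \<Theta> T)) + integral {0..T} (\<lambda>t. matrix_inv (K t) \<bullet> \<theta> t) + matrix_inv (K 0) \<bullet> J"
proof -
  have ends: "\<tau>0 \<in> {\<tau>0..\<tau>1}" "\<tau>1 \<in> {\<tau>0..\<tau>1}" using \<tau>01 by auto
  obtain w0 where w0: "lip {0..\<tau>0} w0" "\<And>s. s \<in> {0..\<tau>0} \<Longrightarrow> psd (w0 s)" "w0 0 = core \<tau>0"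
    "(w0 has_integral J) {0..\<tau>0}"
    using connecting_path[OF \<tau>0_pos core_psd[OF ends(1)] J_pd k] by blast
  have "0 < m - \<tau>1" using \<tau>1_less by simp
  then obtain w1 where w1: "lip {0..m - \<tau>1} w1" "\<And>s. s \<in> {0..m - \<tau>1} \<Longrightarrow> psd (w1 s)" "w1 0 = core \<tau>1"
    "(w1 has_integral Q - \<Theta> T) {0..m - \<tau>1}"
    using connecting_path[OF _ core_psd[OF ends(2)] Q_minus_\<Theta>_pd k] by blast
  \<comment> \<open>\<open>connecting_path\<close> prescribes the slope at its start, but the first
    climb has to match the core at its end; it is therefore run backwards.\<close>
  define p where "p s = (if s \<le> \<tau>1 then (if s \<le> \<tau>0 then w0 (\<tau>0 - s) else core s) else w1 (s - \<tau>1))" for s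
  have p0: "p s = w0 (\<tau>0 - s)" if "s \<in> {0..\<tau>0}" for s using that \<tau>01 by (simp add: p_def)
  have p_core: "p s = core s" if "s \<in> {\<tau>0..\<tau>1}" for s using that w0(3) by (cases "s = \<tau>0") (auto simp: p_def)
  have p1: "p s = w1 (s - \<tau>1)" if "s \<in> {\<tau>1..m}" for s
    using that w1(3) p_core[OF ends(2)] by (cases "s = \<tau>1") (auto simp: p_def)
  have p_lip: "lip {0..m} p"
    unfolding p_def
  proof (intro lip_concat)
    show "lip {0..\<tau>0} (\<lambda>s. w0 (\<tau>0 - s))"
      by (rule lip_compose[OF _ w0(1)]) (auto intro!: lip_diff lip_const lip_id)
    show "lip {\<tau>1..m} (\<lambda>s. w1 (s - \<tau>1))"
      by (rule lip_compose[OF _ w1(1)]) (auto intro!: lip_diff lip_const lip_id)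
    show "(if \<tau>1 \<le> \<tau>0 then w0 (\<tau>0 - \<tau>1) else core \<tau>1) = w1 (\<tau>1 - \<tau>1)"
      using \<tau>01 w0(3) w1(3) by (cases "\<tau>0 = \<tau>1") auto
  qed (use w0(3) in \<open>auto intro: lip_core\<close>)
  have p_psd: "psd (p s)" if "s \<in> {0..m}" for s
    using that w0(2)[of "\<tau>0 - s"] w1(2)[of "s - \<tau>1"] core_psd[of s] by (auto simp: p_def)
  have p_int0: "(p has_integral J) {0..\<tau>0}"
    by (rule has_integral_eq[OF _ has_integral_reverse[OF w0(4)]]) (simp add: p0)
  have good_\<theta>: "good \<theta>" "good (\<lambda>t. x t *\<^sub>R \<theta> t)" by (intro good_continuous lip_continuous lip_\<theta>)+
  have p_int: "(p has_integral \<Theta> (\<sigma> s) - J) {\<tau>0..s}" if s: "s \<in> {\<tau>0..\<tau>1}" for s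
  proof -
    have "integral {\<sigma> \<tau>0..\<sigma> s} \<theta> = \<Theta> (\<sigma> s) - J"
      using \<theta>_integral[of 0 "\<sigma> s"] \<sigma>_range[OF s] T_bounds by (simp add: integral_unique \<Theta>_0)
    then have "((\<lambda>u. (1 / a (\<sigma> u)) *\<^sub>R \<theta> (\<sigma> u)) has_integral \<Theta> (\<sigma> s) - J) {\<tau>0..s}"
      using substitution[OF good_\<theta>(1), of \<tau>0 s] s by simp
    then show ?thesis by (rule has_integral_eq[rotated]) (use s in \<open>auto simp: p_core core_def\<close>)
  qed
  have p_int1: "(p has_integral Q - \<Theta> T) {\<tau>1..m}"
    using has_integral_shift_right[OF w1(4), of \<tau>1] by (auto simp: p1 elim: has_integral_eq[rotated])
  define \<Psi> where "\<Psi> s = integral {0..s} p" for s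
  have \<Psi>_core: "\<Psi> s = \<Theta> (\<sigma> s)" if s: "s \<in> {\<tau>0..\<tau>1}" for s
    using has_integral_combine[OF _ _ p_int0 p_int[OF s]] s \<tau>0_pos by (simp add: \<Psi>_def integral_unique)
  have \<Psi>_m: "\<Psi> m = Q"
  proof -
    have "(p has_integral \<Theta> T) {0..\<tau>1}"
      using has_integral_combine[OF _ _ p_int0 p_int[OF ends(2)]] \<tau>0_pos \<tau>01 by simp
    from has_integral_combine[OF _ _ this p_int1] show ?thesis
      using \<tau>0_pos \<tau>01 \<tau>1_less by (simp add: \<Psi>_def integral_unique)
  qed
  have path: "psd_path Q \<Psi>" and pd: "\<And>s. s \<in> {0..m} \<Longrightarrow> path_deriv \<Psi> s = p s"
    using psd_path_integral[OF p_lip p_psd] \<Psi>_m unfolding \<Psi>_def[abs_def] by auto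
  have adm: "admissible Q y \<Psi>"
    unfolding admissible_def Let_def m_def[symmetric]
  proof (intro conjI ballI y_order_param path)
    fix s assume s: "s \<in> measure_support (parisi_measure m y)"
    have \<sigma>s: "\<sigma> s \<in> measure_support (parisi_measure m x)" by (rule y_support[OF s])
    then have r: "\<sigma> s \<in> {0..T}" by (rule support_subset)
    have "s = \<tau> (\<sigma> s)" by simp
    also have "\<dots> = trace (\<Theta> (\<sigma> s))" using \<tau>_eq[OF r] trace_support[OF \<sigma>s] by simp
    finally have *: "s = trace (\<Theta> (\<sigma> s))" .
    have "s \<in> {\<tau>0..\<tau>1}"
      using r \<sigma>_strict[of s \<tau>0] \<sigma>_strict[of \<tau>1 s] by (auto simp: not_less[symmetric])
    then show "trace (\<Psi> s) = s" using * by (simp add: \<Psi>_core)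
  next
    show "0 < det (Q - \<Psi> (top_time m y))"
      using pd_by_det_pos[OF Q_minus_\<Theta>_pd k] by (simp add: y_top_time \<Psi>_core[OF ends(2)])
  qed
  interpret N: cs_pair \<beta> h Q m y \<Psi> by unfold_locales (rule adm)
  have NT: "N.T = \<tau>1" by (simp add: N.T_def y_top_time)
  have N\<phi>: "N.\<phi> s = p s" if "s \<in> {0..m}" for s using N.\<phi>_eq[OF that] pd[OF that] by simp
  have N\<phi>_core: "N.\<phi> s = core s" if "s \<in> {\<tau>0..\<tau>1}" for s
    using N\<phi>[of s] p_core[OF that] that \<tau>0_pos \<tau>1_less by simp
  have sub: "integral {u..\<tau>1} (\<lambda>s. (1 / a (\<sigma> s)) *\<^sub>R F (\<sigma> s)) = integral {\<sigma> u..T} F"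
    if "good F" "u \<in> {\<tau>0..\<tau>1}" for u and F :: "real \<Rightarrow> 'c::euclidean_space"
    using substitution[OF that(1), of u \<tau>1] that(2) by (simp add: integral_unique)
  have NH_core: "N.H s = K (\<sigma> s)" if s: "s \<in> {\<tau>0..\<tau>1}" for s
  proof -
    have "N.H s = Q - \<Psi> \<tau>1 + integral {s..\<tau>1} (\<lambda>u. y u *\<^sub>R N.\<phi> u)"
      using N.H_before[of s] s \<tau>0_pos by (simp add: NT)
    also have "integral {s..\<tau>1} (\<lambda>u. y u *\<^sub>R N.\<phi> u)
        = integral {s..\<tau>1} (\<lambda>u. (1 / a (\<sigma> u)) *\<^sub>R (x (\<sigma> u) *\<^sub>R \<theta> (\<sigma> u)))"
      using s by (intro integral_cong) (simp add: N\<phi>_core y_core core_def)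
    also have "\<dots> = integral {\<sigma> s..T} (\<lambda>t. x t *\<^sub>R \<theta> t)"
      by (rule sub[OF good_\<theta>(2) s])
    finally show ?thesis by (simp add: K_def \<Psi>_core[OF ends(2)])
  qed
  \<comment> \<open>\<open>y\<close> vanishes strictly before \<open>\<tau>0\<close>; at
    \<open>\<tau>0\<close> it has the mass of the old atom at 0, which is a single point for the
    integral.\<close>
  have y_null: "((\<lambda>u. y u *\<^sub>R F u) has_integral 0) {s..\<tau>0}" if "0 \<le> s" for s and F :: "real \<Rightarrow> 'c::euclidean_space"
    by (rule has_integral_spike_finite[of "{\<tau>0}" _ _ "\<lambda>_. 0"]) (auto simp: y_before)
  have NH_before: "N.H s = K 0" if s: "s \<in> {0..\<tau>0}" for s
  proof -
    have "N.H s = Q - \<Psi> \<tau>1 + integral {s..\<tau>1} (\<lambda>u. y u *\<^sub>R N.\<phi> u)"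
      using N.H_before[of s] s \<tau>01 by (simp add: NT)
    also have "integral {s..\<tau>1} (\<lambda>u. y u *\<^sub>R N.\<phi> u)
        = integral {s..\<tau>0} (\<lambda>u. y u *\<^sub>R N.\<phi> u) + integral {\<tau>0..\<tau>1} (\<lambda>u. y u *\<^sub>R N.\<phi> u)"
      using s \<tau>01 \<tau>1_less
      by (intro integral_combine_Icc[symmetric] N.x\<phi>_integrable) auto
    also have "integral {s..\<tau>0} (\<lambda>u. y u *\<^sub>R N.\<phi> u) = 0"
      using y_null[of s N.\<phi>] s by (simp add: integral_unique)
    finally have "N.H s = N.H \<tau>0"
      using N.H_before[of \<tau>0] \<tau>0_pos \<tau>01 by (simp add: NT)
    then show ?thesis using NH_core[OF ends(1)] by simp
  qed
  have cont_\<Theta>: "lip {0..T} \<Theta>"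
  proof -
    have "lip {0..T} (\<lambda>t. \<Theta> 0 + integral {0..t} \<theta>)"
      using good_\<theta>(1) by (auto simp: good_def intro!: lip_add lip_const lip_integral)
    then show ?thesis
    proof (rule lip_cong)
      fix t assume "t \<in> {0..T}"
      then show "\<Theta> 0 + integral {0..t} \<theta> = \<Theta> t"
        using \<theta>_integral[of 0 t] T_bounds by (simp add: integral_unique)
    qed
  qed
  have \<Theta>_entries: "\<Theta> t $ i $ j \<in> {-1..1}" if "t \<in> {0..T}" for t i j
    using N.\<Phi>_entries[of "\<tau> t" i j] \<Psi>_core[of "\<tau> t"] that \<tau>_increase[of 0 t] \<tau>_increase[of t T] \<tau>0_pos \<tau>1_less
    by (simp add: \<tau>0_def \<tau>1_def)
  have "integral {0..\<tau>1} (\<lambda>s. y s * (xi_field (\<Psi> s) \<bullet> N.\<phi> s))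
      = integral {0..\<tau>0} (\<lambda>s. y s * (xi_field (\<Psi> s) \<bullet> N.\<phi> s))
      + integral {\<tau>0..\<tau>1} (\<lambda>s. y s * (xi_field (\<Psi> s) \<bullet> N.\<phi> s))"
    using \<tau>0_pos \<tau>01 \<tau>1_less
    by (intro integral_combine_Icc[symmetric] N.xi_field_integrable) auto
  also have "integral {0..\<tau>0} (\<lambda>s. y s * (xi_field (\<Psi> s) \<bullet> N.\<phi> s)) = 0"
    using y_null[of 0 "\<lambda>s. xi_field (\<Psi> s) \<bullet> N.\<phi> s"] by (simp add: integral_unique)
  also have "integral {\<tau>0..\<tau>1} (\<lambda>s. y s * (xi_field (\<Psi> s) \<bullet> N.\<phi> s))
      = integral {\<tau>0..\<tau>1} (\<lambda>s. (1 / a (\<sigma> s)) *\<^sub>R (x (\<sigma> s) *\<^sub>R (xi_field (\<Theta> (\<sigma> s)) \<bullet> \<theta> (\<sigma> s))))"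
    by (intro integral_cong) (simp add: N\<phi>_core y_core core_def \<Psi>_core)
  also have "\<dots> = integral {\<sigma> \<tau>0..T} (\<lambda>t. x t *\<^sub>R (xi_field (\<Theta> t) \<bullet> \<theta> t))"
    by (intro sub[of "\<lambda>t. x t *\<^sub>R (xi_field (\<Theta> t) \<bullet> \<theta> t)"] good_continuous lip_continuous lip_inner compact_Icc
        lip_xi_field cont_\<Theta> \<Theta>_entries lip_\<theta> ends)
  finally have 1: "integral {0..\<tau>1} (\<lambda>s. y s * (xi_field (\<Psi> s) \<bullet> N.\<phi> s))
      = integral {0..T} (\<lambda>t. x t * (xi_field (\<Theta> t) \<bullet> \<theta> t))" by simp
  have KT: "lip {0..T} (\<lambda>t. matrix_inv (K t))"
    using K_pd by (intro lip_compose[OF lip_K lip_matrix_inv[OF k]]) auto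
  have "integral {0..\<tau>1} (\<lambda>s. matrix_inv (N.H s) \<bullet> N.\<phi> s)
      = integral {0..\<tau>0} (\<lambda>s. matrix_inv (N.H s) \<bullet> N.\<phi> s) + integral {\<tau>0..\<tau>1} (\<lambda>s. matrix_inv (N.H s) \<bullet> N.\<phi> s)"
    using \<tau>0_pos \<tau>01 N.H_inv_lip
    by (intro integral_combine_Icc[symmetric] integrable_continuous_real lip_continuous
        lip_inner compact_Icc N.lip_\<phi>) (auto simp: NT)
  also have "integral {0..\<tau>0} (\<lambda>s. matrix_inv (N.H s) \<bullet> N.\<phi> s) = integral {0..\<tau>0} (\<lambda>s. matrix_inv (K 0) \<bullet> p s)"
    using \<tau>01 \<tau>1_less by (intro integral_cong) (simp add: NH_before N\<phi>)
  also have "\<dots> = matrix_inv (K 0) \<bullet> J"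
    using has_integral_linear[OF p_int0 bounded_linear_inner_right[of "matrix_inv (K 0)"]]
    by (simp add: integral_unique o_def)
  also have "integral {\<tau>0..\<tau>1} (\<lambda>s. matrix_inv (N.H s) \<bullet> N.\<phi> s)
      = integral {\<tau>0..\<tau>1} (\<lambda>s. (1 / a (\<sigma> s)) *\<^sub>R (matrix_inv (K (\<sigma> s)) \<bullet> \<theta> (\<sigma> s)))"
    by (intro integral_cong) (simp add: N\<phi>_core core_def NH_core)
  also have "\<dots> = integral {\<sigma> \<tau>0..T} (\<lambda>t. matrix_inv (K t) \<bullet> \<theta> t)"
    by (intro sub[of "\<lambda>t. matrix_inv (K t) \<bullet> \<theta> t"] good_continuous lip_continuous lip_inner compact_Icc KT lip_\<theta> ends)
  finally have 2: "integral {0..\<tau>1} (\<lambda>s. matrix_inv (N.H s) \<bullet> N.\<phi> s)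
      = matrix_inv (K 0) \<bullet> J + integral {0..T} (\<lambda>t. matrix_inv (K t) \<bullet> \<theta> t)" by simp
  have "2 * crisanti_sommers \<beta> h y \<Psi> =
     integral {0..T} (\<lambda>t. x t * (xi_field (\<Theta> t) \<bullet> \<theta> t)) + potential Q - potential (\<Theta> T)
     + ln (det (Q - \<Theta> T)) + integral {0..T} (\<lambda>t. matrix_inv (K t) \<bullet> \<theta> t) + matrix_inv (K 0) \<bullet> J"
    using N.cs_evaluation by (simp add: NT 1 2 \<Psi>_core[OF ends(2)])
  with adm show ?thesis by blast
qed

end

subsection \<open>The first variation\<close>

lemma lip_fst: "lip S fst" and lip_snd: "lip S snd"
  by (rule lipI[of _ _ 1], simp add: dist_fst_le dist_snd_le)+

lemma pd_by_le: "pd_by k A \<Longrightarrow> k' \<le> k \<Longrightarrow> pd_by k' A"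
  unfolding pd_by_iff by (meson inner_ge_zero mult_right_mono order_trans)

lemma pd_by_scaleR: "pd_by k A \<Longrightarrow> 0 \<le> r \<Longrightarrow> pd_by (r * k) (r *\<^sub>R A)"
  using psd_scaleR[of r "A - k *\<^sub>R mat 1"] by (simp add: pd_by_def algebra_simps)

lemma right_derivative_nonneg_at_min:
  fixes g :: "real \<Rightarrow> real"
  assumes "(g has_real_derivative d) (at_right 0)" "0 < e" "\<And>r. 0 < r \<Longrightarrow> r < e \<Longrightarrow> g 0 \<le> g r"
  shows "0 \<le> d"
proof (rule tendsto_lowerbound)
  show "((\<lambda>r. (g r - g 0) / (r - 0)) \<longlongrightarrow> d) (at_right 0)"
    using assms(1) by (simp add: has_field_derivative_iff)
  show "\<forall>\<^sub>F r in at_right 0. 0 \<le> (g r - g 0) / (r - 0)"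
    using eventually_at_right_real[OF assms(2)] by eventually_elim (use assms(3) in auto)
qed simp

lemma has_real_derivative_inner:
  fixes f g :: "real \<Rightarrow> 'a::real_inner"
  assumes "(f has_vector_derivative f') (at t within S)" "(g has_vector_derivative g') (at t within S)"
  shows "((\<lambda>s. f s \<bullet> g s) has_real_derivative f t \<bullet> g' + f' \<bullet> g t) (at t within S)"
  using bounded_bilinear.has_vector_derivative[OF bounded_bilinear_inner assms]
  by (simp add: has_real_derivative_iff_has_vector_derivative)

lemmas has_vector_derivative_matrix_mult =
  bounded_bilinear.has_vector_derivative[OF bounded_bilinear_matrix_mult]

context cs_pair
begin

section \<open>The two sides of the identity and their derivatives\<close>

definition Hi :: "real \<Rightarrow> real ^ 'n ^ 'n" where "Hi t = matrix_inv (H t)"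
text \<open>The integrand on the right of the claimed identity. It enters the variation because
  \<open>x t *\<^sub>R M' t\<close> is the right derivative of \<open>Hi\<close>.\<close>

definition M' :: "real \<Rightarrow> real ^ 'n ^ 'n" where "M' t = Hi t ** \<phi> t ** Hi t"
definition M :: "real \<Rightarrow> real ^ 'n ^ 'n" where "M t = integral {0..t} M'"
definition K' :: "real \<Rightarrow> real ^ 'n ^ 'n" where "K' t = xi_field_deriv (\<Phi> t) (\<phi> t)"
definition D :: "real \<Rightarrow> real ^ 'n ^ 'n" where "D t = xi_field (\<Phi> t) - M t"
definition D' :: "real \<Rightarrow> real ^ 'n ^ 'n" where "D' t = K' t - M' t"

lemma lip_Hi: "lip {0..T} Hi"
  using H_inv_lip by (simp add: Hi_def[abs_def])

lemma lip_M': "lip {0..T} M'"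
  unfolding M'_def[abs_def] by (intro lip_matrix_mult compact_Icc lip_Hi lip_\<phi>)

lemma M'_integrable: "0 \<le> s \<Longrightarrow> t \<le> T \<Longrightarrow> M' integrable_on {s..t}"
  by (intro integrable_continuous_real continuous_on_subset[OF lip_continuous[OF lip_M']]) auto

lemma M_deriv: "t \<in> {0..T} \<Longrightarrow> (M has_vector_derivative M' t) (at t within {0..T})"
  unfolding M_def[abs_def] by (rule integral_has_vector_derivative[OF lip_continuous[OF lip_M']])

lemma lip_M: "lip {0..T} M"
  by (rule lip_C1[OF M_deriv lip_continuous[OF lip_M']])

lemma lip_K': "lip {0..T} K'"
  unfolding K'_def[abs_def] using T_bounds
  by (intro lip_xi_field_deriv compact_Icc lip_subset[OF lip_\<Phi>] \<Phi>_entries lip_\<phi>) auto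

lemma lip_D: "lip {0..T} D"
  unfolding D_def[abs_def] using T_bounds
  by (intro lip_diff lip_xi_field lip_M lip_subset[OF lip_\<Phi>] \<Phi>_entries) auto

lemma lip_D': "lip {0..T} D'"
  unfolding D'_def[abs_def] by (intro lip_diff lip_K' lip_M')

lemma D_deriv: assumes "t \<in> {0..T}" shows "(D has_vector_derivative D' t) (at t within {0..T})"
  unfolding D_def[abs_def] D'_def K'_def using assms T_bounds
  by (intro has_vector_derivative_diff M_deriv xi_field_derivative \<Phi>_entries
      has_vector_derivative_within_subset[OF \<Phi>_deriv]) auto

lemma at_right_of_within:
  assumes "(f has_vector_derivative f') (at t within {0..T})" "0 \<le> t" "t < T"
  shows "(f has_vector_derivative f') (at_right t)"
proof -
  have "(f has_vector_derivative f') (at t within {t..T})"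
    by (rule has_vector_derivative_within_subset[OF assms(1)]) (use assms in auto)
  then show ?thesis using assms by (simp add: at_within_Icc_at_right)
qed

lemma H_sym: "t \<in> {0..T} \<Longrightarrow> transpose (H t) = H t"
  using H_pd[of t] by (simp add: pd_by_iff)

lemma H_invertible: "t \<in> {0..T} \<Longrightarrow> invertible (H t)"
  using H_pd[of t] c_pos by (rule pd_by_invertible)

lemma Hi_sym: "t \<in> {0..T} \<Longrightarrow> transpose (Hi t) = Hi t"
  unfolding Hi_def by (intro matrix_inv_symmetric H_invertible H_sym)

lemma K'_psd: "t \<in> {0..T} \<Longrightarrow> psd (K' t)"
  unfolding K'_def using T_bounds by (intro xi_field_deriv_psd \<Phi>_psd \<Phi>_entries \<phi>_psd) auto

lemma M_psd: "t \<in> {0..T} \<Longrightarrow> psd (M t)"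
  unfolding M_def using Hi_sym
  by (intro psd_integral M'_integrable) (auto simp: M'_def intro!: psd_congruence_sym \<phi>_psd)

lemma Hi_right_deriv: assumes "0 \<le> t" "t < T"
  shows "(Hi has_vector_derivative x t *\<^sub>R M' t) (at_right t)"
proof -
  have "(H has_vector_derivative - (x t *\<^sub>R \<phi> t)) (at t within {t..T})"
    using H_right_deriv[of t] assms T_bounds by (simp add: at_within_Icc_at_right)
  then have "(Hi has_vector_derivative - (Hi t ** (- (x t *\<^sub>R \<phi> t)) ** Hi t)) (at t within {t..T})"
    unfolding Hi_def using assms H_pd by (intro matrix_inv_has_vector_derivative[OF _ _ c_pos]) auto
  then show ?thesis
    using assms by (simp add: at_within_Icc_at_right M'_def matrix_mult_algebra)
qed

lemma x_weight_integrable: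
  fixes g :: "real \<Rightarrow> real"
  assumes "continuous_on {0..T} g" "0 \<le> s" "t \<le> T"
  shows "(\<lambda>u. x u * g u) integrable_on {s..t}"
  using mono_scaleR_integrable[of s t x g] assms T_bounds
    mono_on_subset[OF x_mono, of "{s..t}"] continuous_on_subset[OF assms(1), of "{s..t}"]
  by auto

text \<open>With \<open>\<mu>\<close> the measure of the order parameter, \<open>variation \<eta> g\<close> equals \<open>\<integral> \<langle>D, \<eta>\<rangle> d\<mu>\<close> whenever
  \<open>g\<close> is the derivative of \<open>\<eta>\<close>.\<close>

definition variation :: "(real \<Rightarrow> real ^ 'n ^ 'n) \<Rightarrow> (real \<Rightarrow> real ^ 'n ^ 'n) \<Rightarrow> real"
  where "variation \<eta> g = D T \<bullet> \<eta> T - integral {0..T} (\<lambda>t. x t * (D' t \<bullet> \<eta> t + D t \<bullet> g t))"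

text \<open>Along \<open>\<Phi> + r *\<^sub>R \<eta>\<close> the functional is minimal at
  \<open>r = 0\<close>, and twice its right derivative there is \<open>- variation \<eta> g\<close>.
  Two integrations by parts bring the derivative into this form: they remove every unweighted
  integral and leave the weight \<open>x\<close> in front of an expression in \<open>D\<close> and
  \<open>D'\<close>.\<close>

theorem first_variation:
  assumes minimal: "\<And>y \<Psi>. admissible Q y \<Psi> \<Longrightarrow> crisanti_sommers \<beta> h x \<Phi> \<le> crisanti_sommers \<beta> h y \<Psi>"
    and g_lip: "lip {0..T} g" and J: "0 < k" "pd_by k J"
    and e0: "0 < e0" "\<And>t. t \<in> {0..T} \<Longrightarrow> psd (\<phi> t + e0 *\<^sub>R g t)"
    and \<eta>_def: "\<And>t. \<eta> t = J + integral {0..t} g"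
  shows "variation \<eta> g \<le> 0"
proof -
  have g_cont: "continuous_on {0..T} g" by (rule lip_continuous[OF g_lip])
  have g_int: "g integrable_on {s..t}" if "0 \<le> s" "t \<le> T" for s t
    using that by (intro integrable_continuous_real continuous_on_subset[OF g_cont]) auto
  have \<eta>_deriv: "(\<eta> has_vector_derivative g t) (at t within {0..T})" if "t \<in> {0..T}" for t
    unfolding \<eta>_def[abs_def]
    using integral_has_vector_derivative[OF g_cont that] by (auto intro!: derivative_eq_intros)
  have \<eta>_lip: "lip {0..T} \<eta>" by (rule lip_C1[OF \<eta>_deriv g_cont])
  have \<eta>_0: "\<eta> 0 = J" by (simp add: \<eta>_def)
  \<comment> \<open>\<open>cs_perturbation\<close> asks for a derivative that is Lipschitz on the
    whole line.\<close>
  define G where "G t = g (max 0 (min T t))" for t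
  have G_eq: "G t = g t" if "t \<in> {0..T}" for t using that by (simp add: G_def)
  have clamp: "max 0 (min T t) \<in> {0..T}" for t using T_bounds by auto
  have G_lip: "lip UNIV G"
  proof -
    have "lip UNIV (\<lambda>t :: real. max 0 (min T t))"
      by (rule lipI[of _ _ 1]) (auto simp: dist_real_def max_def min_def)
    from lip_compose[OF this g_lip] show ?thesis using clamp by (simp add: G_def[abs_def] image_subset_iff)
  qed
  obtain B where B: "0 < B" "\<And>t. t \<in> {0..T} \<Longrightarrow> norm (trace (g t)) \<le> B"
    using continuous_on_bounded_norm[OF lip_continuous[OF lip_bounded_linear[OF bounded_linear_trace g_lip]] compact_Icc]
    by metis
  \<comment> \<open>By convexity the condition at \<open>e0\<close> is inherited by all smaller
    parameters.\<close>
  have psd_r: "psd (\<phi> t + r *\<^sub>R g t)" if "0 \<le> r" "r \<le> e0" "t \<in> {0..T}" for r t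
  proof -
    have "psd ((1 - r / e0) *\<^sub>R \<phi> t + (r / e0) *\<^sub>R (\<phi> t + e0 *\<^sub>R g t))"
      using that e0(1) by (intro psd_add[OF psd_scaleR[OF _ \<phi>_psd] psd_scaleR[OF _ e0(2)]]) auto
    moreover have "(1 - r / e0) *\<^sub>R \<phi> t + (r / e0) *\<^sub>R (\<phi> t + e0 *\<^sub>R g t) = \<phi> t + r *\<^sub>R g t"
      using e0(1) by (simp add: algebra_simps)
    ultimately show ?thesis by simp
  qed
  have increment: "integral {s..t} (\<lambda>u. \<phi> u + r *\<^sub>R g u) = (\<Phi> t + r *\<^sub>R \<eta> t) - (\<Phi> s + r *\<^sub>R \<eta> s)"
    if "0 \<le> s" "s \<le> t" "t \<le> T" for r s t
  proof -
    have "integral {0..s} g + integral {s..t} g = integral {0..t} g"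
      using that by (intro integral_combine_Icc g_int) auto
    then have "integral {s..t} g = \<eta> t - \<eta> s" by (simp add: \<eta>_def algebra_simps)
    then have "(g has_integral \<eta> t - \<eta> s) {s..t}"
      using integrable_integral[OF g_int, of s t] that by simp
    from has_integral_add[OF \<phi>_integral[of s t] has_integral_cmul[OF this, of r]] that T_bounds
    show ?thesis by (simp add: integral_unique algebra_simps)
  qed
  have increment_psd: "psd ((\<Phi> t + r *\<^sub>R \<eta> t) - (\<Phi> s + r *\<^sub>R \<eta> s))"
    if "0 \<le> r" "r \<le> e0" "0 \<le> s" "s \<le> t" "t \<le> T" for r s t
  proof -
    have "(\<lambda>u. \<phi> u + r *\<^sub>R g u) integrable_on {s..t}"
      using that by (intro integrable_continuous_real continuous_intros lip_continuous lip_\<phi> lip_subset[OF g_lip]) auto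
    then have "psd (integral {s..t} (\<lambda>u. \<phi> u + r *\<^sub>R g u))"
      using that psd_r[of r] by (intro psd_integral) auto
    then show ?thesis using that by (simp add: increment)
  qed
  have J_psd: "psd J" using J by (auto intro: pd_by_psd)
  have \<eta>T_sym: "transpose (\<eta> T) = \<eta> T"
  proof -
    have "transpose ((\<Phi> T + e0 *\<^sub>R \<eta> T) - (\<Phi> 0 + e0 *\<^sub>R \<eta> 0)) = (\<Phi> T + e0 *\<^sub>R \<eta> T) - (\<Phi> 0 + e0 *\<^sub>R \<eta> 0)"
      using increment_psd[of e0 0 T] e0(1) T_bounds by (simp add: psd_transpose)
    moreover have "transpose (\<Phi> T) = \<Phi> T" using T_bounds by (intro psd_transpose \<Phi>_psd) auto
    ultimately have "e0 *\<^sub>R transpose (\<eta> T) = e0 *\<^sub>R \<eta> T"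
      using psd_transpose[OF J_psd] by (simp add: transpose_diff transpose_add transpose_scalar \<eta>_0 \<Phi>_0)
    then show ?thesis using e0(1) by simp
  qed
  \<comment> \<open>The three bounds keep the perturbed path monotone, the trace of its extra slope
    at most 1/2, and half of the gap \<open>c\<close> at \<open>T\<close>.\<close>
  define e where "e = Min {e0, 1 / (2 * B), c / (2 * (norm (\<eta> T) + 1))}"
  have nT: "0 < norm (\<eta> T) + 1" using norm_ge_zero[of "\<eta> T"] by linarith
  have e_pos: "0 < e" using e0 B(1) c_pos nT by (simp add: e_def)
  have e_le: "e \<le> e0" "e * B \<le> 1 / 2" "e * norm (\<eta> T) \<le> c / 2"
  proof -
    have "e \<le> 1 / (2 * B)" by (simp add: e_def)
    then show "e * B \<le> 1 / 2" using B(1) by (simp add: field_simps)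
    have "e \<le> c / (2 * (norm (\<eta> T) + 1))" by (simp add: e_def)
    then have "e * (norm (\<eta> T) + 1) \<le> c / 2" using nT by (simp add: field_simps)
    then show "e * norm (\<eta> T) \<le> c / 2" using e_pos by (simp add: algebra_simps)
  qed (simp add: e_def)
  have end_pd: "pd_by (c / 2) (Q - (\<Phi> T + r *\<^sub>R \<eta> T))" if r: "0 \<le> r" "r \<le> e" for r
  proof -
    have "norm (- (r *\<^sub>R \<eta> T)) \<le> c / 2"
      using mult_right_mono[OF r(2) norm_ge_zero[of "\<eta> T"]] r(1) e_le(3) by simp
    then have "pd_by (c - c / 2) (Q - \<Phi> T + - (r *\<^sub>R \<eta> T))"
      by (intro pd_by_of_norm c_T) (simp_all add: transpose_minus transpose_scalar \<eta>T_sym)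
    then show ?thesis by (simp add: algebra_simps)
  qed
  have entries: "(\<Phi> t + r *\<^sub>R \<eta> t) $ i $ j \<in> {-1..1}" if r: "0 \<le> r" "r \<le> e" and t: "t \<in> {0..T}" for r t i j
  proof (rule psd_mono_entries[OF _ _ Q_diag])
    have "psd ((\<Phi> t + r *\<^sub>R \<eta> t) - (\<Phi> 0 + r *\<^sub>R \<eta> 0) + r *\<^sub>R J)"
      using r t e_le(1) by (intro psd_add increment_psd psd_scaleR J_psd) auto
    then show "psd (\<Phi> t + r *\<^sub>R \<eta> t)" by (simp add: \<Phi>_0 \<eta>_0)
    have "psd ((\<Phi> T + r *\<^sub>R \<eta> T) - (\<Phi> t + r *\<^sub>R \<eta> t) + (Q - (\<Phi> T + r *\<^sub>R \<eta> T)))"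
      using r t e_le(1) c_pos by (intro psd_add increment_psd pd_by_psd[OF end_pd]) auto
    then show "psd (Q - (\<Phi> t + r *\<^sub>R \<eta> t))" by (simp add: algebra_simps)
  qed
  \<comment> \<open>The derivative of the perturbed hat path in the parameter. The dependence is
    exactly affine: the hat path becomes \<open>H t + r *\<^sub>R \<zeta> t\<close>.\<close>
  define \<zeta> where "\<zeta> t = - \<eta> T + integral {t..T} (\<lambda>s. x s *\<^sub>R g s)" for t
  have xg_int: "(\<lambda>s. x s *\<^sub>R g s) integrable_on {s..t}" if "0 \<le> s" "t \<le> T" for s t
    using that T_bounds
    by (intro mono_scaleR_integrable mono_on_subset[OF x_mono] continuous_on_subset[OF g_cont]) auto
  have \<zeta>_lip: "lip {0..T} \<zeta>"
  proof -
    obtain B' where B': "0 < B'" "\<And>t. t \<in> {0..T} \<Longrightarrow> norm (g t) \<le> B'"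
      using continuous_on_bounded_norm[OF g_cont compact_Icc] by metis
    have "norm (x t *\<^sub>R g t) \<le> 1 * B'" if "t \<in> {0..T}" for t
      using B'(2)[OF that] x01[of t] that T_bounds unfolding norm_scaleR by (intro mult_mono) auto
    then show ?thesis unfolding \<zeta>_def[abs_def]
      by (intro lip_add lip_const lip_integral[of _ 0 T "1 * B'"] xg_int) auto
  qed
  have H\<zeta>: "Q - (\<Phi> T + r *\<^sub>R \<eta> T) + integral {t..T} (\<lambda>s. x s *\<^sub>R (\<phi> s + r *\<^sub>R g s)) = H t + r *\<^sub>R \<zeta> t"
    if "t \<in> {0..T}" for r t
  proof -
    have "((\<lambda>s. x s *\<^sub>R \<phi> s + r *\<^sub>R (x s *\<^sub>R g s)) has_integral
        integral {t..T} (\<lambda>s. x s *\<^sub>R \<phi> s) + r *\<^sub>R integral {t..T} (\<lambda>s. x s *\<^sub>R g s)) {t..T}"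
      using that T_bounds by (intro has_integral_add has_integral_cmul integrable_integral x\<phi>_integrable xg_int) auto
    then have "integral {t..T} (\<lambda>s. x s *\<^sub>R (\<phi> s + r *\<^sub>R g s))
        = integral {t..T} (\<lambda>s. x s *\<^sub>R \<phi> s) + r *\<^sub>R integral {t..T} (\<lambda>s. x s *\<^sub>R g s)"
      by (simp add: integral_unique scaleR_add_right mult.commute)
    then show ?thesis using that H_before[of t] by (simp add: \<zeta>_def algebra_simps)
  qed
  have H\<zeta>_pd: "pd_by (c / 2) (H t + r *\<^sub>R \<zeta> t)" if r: "0 \<le> r" "r \<le> e" and t: "t \<in> {0..T}" for r t
  proof -
    have "(\<lambda>s. x s *\<^sub>R (\<phi> s + r *\<^sub>R g s)) integrable_on {t..T}"
      using t T_bounds lip_\<phi>[of "{t..T}"] lip_subset[OF g_lip, of "{t..T}"]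
      by (intro mono_scaleR_integrable mono_on_subset[OF x_mono] continuous_intros lip_continuous) auto
    then have "psd (integral {t..T} (\<lambda>s. x s *\<^sub>R (\<phi> s + r *\<^sub>R g s)))"
      using r t e_le(1) T_bounds x01 psd_r[of r] by (intro psd_integral psd_scaleR) auto
    then show ?thesis using pd_by_add_psd[OF end_pd[OF r]] by (simp add: H\<zeta>[OF t, symmetric])
  qed
  define f1 where "f1 r t = xi_field (\<Phi> t + r *\<^sub>R \<eta> t) \<bullet> (\<phi> t + r *\<^sub>R g t)" for r t
  define f1' where "f1' r t = xi_field (\<Phi> t + r *\<^sub>R \<eta> t) \<bullet> g t
      + xi_field_deriv (\<Phi> t + r *\<^sub>R \<eta> t) (\<eta> t) \<bullet> (\<phi> t + r *\<^sub>R g t)" for r t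
  define inv where "inv r t = matrix_inv (H t + r *\<^sub>R \<zeta> t)" for r t
  define f2 where "f2 r t = inv r t \<bullet> (\<phi> t + r *\<^sub>R g t)" for r t
  define f2' where "f2' r t = inv r t \<bullet> g t + - (inv r t ** \<zeta> t ** inv r t) \<bullet> (\<phi> t + r *\<^sub>R g t)" for r t
  \<comment> \<open>Twice the functional without the constant \<open>potential Q\<close>. The factor
    1 before \<open>f2\<close> is the weight with which
    \<open>integral_param_right_derivative\<close> is applied.\<close>
  define W where "W r = integral {0..T} (\<lambda>t. x t * f1 r t) - potential (\<Phi> T + r *\<^sub>R \<eta> T)
     + ln (det (Q - (\<Phi> T + r *\<^sub>R \<eta> T))) + integral {0..T} (\<lambda>t. 1 * f2 r t) + inv r 0 \<bullet> (r *\<^sub>R J)" for r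
  have "W 0 \<le> W r" if r: "0 < r" "r < e" for r
  proof -
    have r': "0 \<le> r" "r \<le> e" using r by auto
    define e' where "e' t = r *\<^sub>R G t" for t
    have e'_int: "integral {0..t} e' = r *\<^sub>R integral {0..t} g" if "t \<in> {0..T}" for t
    proof -
      have "integral {0..t} e' = integral {0..t} (\<lambda>s. r *\<^sub>R g s)"
        using that by (intro integral_cong) (simp add: e'_def G_eq)
      then show ?thesis by simp
    qed
    have \<Theta>_eq: "\<Phi> t + r *\<^sub>R J + integral {0..t} e' = \<Phi> t + r *\<^sub>R \<eta> t" if "t \<in> {0..T}" for t
      using e'_int[OF that] by (simp add: \<eta>_def scaleR_add_right)
    \<comment> \<open>The constant has to serve two matrices: the gap to \<open>Q\<close> keeps
      \<open>c / 2\<close>, while the initial value \<open>r *\<^sub>R J\<close> shrinks with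
      \<open>r\<close>.\<close>
    interpret P: cs_perturbation \<beta> h Q m x \<Phi> e' "r *\<^sub>R J" "min (c / 2) (r * k)"
    proof unfold_locales
      show "lip UNIV e'"
        unfolding e'_def[abs_def]
        by (rule lip_bounded_linear[OF bounded_linear_scaleR_right G_lip])
      show "\<bar>trace (e' t)\<bar> \<le> 1 / 2" for t
      proof -
        have "\<bar>trace (e' t)\<bar> = r * \<bar>trace (G t)\<bar>"
          using r by (simp add: e'_def trace_def sum_distrib_left[symmetric] abs_mult)
        also have "\<dots> \<le> e * B"
          using B(2)[OF clamp, of t] r e_pos by (intro mult_mono) (auto simp: G_def)
        finally show ?thesis using e_le(2) by simp
      qed
      show "psd (\<phi> t + e' t)" if "t \<in> {0..T}" for t
        using psd_r[of r t] that r e_le(1) by (simp add: e'_def G_eq)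
      show "0 < min (c / 2) (r * k)" using c_pos r J by simp
      show "pd_by (min (c / 2) (r * k)) (r *\<^sub>R J)"
        by (rule pd_by_le[OF pd_by_scaleR[OF J(2)]]) (use r in auto)
      show "pd_by (min (c / 2) (r * k)) (Q - (\<Phi> T + r *\<^sub>R J + integral {0..T} e'))"
      proof -
        have "\<Phi> T + r *\<^sub>R J + integral {0..T} e' = \<Phi> T + r *\<^sub>R \<eta> T"
          using T_bounds by (intro \<Theta>_eq) auto
        then show ?thesis by (simp only:) (rule pd_by_le[OF end_pd[OF r']], simp)
      qed
    qed
    have \<Theta>: "P.\<Theta> t = \<Phi> t + r *\<^sub>R \<eta> t" and \<theta>: "P.\<theta> t = \<phi> t + r *\<^sub>R g t" if "t \<in> {0..T}" for t
      using \<Theta>_eq[OF that] that by (simp_all add: P.\<Theta>_def P.\<theta>_def e'_def G_eq)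
    have K: "P.K t = H t + r *\<^sub>R \<zeta> t" if t: "t \<in> {0..T}" for t
    proof -
      have "integral {t..T} (\<lambda>s. x s *\<^sub>R P.\<theta> s) = integral {t..T} (\<lambda>s. x s *\<^sub>R (\<phi> s + r *\<^sub>R g s))"
        using t by (intro integral_cong) (simp add: \<theta>)
      then show ?thesis using H\<zeta>[OF t, of r] T_bounds by (simp add: P.K_def \<Theta>)
    qed
    have "integral {0..T} (\<lambda>t. x t * (xi_field (P.\<Theta> t) \<bullet> P.\<theta> t)) = integral {0..T} (\<lambda>t. x t * f1 r t)"
      by (intro integral_cong) (simp add: \<Theta> \<theta> f1_def)
    moreover have "integral {0..T} (\<lambda>t. matrix_inv (P.K t) \<bullet> P.\<theta> t) = integral {0..T} (\<lambda>t. 1 * f2 r t)"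
      by (intro integral_cong) (simp add: K \<theta> f2_def inv_def)
    moreover have "0 \<in> {0..T}" "T \<in> {0..T}" using T_bounds by auto
    ultimately obtain y \<Psi> where "admissible Q y \<Psi>" "2 * crisanti_sommers \<beta> h y \<Psi> = W r + potential Q"
      using P.perturbed_pair by (auto simp: W_def \<Theta> K inv_def)
    then have "2 * crisanti_sommers \<beta> h x \<Phi> \<le> W r + potential Q" using minimal[of y \<Psi>] by simp
    then show ?thesis
      unfolding cs_evaluation by (simp add: W_def f1_def f2_def inv_def)
  qed
  moreover have "(W has_real_derivative - variation \<eta> g) (at_right 0)"
  proof -
    have T0: "0 \<in> {0..T}" "T \<in> {0..T}" using T_bounds by auto
    have e0_in: "0 \<in> {0..e}" using e_pos by simp
    have atr: "at 0 within {0..e} = at_right 0" using e_pos by (rule at_within_Icc_at_right)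
    let ?S = "{0..e} \<times> {0..T}"
    have S: "compact ?S" by (intro compact_Times compact_Icc)
    have lin: "((\<lambda>r. A + r *\<^sub>R E) has_vector_derivative E) (at r within S)" for A E :: "real ^ 'n ^ 'n" and r S
      by (auto intro!: derivative_eq_intros)
    have lipS: "lip ?S (\<lambda>p. f (snd p))" if "lip {0..T} f" for f :: "real \<Rightarrow> real ^ 'n ^ 'n"
      by (rule lip_compose[OF lip_snd that]) auto
    have lipS': "lip ?S (\<lambda>p. f (snd p) + fst p *\<^sub>R f' (snd p))"
      if "lip {0..T} f" "lip {0..T} f'" for f f' :: "real \<Rightarrow> real ^ 'n ^ 'n"
      using that by (intro lip_add lip_scaleR S lip_fst lipS)
    have \<Phi>T_lip: "lip {0..T} \<Phi>" using T_bounds by (intro lip_subset[OF lip_\<Phi>]) auto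
    have HT_lip: "lip {0..T} H" using T_bounds by (intro lip_subset[OF lip_H]) auto
    have f1_deriv: "((\<lambda>r. f1 r t) has_real_derivative f1' r t) (at r within {0..e})"
      if "r \<in> {0..e}" "t \<in> {0..T}" for r t
      unfolding f1_def f1'_def using that entries
      by (intro has_real_derivative_inner xi_field_derivative lin) auto
    have f2_deriv: "((\<lambda>r. f2 r t) has_real_derivative f2' r t) (at r within {0..e})"
      if "r \<in> {0..e}" "t \<in> {0..T}" for r t
      unfolding f2_def f2'_def inv_def using that H\<zeta>_pd c_pos
      by (intro has_real_derivative_inner matrix_inv_has_vector_derivative[of _ _ _ _ "c / 2"] lin) auto
    have inv_lip: "lip ?S (\<lambda>p. inv (fst p) (snd p))"
      unfolding inv_def using H\<zeta>_pd c_pos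
      by (intro lip_compose[OF lipS'[OF HT_lip \<zeta>_lip] lip_matrix_inv[of "c / 2"]]) auto
    have f1'_cont: "continuous_on ?S (\<lambda>(r, t). f1' r t)"
    proof -
      have "lip ?S (\<lambda>p. f1' (fst p) (snd p))"
        unfolding f1'_def using entries
        by (intro lip_add lip_inner S lip_xi_field lip_xi_field_deriv lipS' lipS \<Phi>T_lip \<eta>_lip g_lip lip_\<phi>) auto
      from lip_continuous[OF this] show ?thesis by (simp add: case_prod_unfold)
    qed
    have f2'_cont: "continuous_on ?S (\<lambda>(r, t). f2' r t)"
    proof -
      have "lip ?S (\<lambda>p. f2' (fst p) (snd p))"
        unfolding f2'_def
        by (intro lip_add lip_inner lip_minus lip_matrix_mult S inv_lip lipS' lipS g_lip lip_\<phi> \<zeta>_lip)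
      from lip_continuous[OF this] show ?thesis by (simp add: case_prod_unfold)
    qed
    have f1_cont: "continuous_on {0..T} (f1 r)" if "r \<in> {0..e}" for r
      unfolding f1_def[abs_def] using that entries
      by (intro lip_continuous lip_inner compact_Icc lip_xi_field lip_add \<Phi>T_lip lip_\<phi>
          lip_bounded_linear[OF bounded_linear_scaleR_right] \<eta>_lip g_lip) auto
    have f2_cont: "continuous_on {0..T} (f2 r)" if "r \<in> {0..e}" for r
    proof -
      have "lip {0..T} (\<lambda>t. H t + r *\<^sub>R \<zeta> t)"
        by (intro lip_add HT_lip lip_bounded_linear[OF bounded_linear_scaleR_right] \<zeta>_lip)
      then have "lip {0..T} (inv r)" unfolding inv_def[abs_def]
        using that H\<zeta>_pd c_pos by (intro lip_compose[OF _ lip_matrix_inv[of "c / 2"]]) auto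
      then show ?thesis unfolding f2_def[abs_def]
        by (intro lip_continuous lip_inner compact_Icc lip_add lip_\<phi>
            lip_bounded_linear[OF bounded_linear_scaleR_right] g_lip)
    qed
    have d1: "((\<lambda>r. integral {0..T} (\<lambda>t. x t * f1 r t)) has_real_derivative
        integral {0..T} (\<lambda>t. x t * f1' 0 t)) (at_right 0)"
      using x01 T_bounds
      by (intro integral_param_right_derivative[OF e_pos f1_deriv f1'_cont] x_weight_integrable f1_cont) auto
    have d2: "((\<lambda>r. integral {0..T} (\<lambda>t. 1 * f2 r t)) has_real_derivative
        integral {0..T} (\<lambda>t. 1 * f2' 0 t)) (at_right 0)"
      by (intro integral_param_right_derivative[OF e_pos f2_deriv f2'_cont])
         (auto intro!: integrable_continuous_real f2_cont)
    have d3: "((\<lambda>r. potential (\<Phi> T + r *\<^sub>R \<eta> T)) has_real_derivative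
        xi_field (\<Phi> T + 0 *\<^sub>R \<eta> T) \<bullet> \<eta> T) (at_right 0)"
      using entries[of 0 T] e_pos T0 by (intro potential_derivative lin) auto
    have d4: "((\<lambda>r. ln (det (Q - (\<Phi> T + r *\<^sub>R \<eta> T)))) has_real_derivative
        matrix_inv (Q - (\<Phi> T + 0 *\<^sub>R \<eta> T)) \<bullet> (0 - \<eta> T)) (at_right 0)"
      using c_T pd_by_det_pos[OF c_T c_pos]
      by (intro ln_det_has_derivative has_vector_derivative_diff has_vector_derivative_const lin)
         (auto simp: pd_by_iff)
    have d5: "((\<lambda>r. inv r 0 \<bullet> (r *\<^sub>R J)) has_real_derivative
        inv 0 0 \<bullet> J + - (inv 0 0 ** \<zeta> 0 ** inv 0 0) \<bullet> (0 *\<^sub>R J)) (at 0 within {0..e})"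
      unfolding inv_def using H\<zeta>_pd c_pos T0 e0_in lin[of 0 J]
      by (intro has_real_derivative_inner matrix_inv_has_vector_derivative[of _ _ _ _ "c / 2"] lin) auto
    have W': "(W has_real_derivative integral {0..T} (\<lambda>t. x t * f1' 0 t) - xi_field (\<Phi> T) \<bullet> \<eta> T
        - Hi T \<bullet> \<eta> T + integral {0..T} (\<lambda>t. f2' 0 t) + Hi 0 \<bullet> J) (at_right 0)"
      unfolding W_def[abs_def]
      using DERIV_add[OF DERIV_add[OF DERIV_add[OF DERIV_diff[OF d1 d3] d4] d2] d5[unfolded atr]]
        H_after[of T] T_bounds by (simp add: inv_def Hi_def)
    have \<zeta>_right: "(\<zeta> has_vector_derivative - (x t *\<^sub>R g t)) (at_right t)" if "0 \<le> t" "t < T" for t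
    proof -
      have "continuous (at_right t) (\<lambda>s. x s *\<^sub>R g s)"
        using that T_bounds by (intro continuous_scaleR x_right_continuous continuous_on_at_right[OF g_cont]) auto
      from integral_right_derivative(2)[OF xg_int that this] show ?thesis
        unfolding \<zeta>_def[abs_def] by (auto intro!: derivative_eq_intros)
    qed
    \<comment> \<open>Exchanges the unweighted term \<open>Hi t \<bullet> g t\<close> of
      \<open>f2'\<close> for a term in \<open>M'\<close> and \<eta> with weight \<open>x\<close>;
      the boundary terms cancel those from the logarithm and from \<open>J\<close>.\<close>
    have i1: "((\<lambda>t. Hi t \<bullet> g t + (x t *\<^sub>R M' t) \<bullet> \<eta> t) has_integral Hi T \<bullet> \<eta> T - Hi 0 \<bullet> \<eta> 0) {0..T}"
    proof (rule fundamental_theorem_of_calculus_right[OF T_bounds(1)])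
      show "lip {0..T} (\<lambda>t. Hi t \<bullet> \<eta> t)" by (intro lip_inner compact_Icc lip_Hi \<eta>_lip)
      fix t assume t: "0 \<le> t" "t < T"
      then show "((\<lambda>t. Hi t \<bullet> \<eta> t) has_vector_derivative Hi t \<bullet> g t + (x t *\<^sub>R M' t) \<bullet> \<eta> t) (at_right t)"
        unfolding has_real_derivative_iff_has_vector_derivative[symmetric]
        by (intro has_real_derivative_inner Hi_right_deriv at_right_of_within[OF \<eta>_deriv]) auto
    qed
    \<comment> \<open>Exchanges the other unweighted term, \<open>\<zeta> t \<bullet> M' t\<close>,
      for a weighted one in \<open>g\<close> and \<open>M\<close>. As \<open>M\<close> is 0 at 0 and
      \<open>\<zeta> T = - \<eta> T\<close>, the boundary supplies the part of
      \<open>D T \<bullet> \<eta> T\<close> that contains \<open>M T\<close>.\<close>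
    have i2: "((\<lambda>t. \<zeta> t \<bullet> M' t + (- (x t *\<^sub>R g t)) \<bullet> M t) has_integral \<zeta> T \<bullet> M T - \<zeta> 0 \<bullet> M 0) {0..T}"
    proof (rule fundamental_theorem_of_calculus_right[OF T_bounds(1)])
      show "lip {0..T} (\<lambda>t. \<zeta> t \<bullet> M t)" by (intro lip_inner compact_Icc lip_M \<zeta>_lip)
      fix t assume t: "0 \<le> t" "t < T"
      then show "((\<lambda>t. \<zeta> t \<bullet> M t) has_vector_derivative \<zeta> t \<bullet> M' t + (- (x t *\<^sub>R g t)) \<bullet> M t) (at_right t)"
        unfolding has_real_derivative_iff_has_vector_derivative[symmetric]
        by (intro has_real_derivative_inner \<zeta>_right at_right_of_within[OF M_deriv]) auto
    qed
    have i3: "((\<lambda>t. x t * f1' 0 t) has_integral integral {0..T} (\<lambda>t. x t * f1' 0 t)) {0..T}"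
    proof (intro integrable_integral x_weight_integrable)
      have "continuous_on {0..T} ((\<lambda>(r, t). f1' r t) \<circ> (\<lambda>t. (0, t)))"
        using e0_in by (intro continuous_on_compose continuous_intros continuous_on_subset[OF f1'_cont]) auto
      then show "continuous_on {0..T} (f1' 0)" by (simp add: o_def)
    qed auto
    have i4: "((\<lambda>t. f2' 0 t) has_integral integral {0..T} (\<lambda>t. f2' 0 t)) {0..T}"
    proof (intro integrable_integral integrable_continuous_real)
      have "continuous_on {0..T} ((\<lambda>(r, t). f2' r t) \<circ> (\<lambda>t. (0, t)))"
        using e0_in by (intro continuous_on_compose continuous_intros continuous_on_subset[OF f2'_cont]) auto
      then show "continuous_on {0..T} (f2' 0)" by (simp add: o_def)
    qed
    have "((\<lambda>t. x t * f1' 0 t + f2' 0 t - (Hi t \<bullet> g t + (x t *\<^sub>R M' t) \<bullet> \<eta> t)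
          + (\<zeta> t \<bullet> M' t + (- (x t *\<^sub>R g t)) \<bullet> M t)) has_integral
        integral {0..T} (\<lambda>t. x t * f1' 0 t) + integral {0..T} (\<lambda>t. f2' 0 t)
          - (Hi T \<bullet> \<eta> T - Hi 0 \<bullet> \<eta> 0) + (\<zeta> T \<bullet> M T - \<zeta> 0 \<bullet> M 0)) {0..T}"
      by (intro has_integral_add has_integral_diff i1 i2 i3 i4)
    moreover have "x t * f1' 0 t + f2' 0 t - (Hi t \<bullet> g t + (x t *\<^sub>R M' t) \<bullet> \<eta> t)
          + (\<zeta> t \<bullet> M' t + (- (x t *\<^sub>R g t)) \<bullet> M t) = x t * (D' t \<bullet> \<eta> t + D t \<bullet> g t)" if t: "t \<in> {0..T}" for t
    proof -
      have "(Hi t ** \<zeta> t ** Hi t) \<bullet> \<phi> t = \<zeta> t \<bullet> M' t"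
        using inner_matrix_mult_right[of "Hi t ** \<zeta> t" "Hi t" "\<phi> t"]
          inner_matrix_mult_left[of "Hi t" "\<zeta> t" "\<phi> t ** Hi t"]
        by (simp add: Hi_sym[OF t] M'_def matrix_mul_assoc)
      moreover have "xi_field_deriv (\<Phi> t) (\<eta> t) \<bullet> \<phi> t = K' t \<bullet> \<eta> t"
        by (simp add: K'_def xi_field_deriv_inner)
      ultimately show ?thesis
        by (simp add: f1'_def f2'_def inv_def Hi_def[symmetric] D_def D'_def inner_diff_left inner_minus_left
            inner_commute[of _ "M t"] algebra_simps)
    qed
    ultimately have "((\<lambda>t. x t * (D' t \<bullet> \<eta> t + D t \<bullet> g t)) has_integral
        integral {0..T} (\<lambda>t. x t * f1' 0 t) + integral {0..T} (\<lambda>t. f2' 0 t)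
          - (Hi T \<bullet> \<eta> T - Hi 0 \<bullet> \<eta> 0) + (\<zeta> T \<bullet> M T - \<zeta> 0 \<bullet> M 0)) {0..T}"
      by (rule has_integral_eq[rotated]) simp
    then have "variation \<eta> g = D T \<bullet> \<eta> T - (integral {0..T} (\<lambda>t. x t * f1' 0 t) + integral {0..T} (\<lambda>t. f2' 0 t)
          - (Hi T \<bullet> \<eta> T - Hi 0 \<bullet> \<eta> 0) + (\<zeta> T \<bullet> M T - \<zeta> 0 \<bullet> M 0))"
      by (simp add: variation_def integral_unique)
    also have "\<zeta> T \<bullet> M T - \<zeta> 0 \<bullet> M 0 = - (M T \<bullet> \<eta> T)"
      by (simp add: \<zeta>_def M_def inner_commute)
    also have "D T \<bullet> \<eta> T = xi_field (\<Phi> T) \<bullet> \<eta> T - M T \<bullet> \<eta> T" by (simp add: D_def inner_diff_left)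
    finally have "- variation \<eta> g = integral {0..T} (\<lambda>t. x t * f1' 0 t) - xi_field (\<Phi> T) \<bullet> \<eta> T
        - Hi T \<bullet> \<eta> T + integral {0..T} (\<lambda>t. f2' 0 t) + Hi 0 \<bullet> J"
      by (simp add: \<eta>_0)
    with W' show ?thesis by simp
  qed
  ultimately have "0 \<le> - variation \<eta> g"
    using right_derivative_nonneg_at_min[OF _ e_pos, of W] by blast
  then show ?thesis by simp
qed

end

subsection \<open>Stationarity\<close>

context cs_pair
begin

lemma D_sym: assumes "t \<in> {0..T}" shows "transpose (D t) = D t"
proof -
  have "transpose (xi_field (\<Phi> t)) = xi_field (\<Phi> t)"
  proof -
    have t: "t \<in> {0..m}" using assms T_bounds by auto
    have b: "\<bar>\<Phi> t $ i $ j\<bar> < 2" for i j using \<Phi>_entries[OF t, of i j] by auto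
    have "cov \<beta> 1 j i z = cov \<beta> 1 i j z" for i j z
      by (simp add: cov_def diffs_def cov_coeff_def mult.commute cong: if_cong)
    then show ?thesis
      using psd_entry[OF \<Phi>_psd[OF t]]
      by (simp add: vec_eq_iff transpose_def xi_field_def xi'_entry b outer_prod_def mult.commute)
  qed
  then show ?thesis using psd_transpose[OF M_psd[OF assms]] by (simp add: D_def transpose_diff)
qed

lemma D_0: "D 0 = outer_prod h h"
  by (simp add: D_def M_def \<Phi>_0 xi_field_zero)

definition HDH :: "real \<Rightarrow> real ^ 'n ^ 'n" where "HDH t = H t ** D t ** H t"

definition HDH' :: "real \<Rightarrow> real ^ 'n ^ 'n"
  where "HDH' t = H t ** K' t ** H t - \<phi> t - x t *\<^sub>R (\<phi> t ** D t ** H t + H t ** D t ** \<phi> t)"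

lemma lip_HT: "lip {0..T} H"
  using T_bounds by (intro lip_subset[OF lip_H]) auto

lemma lip_HDH: "lip {0..T} HDH"
  unfolding HDH_def[abs_def] by (intro lip_matrix_mult compact_Icc lip_HT lip_D)

lemma HDH_right_deriv: assumes "0 \<le> t" "t < T" shows "(HDH has_vector_derivative HDH' t) (at_right t)"
proof -
  have t: "t \<in> {0..T}" using assms by simp
  have "(HDH has_vector_derivative H t ** D t ** (- (x t *\<^sub>R \<phi> t))
      + (H t ** D' t + - (x t *\<^sub>R \<phi> t) ** D t) ** H t) (at_right t)"
    unfolding HDH_def[abs_def] using assms T_bounds
    by (intro has_vector_derivative_matrix_mult H_right_deriv at_right_of_within[OF D_deriv]) auto
  moreover have "H t ** M' t ** H t = \<phi> t"
    by (simp add: M'_def Hi_def matrix_mul_assoc matrix_inv_inverse H_invertible[OF t])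
       (simp add: matrix_mul_assoc[symmetric] matrix_inv_inverse H_invertible[OF t])
  ultimately show ?thesis
    by (simp add: HDH'_def D'_def matrix_mult_algebra algebra_simps)
qed

lemma HDH_integral: assumes "t \<in> {0..T}" shows "(HDH' has_integral HDH t - HDH 0) {0..t}"
  using assms by (intro fundamental_theorem_of_calculus_right lip_subset[OF lip_HDH] HDH_right_deriv) auto

text \<open>The direction \<open>H D H\<close> is approximated by admissible ones: \<open>x\<close> is replaced by a Lipschitz
  function \<open>y\<close>, and the last term completes the square in \<open>\<phi> - \<delta> y (\<phi> Z + Z\<^sup>T \<phi>) + \<delta>\<^sup>2 Z\<^sup>T \<phi> Z\<close>
  with \<open>Z = D H\<close>.\<close>

definition direction :: "real \<Rightarrow> (real \<Rightarrow> real) \<Rightarrow> real \<Rightarrow> real ^ 'n ^ 'n"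
  where "direction \<delta> y t = H t ** K' t ** H t - \<phi> t - y t *\<^sub>R (\<phi> t ** D t ** H t + H t ** D t ** \<phi> t)
     + \<delta> *\<^sub>R (H t ** D t ** \<phi> t ** D t ** H t)"

lemma lip_direction: "lip {0..T} y \<Longrightarrow> lip {0..T} (direction \<delta> y)"
  unfolding direction_def[abs_def]
  by (intro lip_add lip_diff lip_scaleR lip_const lip_matrix_mult compact_Icc lip_HT lip_D lip_K' lip_\<phi>)

text \<open>After multiplication by \<open>1 + \<delta>\<close> the term \<open>- \<phi> t\<close>
  of the direction cancels against the extra \<open>\<delta> *\<^sub>R \<phi> t\<close>. What
  remains is the congruence \<open>N\<close> of \<open>\<phi> t\<close> by the identity minus
  \<open>\<delta> * y t\<close> times Z, the surplus
  \<open>\<delta>\<^sup>2 * (1 - (y t)\<^sup>2)\<close> of the square term, nonnegative as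
  \<open>y t\<close> is at most 1, and a congruence of \<open>K' t\<close>.\<close>

lemma direction_psd:
  assumes "0 < \<delta>" "y t \<in> {0..1}" "t \<in> {0..T}"
  shows "psd (\<phi> t + (\<delta> / (1 + \<delta>)) *\<^sub>R direction \<delta> y t)"
proof -
  let ?Z = "D t ** H t"
  have Z: "transpose ?Z = H t ** D t"
    by (simp add: matrix_transpose_mul D_sym[OF assms(3)] H_sym[OF assms(3)])
  define N where "N = transpose (mat 1 - (\<delta> * y t) *\<^sub>R ?Z) ** \<phi> t ** (mat 1 - (\<delta> * y t) *\<^sub>R ?Z)"
  define R where "R = transpose ?Z ** \<phi> t ** ?Z"
  have N: "N = \<phi> t - (\<delta> * y t) *\<^sub>R (\<phi> t ** D t ** H t + H t ** D t ** \<phi> t) + (\<delta> * y t)\<^sup>2 *\<^sub>R R"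
    by (simp add: N_def R_def transpose_diff transpose_scalar transpose_mat Z matrix_mult_algebra
        matrix_mul_assoc power2_eq_square algebra_simps)
  have y1: "(y t)\<^sup>2 \<le> 1" using assms(2) by (simp add: power_le_one)
  have "psd ((1 / (1 + \<delta>)) *\<^sub>R (N + (\<delta>\<^sup>2 * (1 - (y t)\<^sup>2)) *\<^sub>R R) + (\<delta> / (1 + \<delta>)) *\<^sub>R (H t ** K' t ** H t))"
    unfolding N_def R_def using assms y1
    by (intro psd_add psd_scaleR psd_congruence psd_congruence_sym \<phi>_psd K'_psd H_sym) auto
  moreover have "(1 / (1 + \<delta>)) *\<^sub>R (N + (\<delta>\<^sup>2 * (1 - (y t)\<^sup>2)) *\<^sub>R R) + (\<delta> / (1 + \<delta>)) *\<^sub>R (H t ** K' t ** H t)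
      = \<phi> t + (\<delta> / (1 + \<delta>)) *\<^sub>R direction \<delta> y t"
  proof -
    have "(1 + \<delta>) *\<^sub>R ((1 / (1 + \<delta>)) *\<^sub>R (N + (\<delta>\<^sup>2 * (1 - (y t)\<^sup>2)) *\<^sub>R R) + (\<delta> / (1 + \<delta>)) *\<^sub>R (H t ** K' t ** H t))
      = N + (\<delta>\<^sup>2 * (1 - (y t)\<^sup>2)) *\<^sub>R R + \<delta> *\<^sub>R (H t ** K' t ** H t)"
      using assms(1) by (simp add: scaleR_add_right)
    also have "\<dots> = (1 + \<delta>) *\<^sub>R \<phi> t + \<delta> *\<^sub>R direction \<delta> y t"
      unfolding N by (simp add: direction_def R_def Z matrix_mul_assoc algebra_simps power2_eq_square)
    also have "\<dots> = (1 + \<delta>) *\<^sub>R (\<phi> t + (\<delta> / (1 + \<delta>)) *\<^sub>R direction \<delta> y t)"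
      using assms(1) by (simp add: scaleR_add_right)
    finally show ?thesis using assms(1) by simp
  qed
  ultimately show ?thesis by simp
qed

text \<open>The approximating directions and their derivatives converge pointwise with bounds
  uniform in \<open>n\<close>, so dominated convergence carries the inequality of
  \<open>first_variation\<close> to the limit.\<close>

theorem variation_HDH:
  assumes minimal: "\<And>y \<Psi>. admissible Q y \<Psi> \<Longrightarrow> crisanti_sommers \<beta> h x \<Phi> \<le> crisanti_sommers \<beta> h y \<Psi>"
  shows "variation HDH HDH' \<le> 0"
proof -
  obtain y where y: "\<And>n a b. lip {a..b} (y n)" "\<And>n t. y n t \<in> {0..1}" "\<And>t. (\<lambda>n. y n t) \<longlonglongrightarrow> X t"
    by (rule mono_Lipschitz_approximation[OF X_mono X_right_continuous X01]) blast
  define \<delta> where "\<delta> n = 1 / real (Suc n)" for n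
  have \<delta>: "0 < \<delta> n" "\<delta> n \<le> 1" for n by (simp_all add: \<delta>_def)
  have \<delta>0: "\<delta> \<longlonglongrightarrow> 0" unfolding \<delta>_def
    using LIMSEQ_inverse_real_of_nat by (simp add: inverse_eq_divide)
  \<comment> \<open>The first summand is \<open>HDH 0\<close>; the second makes it positive
    definite, with a constant that tends to 0.\<close>
  define J where "J n = H 0 ** outer_prod h h ** H 0 + \<delta> n *\<^sub>R mat 1" for n
  define g where "g n = direction (\<delta> n) (y n)" for n
  define \<eta> where "\<eta> n t = J n + integral {0..t} (g n)" for n t
  have T0: "0 \<in> {0..T}" "T \<in> {0..T}" using T_bounds by auto
  have J_pd: "pd_by (\<delta> n) (J n)" for n
    using psd_congruence_sym[OF psd_outer_prod H_sym[OF T0(1)], of h] by (simp add: J_def pd_by_def)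
  have g_lip: "lip {0..T} (g n)" for n unfolding g_def by (intro lip_direction y)
  have g_int: "g n integrable_on {0..t}" if "t \<in> {0..T}" for n t
    using that by (intro integrable_continuous_real continuous_on_subset[OF lip_continuous[OF g_lip]]) auto
  have neg: "variation (\<eta> n) (g n) \<le> 0" for n
  proof (rule first_variation[OF minimal g_lip \<delta>(1) J_pd])
    show "0 < \<delta> n / (1 + \<delta> n)" using \<delta>(1)[of n] by simp
    show "psd (\<phi> t + (\<delta> n / (1 + \<delta> n)) *\<^sub>R g n t)" if "t \<in> {0..T}" for t
      unfolding g_def by (rule direction_psd[OF \<delta>(1) y(2) that])
  qed (auto simp: \<eta>_def)
  define P where "P t = H t ** K' t ** H t - \<phi> t" for t
  define R where "R t = \<phi> t ** D t ** H t + H t ** D t ** \<phi> t" for t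
  define S where "S t = H t ** D t ** \<phi> t ** D t ** H t" for t
  have g_eq: "g n t = P t - y n t *\<^sub>R R t + \<delta> n *\<^sub>R S t" for n t
    by (simp add: g_def direction_def P_def R_def S_def)
  have g_lim: "(\<lambda>n. g n t) \<longlonglongrightarrow> HDH' t" if "t \<in> {0..T}" for t
  proof -
    have "(\<lambda>n. P t - y n t *\<^sub>R R t + \<delta> n *\<^sub>R S t) \<longlonglongrightarrow> P t - X t *\<^sub>R R t + 0 *\<^sub>R S t"
      by (intro tendsto_intros y \<delta>0)
    then show ?thesis using that T_bounds by (simp add: g_eq HDH'_def P_def R_def X_eq)
  qed
  have cont: "continuous_on {0..T} P" "continuous_on {0..T} R" "continuous_on {0..T} S"
    unfolding P_def[abs_def] R_def[abs_def] S_def[abs_def]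
    by (intro lip_continuous lip_add lip_diff lip_matrix_mult compact_Icc lip_HT lip_D lip_K' lip_\<phi>)+
  obtain p where p: "0 < p" "\<And>t. t \<in> {0..T} \<Longrightarrow> norm (P t) \<le> p"
    using continuous_on_bounded_norm[OF cont(1) compact_Icc] by metis
  obtain r where r: "0 < r" "\<And>t. t \<in> {0..T} \<Longrightarrow> norm (R t) \<le> r"
    using continuous_on_bounded_norm[OF cont(2) compact_Icc] by metis
  obtain s where s: "0 < s" "\<And>t. t \<in> {0..T} \<Longrightarrow> norm (S t) \<le> s"
    using continuous_on_bounded_norm[OF cont(3) compact_Icc] by metis
  define B where "B = p + r + s"
  have g_bound: "norm (g n t) \<le> B" if "t \<in> {0..T}" for n t
  proof -
    have "norm (y n t *\<^sub>R R t) \<le> 1 * r" "norm (\<delta> n *\<^sub>R S t) \<le> 1 * s"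
      unfolding norm_scaleR by (intro mult_mono; use y(2)[of n t] \<delta>[of n] r s that in auto)+
    then show ?thesis
      using p(2)[OF that] norm_triangle_ineq[of "P t - y n t *\<^sub>R R t" "\<delta> n *\<^sub>R S t"]
        norm_triangle_ineq4[of "P t" "y n t *\<^sub>R R t"]
      unfolding g_eq B_def by linarith
  qed
  have J_lim: "J \<longlonglongrightarrow> HDH 0"
  proof -
    have "(\<lambda>n. H 0 ** outer_prod h h ** H 0 + \<delta> n *\<^sub>R mat 1) \<longlonglongrightarrow> H 0 ** outer_prod h h ** H 0 + 0 *\<^sub>R mat 1"
      by (intro tendsto_intros \<delta>0)
    then show ?thesis by (simp add: J_def[abs_def] HDH_def D_0)
  qed
  have \<eta>_lim: "(\<lambda>n. \<eta> n t) \<longlonglongrightarrow> HDH t" if t: "t \<in> {0..T}" for t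
  proof -
    have "(\<lambda>n. integral {0..t} (g n)) \<longlonglongrightarrow> integral {0..t} HDH'"
      using t by (intro dominated_convergence(2)[where h = "\<lambda>_. B"] g_int g_bound g_lim) auto
    then have "(\<lambda>n. \<eta> n t) \<longlonglongrightarrow> HDH 0 + integral {0..t} HDH'"
      unfolding \<eta>_def by (intro tendsto_add J_lim)
    then show ?thesis using HDH_integral[OF t] by (simp add: integral_unique)
  qed
  obtain b where b: "\<And>n. norm (J n) \<le> b"
    using convergent_imp_bounded[OF J_lim] by (auto simp: bounded_iff)
  have \<eta>_bound: "norm (\<eta> n t) \<le> b + B * T" if t: "t \<in> {0..T}" for n t
  proof -
    have B0: "0 \<le> B" using p r s by (simp add: B_def)
    have "norm (integral {0..t} (g n)) \<le> integral {0..t} (\<lambda>_. B)"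
      using t by (intro integral_norm_bound_integral g_int g_bound) auto
    also have "\<dots> \<le> B * T" using t B0 by (simp add: mult.commute mult_left_mono)
    finally show ?thesis unfolding \<eta>_def using b[of n] norm_triangle_ineq[of "J n" "integral {0..t} (g n)"] by linarith
  qed
  obtain d where d: "0 < d" "\<And>t. t \<in> {0..T} \<Longrightarrow> norm (D t) \<le> d"
    using continuous_on_bounded_norm[OF lip_continuous[OF lip_D] compact_Icc] by metis
  obtain d' where d': "0 < d'" "\<And>t. t \<in> {0..T} \<Longrightarrow> norm (D' t) \<le> d'"
    using continuous_on_bounded_norm[OF lip_continuous[OF lip_D'] compact_Icc] by metis
  have "(\<lambda>n. integral {0..T} (\<lambda>t. x t * (D' t \<bullet> \<eta> n t + D t \<bullet> g n t)))
      \<longlonglongrightarrow> integral {0..T} (\<lambda>t. x t * (D' t \<bullet> HDH t + D t \<bullet> HDH' t))"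
  proof (rule dominated_convergence(2)[where h = "\<lambda>_. d' * (b + B * T) + d * B"])
    show "(\<lambda>t. x t * (D' t \<bullet> \<eta> n t + D t \<bullet> g n t)) integrable_on {0..T}" for n
    proof (intro x_weight_integrable)
      have "lip {0..T} (\<lambda>t. integral {0..t} (g n))"
        by (rule lip_integral(1)[OF g_int[OF T0(2)] g_bound])
      then have "lip {0..T} (\<eta> n)" unfolding \<eta>_def[abs_def] by (intro lip_add lip_const)
      then show "continuous_on {0..T} (\<lambda>t. D' t \<bullet> \<eta> n t + D t \<bullet> g n t)"
        by (intro continuous_on_add continuous_on_inner lip_continuous lip_D lip_D' g_lip)
    qed auto
    fix t assume t: "t \<in> {0..T}"
    show "norm (x t * (D' t \<bullet> \<eta> n t + D t \<bullet> g n t)) \<le> d' * (b + B * T) + d * B" for n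
    proof -
      have "\<bar>D' t \<bullet> \<eta> n t\<bar> \<le> d' * (b + B * T)"
        by (rule order_trans[OF Cauchy_Schwarz_ineq2 mult_mono])
           (use d'(2)[OF t] d'(1) \<eta>_bound[OF t] in auto)
      moreover have "\<bar>D t \<bullet> g n t\<bar> \<le> d * B"
        by (rule order_trans[OF Cauchy_Schwarz_ineq2 mult_mono])
           (use d(2)[OF t] d(1) g_bound[OF t] in auto)
      ultimately have "\<bar>D' t \<bullet> \<eta> n t + D t \<bullet> g n t\<bar> \<le> d' * (b + B * T) + d * B" by linarith
      then have "\<bar>x t\<bar> * \<bar>D' t \<bullet> \<eta> n t + D t \<bullet> g n t\<bar> \<le> 1 * (d' * (b + B * T) + d * B)"
        using x01[of t] t T_bounds by (intro mult_mono) auto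
      then show ?thesis by (simp add: abs_mult)
    qed
    show "(\<lambda>n. x t * (D' t \<bullet> \<eta> n t + D t \<bullet> g n t)) \<longlonglongrightarrow> x t * (D' t \<bullet> HDH t + D t \<bullet> HDH' t)"
      by (intro tendsto_intros \<eta>_lim g_lim t)
  qed auto
  then have "(\<lambda>n. variation (\<eta> n) (g n)) \<longlonglongrightarrow> variation HDH HDH'"
    unfolding variation_def by (intro tendsto_intros \<eta>_lim T0)
  then show ?thesis by (rule LIMSEQ_le_const2) (use neg in auto)
qed

text \<open>Writing \<open>\<mu>\<close> for the measure of the order parameter, integration by parts turns the hypothesis
  into \<open>\<integral> f d\<mu> \<le> 0\<close>.\<close>

lemma nonneg_zero_on_support:
  fixes f f' :: "real \<Rightarrow> real"
  assumes f: "continuous_on {0..T} f" "\<And>t. t \<in> {0..T} \<Longrightarrow> 0 \<le> f t"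
    and f': "\<And>s t. 0 \<le> s \<Longrightarrow> s \<le> t \<Longrightarrow> t \<le> T \<Longrightarrow> (f' has_integral f t - f s) {s..t}"
    and xf': "(\<lambda>t. x t * f' t) integrable_on {0..T}"
    and C: "\<And>t. t \<in> {0..T} \<Longrightarrow> \<bar>f' t\<bar> \<le> C"
    and le: "f T - integral {0..T} (\<lambda>t. x t * f' t) \<le> 0"
    and t0: "t0 \<in> measure_support (parisi_measure m x)"
  shows "f t0 = 0"
proof (rule ccontr)
  assume "f t0 \<noteq> 0"
  have t0T: "t0 \<in> {0..T}" by (rule support_subset[OF t0])
  define \<kappa> where "\<kappa> = f t0 / 2"
  have \<kappa>: "0 < \<kappa>" "\<kappa> < f t0" using f(2)[OF t0T] \<open>f t0 \<noteq> 0\<close> by (simp_all add: \<kappa>_def)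
  have C0: "0 \<le> C" using C[of 0] T_bounds by force
  have int: "(\<lambda>t. x t * f' t) integrable_on {s..t}" if "0 \<le> s" "t \<le> T" for s t
    by (rule integrable_on_subinterval[OF xf']) (use that in auto)
  have x_le: "x s \<le> x t" if "0 \<le> s" "s \<le> t" "t \<le> T" for s t
    using that T_bounds by (intro mono_onD[OF x_mono]) auto
  \<comment> \<open>The integral of \<open>f\<close> over \<open>[0, t]\<close> against \<mu>,
    integrated by parts; the atom at 0 is included as \<open>V 0 = x 0 * f 0\<close>.\<close>
  define V where "V t = x t * f t - integral {0..t} (\<lambda>u. x u * f' u)" for t
  \<comment> \<open>The increment of \<open>V\<close> is a Stieltjes integral; replacing
    \<open>f\<close> by its value at the right end costs a product of two increments, as
    \<open>subdivision_mono\<close> allows.\<close>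
  have V: "(x t - x s) * f t - C * (x t - x s) * (t - s) \<le> V t - V s" if st: "0 \<le> s" "s \<le> t" "t \<le> T" for s t
  proof -
    have "integral {0..s} (\<lambda>u. x u * f' u) + integral {s..t} (\<lambda>u. x u * f' u) = integral {0..t} (\<lambda>u. x u * f' u)"
      using st by (intro integral_combine_Icc int) auto
    moreover have i: "((\<lambda>u. x u * f' u - x s * f' u) has_integral
        integral {s..t} (\<lambda>u. x u * f' u) - x s * (f t - f s)) {s..t}"
      using st by (intro has_integral_diff has_integral_mult_right integrable_integral int f') auto
    moreover have "integral {s..t} (\<lambda>u. x u * f' u) - x s * (f t - f s) \<le> integral {s..t} (\<lambda>_. (x t - x s) * C)"
    proof (rule has_integral_le[OF i])
      show "((\<lambda>_. (x t - x s) * C) has_integral integral {s..t} (\<lambda>_. (x t - x s) * C)) {s..t}"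
        by (intro integrable_integral integrable_const_ivl)
      fix u assume u: "u \<in> {s..t}"
      have "(x u - x s) * f' u \<le> (x u - x s) * C"
        using u st C[of u] x_le[of s u] by (intro mult_left_mono) auto
      also have "\<dots> \<le> (x t - x s) * C"
        using u st x_le[of u t] C0 by (intro mult_right_mono) auto
      finally show "x u * f' u - x s * f' u \<le> (x t - x s) * C" by (simp add: algebra_simps)
    qed
    ultimately show ?thesis using st by (simp add: V_def algebra_simps)
  qed
  have V_mono: "V s \<le> V t" if st: "0 \<le> s" "s \<le> t" "t \<le> T" for s t
  proof (rule subdivision_mono[OF st(2) C0])
    fix u v assume uv: "s \<le> u" "u \<le> v" "v \<le> t"
    then show "x u \<le> x v" using st by (intro x_le) auto
    then have "0 \<le> (x v - x u) * f v" using uv st f(2)[of v] by (intro mult_nonneg_nonneg) auto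
    then show "- C * (x v - x u) * (v - u) \<le> V v - V u" using V[of u v] uv st by simp
  qed
  have V0: "V 0 = x 0 * f 0" by (simp add: V_def)
  have V0_nonneg: "0 \<le> V 0" using V0 f(2)[of 0] x01[of 0] T_bounds by simp
  have "V T \<le> 0" using le by (simp add: V_def x_T)
  then have V_zero: "V t = 0" if "t \<in> {0..T}" for t
    using V_mono[of 0 t] V_mono[of t T] V0_nonneg that by simp
  obtain r where r: "0 < r" "\<And>t. t \<in> {0..T} \<Longrightarrow> dist t t0 \<le> r \<Longrightarrow> \<kappa> < f t"
  proof -
    have "((f \<longlongrightarrow> f t0) (at t0 within {0..T}))" using f(1) t0T by (simp add: continuous_on)
    then have "\<forall>\<^sub>F t in at t0 within {0..T}. \<kappa> < f t" using \<kappa>(2) by (rule order_tendstoD(1))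
    then obtain d where d: "0 < d" "\<And>t. t \<in> {0..T} \<Longrightarrow> t \<noteq> t0 \<Longrightarrow> dist t t0 < d \<Longrightarrow> \<kappa> < f t"
      unfolding eventually_at by auto
    show thesis
    proof (rule that[of "d / 2"])
      show "0 < d / 2" using d by simp
      fix t assume "t \<in> {0..T}" "dist t t0 \<le> d / 2"
      then show "\<kappa> < f t" using d \<kappa>(2) by (cases "t = t0") auto
    qed
  qed
  define s t where "s = max 0 (t0 - r)" and "t = min T (t0 + r)"
  have st: "0 \<le> s" "s \<le> t0" "t0 \<le> t" "t \<le> T" using t0T r(1) by (auto simp: s_def t_def)
  have near: "\<kappa> < f u" if "u \<in> {s..t}" for u
    using that st by (intro r(2)) (auto simp: s_def t_def dist_real_def abs_le_iff)
  \<comment> \<open>Near \<open>t0\<close> the density \<open>f\<close> exceeds \<kappa>, so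
    \<open>V\<close> grows at least \<kappa> times as fast as \<open>x\<close>. Since
    \<open>V\<close> vanishes identically, \<open>x\<close> cannot grow there at all.\<close>
  have "V s - \<kappa> * x s \<le> V t - \<kappa> * x t"
  proof (rule subdivision_mono[OF _ C0, where V = "\<lambda>u. V u - \<kappa> * x u" and X = x])
    show "s \<le> t" using st by simp
    fix u v assume uv: "s \<le> u" "u \<le> v" "v \<le> t"
    then show "x u \<le> x v" using st by (intro x_le) auto
    then have "0 \<le> (x v - x u) * (f v - \<kappa>)" using near[of v] uv by (intro mult_nonneg_nonneg) auto
    then show "- C * (x v - x u) * (v - u) \<le> V v - \<kappa> * x v - (V u - \<kappa> * x u)"
      using V[of u v] uv st by (simp add: algebra_simps)
  qed
  then have "\<kappa> * x t \<le> \<kappa> * x s" using V_zero[of s] V_zero[of t] st by simp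
  then have x_st: "x t \<le> x s" using \<kappa>(1) by simp
  have "X (t0 + r) = x t"
    using X_after[of "t0 + r"] x_T X_eq[of "t0 + r"] t0T r(1) T_bounds by (auto simp: t_def min_def)
  moreover have "x s \<le> X (t0 - r)"
  proof (cases "0 \<le> t0 - r")
    case True
    then show ?thesis using X_eq[of s] t0T r(1) T_bounds by (simp add: s_def)
  next
    case False
    \<comment> \<open>The window reaches below 0, where \<open>X\<close> is 0, so constancy of
      \<open>x\<close> on the window leaves an atom at 0 possible. It is excluded by
      \<open>V 0 = 0\<close> together with \<open>f 0 > 0\<close>.\<close>
    then have "s = 0" by (simp add: s_def)
    then have "0 < f 0" using near[of 0] st \<kappa>(1) by simp
    then have "x 0 = 0" using V_zero[of 0] V0 T_bounds by simp
    then show ?thesis using \<open>s = 0\<close> X01[of "t0 - r"] by simp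
  qed
  ultimately have "X (t0 + r) \<le> X (t0 - r)" using x_st by simp
  then show False using t0[unfolded support_iff, rule_format, OF r(1)] by simp
qed

theorem stationarity:
  assumes minimal: "\<And>y \<Psi>. admissible Q y \<Psi> \<Longrightarrow> crisanti_sommers \<beta> h x \<Phi> \<le> crisanti_sommers \<beta> h y \<Psi>"
    and t: "t \<in> measure_support (parisi_measure m x)"
  shows "D t = 0"
proof -
  define f where "f t = D t \<bullet> HDH t" for t
  define f' where "f' t = D t \<bullet> HDH' t + D' t \<bullet> HDH t" for t
  have f_lip: "lip {0..T} f" unfolding f_def[abs_def] by (intro lip_inner compact_Icc lip_D lip_HDH)
  have f_ge: "c\<^sup>2 * (D t \<bullet> D t) \<le> f t" if "t \<in> {0..T}" for t
    unfolding f_def HDH_def using c_pos by (intro pd_by_congruence_inner D_sym H_pd that) auto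
  have fi: "(f' has_integral f t - f s) {s..t}" if st: "0 \<le> s" "s \<le> t" "t \<le> T" for s t
  proof (rule fundamental_theorem_of_calculus_right[OF st(2)])
    show "lip {s..t} f" using st by (intro lip_subset[OF f_lip]) auto
    fix u assume "s \<le> u" "u < t"
    then show "(f has_vector_derivative f' u) (at_right u)"
      unfolding f_def[abs_def] f'_def has_real_derivative_iff_has_vector_derivative[symmetric] using st
      by (intro has_real_derivative_inner HDH_right_deriv at_right_of_within[OF D_deriv]) auto
  qed
  define A where "A t = D t \<bullet> (H t ** K' t ** H t - \<phi> t) + D' t \<bullet> HDH t" for t
  define E where "E t = D t \<bullet> (\<phi> t ** D t ** H t + H t ** D t ** \<phi> t)" for t
  have f'_eq: "f' t = A t - x t * E t" for t
    by (simp add: f'_def A_def E_def HDH'_def inner_diff_right)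
  have cont: "continuous_on {0..T} A" "continuous_on {0..T} E"
    unfolding A_def[abs_def] E_def[abs_def]
    by (intro lip_continuous lip_add lip_diff lip_inner lip_matrix_mult compact_Icc lip_HT lip_D lip_D' lip_K' lip_\<phi> lip_HDH)+
  obtain p where p: "0 < p" "\<And>t. t \<in> {0..T} \<Longrightarrow> norm (A t) \<le> p"
    using continuous_on_bounded_norm[OF cont(1) compact_Icc] by metis
  obtain r where r: "0 < r" "\<And>t. t \<in> {0..T} \<Longrightarrow> norm (E t) \<le> r"
    using continuous_on_bounded_norm[OF cont(2) compact_Icc] by metis
  have f'_bound: "\<bar>f' t\<bar> \<le> p + 1 * r" if "t \<in> {0..T}" for t
  proof -
    have "\<bar>x t * E t\<bar> \<le> 1 * r"
      unfolding abs_mult using x01[of t] r(2)[OF that] that T_bounds by (intro mult_mono) auto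
    then show ?thesis using p(2)[OF that] unfolding f'_eq real_norm_def by linarith
  qed
  have "f t = 0"
  proof (rule nonneg_zero_on_support[OF _ _ fi _ f'_bound _ t])
    show "continuous_on {0..T} f" by (rule lip_continuous[OF f_lip])
    show "0 \<le> f t" if "t \<in> {0..T}" for t
      by (rule order_trans[OF _ f_ge[OF that]]) simp
    \<comment> \<open>The derivative of \<open>HDH\<close> already contains a factor
      \<open>x\<close>, so the weighted integrand involves its square, which is again monotone
      because \<open>x\<close> is nonnegative.\<close>
    have "mono_on {0..T} (\<lambda>t. x t * x t)"
      using x01 T_bounds by (intro mono_onI mult_mono mono_onD[OF x_mono]) auto
    then have "(\<lambda>t. (x t * x t) * E t) integrable_on {0..T}"
      using mono_scaleR_integrable[OF _ cont(2), of "\<lambda>t. x t * x t"] by simp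
    then have "(\<lambda>t. x t * A t - (x t * x t) * E t) integrable_on {0..T}"
      by (intro integrable_diff x_weight_integrable cont) auto
    then show "(\<lambda>t. x t * f' t) integrable_on {0..T}" by (simp add: f'_eq algebra_simps)
    show "f T - integral {0..T} (\<lambda>t. x t * f' t) \<le> 0"
      using variation_HDH[OF minimal] by (simp add: variation_def f_def f'_def add.commute)
  qed
  then have "c\<^sup>2 * (D t \<bullet> D t) \<le> 0" using f_ge[OF support_subset[OF t]] by simp
  then have "D t \<bullet> D t \<le> 0" using c_pos by (simp add: mult_le_0_iff )
  then have "D t \<bullet> D t = 0" using inner_ge_zero[of "D t"] by linarith
  then show ?thesis by simp
qed

end

theorem theorem13:
  fixes \<beta> :: "nat \<Rightarrow> real ^ 'n" and h :: "real ^ 'n" and Q :: "real ^ 'n ^ 'n"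
    and x :: "real \<Rightarrow> real" and \<Phi> :: "real \<Rightarrow> real ^ 'n ^ 'n" and t :: real
  assumes "\<And>p. 2 \<le> p \<Longrightarrow> odd p \<Longrightarrow> \<beta> p = 0"
    and "\<And>j. (\<lambda>p. 2 ^ p * (\<beta> p $ j)\<^sup>2) summable_on {2..}"
    and "psd Q"
    and "\<And>i j. Q $ i $ j \<in> {-1..1}"
    and "\<And>i. Q $ i $ i = 1"
    and "cs_minimizer Q \<beta> h x \<Phi>"
    and "t \<in> measure_support (parisi_measure (real CARD('n)) x)"
  shows "xi' \<beta> (\<Phi> t) + outer_prod h h
           = integral {0..t} (\<lambda>s. matrix_inv (hat_path x \<Phi> s) ** path_deriv \<Phi> s
                                    ** matrix_inv (hat_path x \<Phi> s))"
proof -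
  interpret cs_pair \<beta> h Q "real CARD('n)" x \<Phi>
    using assms by unfold_locales (auto simp: cs_minimizer_def)
  have "D t = 0"
    using assms(6,7) by (intro stationarity) (auto simp: cs_minimizer_def)
  moreover have "M t = integral {0..t} (\<lambda>s. matrix_inv (hat_path x \<Phi> s) ** path_deriv \<Phi> s
                                    ** matrix_inv (hat_path x \<Phi> s))"
    unfolding M_def using support_subset[OF assms(7)] T_bounds
    by (intro integral_cong) (simp add: M'_def Hi_def \<phi>_eq)
  ultimately show ?thesis by (simp add: D_def xi_field_def)
qed

end
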